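(* Let $\Sigma$ be a signed alphabet. Let $\mathrm{Col}_3(\Sigma)$ be the extended presentation obtained from the rewriting system $\mathrm{Col}_2(\Sigma)$ by adjoining one 3-cell $\mathcal{X}_{u,v,t}$ for every triple $u,v,t$ of nonempty super columns such that neither $(u,v)$ nor $(v,t)$ is juxtaposable. The 3-cell $\mathcal{X}_{u,v,t}$ goes from the 2-cell $$(\gamma_{u,v}c_t)\star_1(c_e\gamma_{e',t})\star_1(\gamma_{e,b}c_{b'}):\ c_uc_vc_t\Rightarrow c_ec_{e'}c_t\Rightarrow c_ec_bc_{b'}\Rightarrow c_ac_dc_{b'}$$ to the 2-cell $$(c_u\gamma_{v,t})\star_1(\gamma_{u,w}c_{w'})\star_1(c_a\gamma_{a',w'}):\ c_uc_vc_t\Rightarrow c_uc_wc_{w'}\Rightarrow c_ac_{a'}c_{w'}\Rightarrow c_ac_dc_{b'}.$$ The columns appearing here are as follows: - $e,e'$ are the column readings of $[uv]_r$; - $w,w'$ are the column readings of $[vt]_r$; - $a,a'$ are the column readings of $[uw]_r$; - $b,b'$ are the column readings of $[e't]_r$; - $a,d,b'$ are the readings of the three columns of $[uvt]_r$. Any of these columns may be empty, in which case $c_{\text{empty}}$ is the empty word; any indicated step $\gamma_{p,q}$ with $p$ or $q$ empty, or with $(p,q)$ juxtaposable, is an identity. Then $\mathrm{Col}_3(\Sigma)$ is a coherent presentation of the super plactic monoid $\mathbf{P}(\Sigma)$.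
   Context: A signed alphabet is a finite or countable totally ordered set $\Sigma$ with $\|\cdot\|:\Sigma\to\mathbb{Z}_2$; $\Sigma_0=\|\cdot\|^{-1}(0)$, $\Sigma_1=\|\cdot\|^{-1}(1)$. A super column is a word $x_1\ldots x_k$ over $\Sigma$ with $x_{i+1}\le x_i$, where equality is allowed only if $\|x_i\|=1$. A super tableau is a filling $T$ of a Young diagram by elements of $\Sigma$ such that: - $T(i,j)\le T(i,j+1)$, with equality only if $\|T(i,j)\|=0$; - $T(i,j)\le T(i+1,j)$, with equality only if $\|T(i,j)\|=1$. Column readings list the entries bottom to top, and the columns of a tableau are listed left to right. Right insertion $t\leftarrow x$ works as follows. - If $x\in\Sigma_0$ (resp. $\Sigma_1$) is $\ge$ (resp. $>$) the last entry of the top row, append it to that row. - Otherwise, $x$ replaces the smallest entry $y$ of the top row with $y>x$ (resp. $y\ge x$), and $y$ is inserted likewise into the next row (a new row if none). $[w]_r$ is obtained by inserting the letters of $w$ left to right into the empty tableau. Super columns $u=x_1\ldots x_p$, $v=y_1\ldots y_q$ are called juxtaposable if $p\ge q$ and $x_i\le y_i$ for all $i\le q$, with $x_i=y_i$ only if $\|x_i\|=0$ (i.e. the topmost juxtaposition of $[u]_r$, $[v]_r$ is a super tableau). $\mathrm{Col}_2(\Sigma)$ is the rewriting system on generators $c_u$ ($u$ a nonempty super column) with rules $\gamma_{u,v}:c_uc_v\Rightarrow c_wc_{w'}$ for each non-juxtaposable pair $(u,v)$. Here $w,w'$ are the readings of the left and right columns of $[uv]_r$ if it has two columns; otherwise $w=uv$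 and $c_{w'}$ is empty. $\mathbf{P}(\Sigma)$ is $\Sigma^*$ modulo the congruence generated by the following relations: - $zxy=xzy$ for $x\le y\le z$, with $x=y$ only if $\|y\|=0$ and $y=z$ only if $\|y\|=1$; - $yzx=yxz$ for $x\le y\le z$, with $x=y$ only if $\|y\|=1$ and $y=z$ only if $\|y\|=0$. Given a rewriting system (2-polygraph) $\Sigma_2$ presenting a monoid $\mathbf{M}$, let $\Sigma_2^\top$ be the free $(2,1)$-category it generates: its 2-cells are composites of rewriting steps and their formal inverses. An extended presentation is such a $\Sigma_2$ together with a set $\Sigma_3$ of 3-cells, each relating two parallel 2-cells of $\Sigma_2^\top$. It is a coherent presentation of $\mathbf{M}$ if $\Sigma_3$ is a homotopy basis: for every pair of parallel 2-cells $f,g$ of $\Sigma_2^\top$ (same source and same target), there is a 3-cell from $f$ to $g$ in the free $(3,1)$-category generated by $(\Sigma_2,\Sigma_3)$. *)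

theory Defs
  imports "HOL-Algebra.Group" "HOL-Library.Countable_Set" "HOL-Library.Z2"
begin

inductive_set word_cong :: "'x set \<Rightarrow> ('x list \<times> 'x list) set \<Rightarrow> ('x list \<times> 'x list) set"
  for X :: "'x set" and R :: "('x list \<times> 'x list) set" where
  base: "(l, r) \<in> R \<Longrightarrow> (l, r) \<in> word_cong X R"
| refl: "w \<in> lists X \<Longrightarrow> (w, w) \<in> word_cong X R"
| sym: "(w, w') \<in> word_cong X R \<Longrightarrow> (w', w) \<in> word_cong X R"
| trans: "(w, w') \<in> word_cong X R \<Longrightarrow> (w', w'') \<in> word_cong X R \<Longrightarrow> (w, w'') \<in> word_cong X R"
| mult: "(w, w') \<in> word_cong X R \<Longrightarrow> (z, z') \<in> word_cong X R \<Longrightarrow>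
    (w @ z, w' @ z') \<in> word_cong X R"

definition presented_monoid :: "'x set \<Rightarrow> ('x list \<times> 'x list) set \<Rightarrow> 'x list set monoid" where
  "presented_monoid X R =
    \<lparr>carrier = lists X // word_cong X R,
     monoid.mult = (\<lambda>A B. \<Union>a\<in>A. \<Union>b\<in>B. word_cong X R `` {a @ b}),
     one = word_cong X R `` {[]}\<rparr>"

text \<open>Two-polygraphs with a single 0-cell. The 1-cells are the words over the generators.\<close>

record ('x, 'r) polygraph2 =
  gens :: "'x set"
  rules :: "'r set"
  rsrc :: "'r \<Rightarrow> 'x list"
  rtgt :: "'r \<Rightarrow> 'x list"

definition wf_polygraph2 :: "('x, 'r, 'z) polygraph2_scheme \<Rightarrow> bool" where
  "wf_polygraph2 P \<longleftrightarrow> (\<forall>r\<in>rules P. rsrc P r \<in> lists (gens P) \<and> rtgt P r \<in> lists (gens P))"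

definition polygraph_monoid :: "('x, 'r, 'z) polygraph2_scheme \<Rightarrow> 'x list set monoid" where
  "polygraph_monoid P = presented_monoid (gens P) {(rsrc P r, rtgt P r) | r. r \<in> rules P}"

text \<open>The 2-cells of the free (2,1)-category are the well-formed expressions below modulo
  the congruence \<open>eq2\<close>. Here \<open>Comp2_0\<close> is the composition along the 0-cell
  (juxtaposition of words) and \<open>Comp2_1\<close> the composition along 1-cells, both in diagrammatic
  order. The latter is written with a star and index 1 in the literature.\<close>

datatype ('x, 'r) cell2 =
    Gen2 'r
  | Id2 "'x list"
  | Inv2 "('x, 'r) cell2"
  | Comp2_0 "('x, 'r) cell2" "('x, 'r) cell2"
  | Comp2_1 "('x, 'r) cell2" "('x, 'r) cell2"

fun src2 and tgt2 :: "('x, 'r, 'z) polygraph2_scheme \<Rightarrow> ('x, 'r) cell2 \<Rightarrow> 'x list" where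
  "src2 P (Gen2 r) = rsrc P r"
| "src2 P (Id2 w) = w"
| "src2 P (Inv2 f) = tgt2 P f"
| "src2 P (Comp2_0 f g) = src2 P f @ src2 P g"
| "src2 P (Comp2_1 f g) = src2 P f"
| "tgt2 P (Gen2 r) = rtgt P r"
| "tgt2 P (Id2 w) = w"
| "tgt2 P (Inv2 f) = src2 P f"
| "tgt2 P (Comp2_0 f g) = tgt2 P f @ tgt2 P g"
| "tgt2 P (Comp2_1 f g) = tgt2 P g"

fun wf2 :: "('x, 'r, 'z) polygraph2_scheme \<Rightarrow> ('x, 'r) cell2 \<Rightarrow> bool" where
  "wf2 P (Gen2 r) \<longleftrightarrow> r \<in> rules P"
| "wf2 P (Id2 w) \<longleftrightarrow> w \<in> lists (gens P)"
| "wf2 P (Inv2 f) \<longleftrightarrow> wf2 P f"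
| "wf2 P (Comp2_0 f g) \<longleftrightarrow> wf2 P f \<and> wf2 P g"
| "wf2 P (Comp2_1 f g) \<longleftrightarrow> wf2 P f \<and> wf2 P g \<and> tgt2 P f = src2 P g"

definition hom2 :: "('x, 'r, 'z) polygraph2_scheme \<Rightarrow> 'x list \<Rightarrow> 'x list \<Rightarrow> ('x, 'r) cell2 set" where
  "hom2 P x y = {f. wf2 P f \<and> src2 P f = x \<and> tgt2 P f = y}"

definition parallel2 :: "('x, 'r, 'z) polygraph2_scheme \<Rightarrow> ('x, 'r) cell2 \<Rightarrow> ('x, 'r) cell2 \<Rightarrow> bool" where
  "parallel2 P f g \<longleftrightarrow> wf2 P f \<and> wf2 P g \<and> src2 P f = src2 P g \<and> tgt2 P f = tgt2 P g"

text \<open>Equality of 2-cells in the free (2,1)-category: the axioms of a 2-category together with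
  invertibility of 2-cells.\<close>

inductive eq2 :: "('x, 'r, 'z) polygraph2_scheme \<Rightarrow> ('x, 'r) cell2 \<Rightarrow> ('x, 'r) cell2 \<Rightarrow> bool"
  for P :: "('x, 'r, 'z) polygraph2_scheme" where
  refl: "wf2 P f \<Longrightarrow> eq2 P f f"
| sym: "eq2 P f g \<Longrightarrow> eq2 P g f"
| trans: "eq2 P f g \<Longrightarrow> eq2 P g h \<Longrightarrow> eq2 P f h"
| cong_Inv: "eq2 P f f' \<Longrightarrow> eq2 P (Inv2 f) (Inv2 f')"
| cong_0: "eq2 P f f' \<Longrightarrow> eq2 P g g' \<Longrightarrow> eq2 P (Comp2_0 f g) (Comp2_0 f' g')"
| cong_1: "eq2 P f f' \<Longrightarrow> eq2 P g g' \<Longrightarrow> tgt2 P f = src2 P g \<Longrightarrow>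
    eq2 P (Comp2_1 f g) (Comp2_1 f' g')"
| assoc_1: "wf2 P (Comp2_1 (Comp2_1 f g) h) \<Longrightarrow>
    eq2 P (Comp2_1 (Comp2_1 f g) h) (Comp2_1 f (Comp2_1 g h))"
| left_unit_1: "wf2 P f \<Longrightarrow> eq2 P (Comp2_1 (Id2 (src2 P f)) f) f"
| right_unit_1: "wf2 P f \<Longrightarrow> eq2 P (Comp2_1 f (Id2 (tgt2 P f))) f"
| right_inv_1: "wf2 P f \<Longrightarrow> eq2 P (Comp2_1 f (Inv2 f)) (Id2 (src2 P f))"
| left_inv_1: "wf2 P f \<Longrightarrow> eq2 P (Comp2_1 (Inv2 f) f) (Id2 (tgt2 P f))"
| assoc_0: "wf2 P f \<Longrightarrow> wf2 P g \<Longrightarrow> wf2 P h \<Longrightarrow>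
    eq2 P (Comp2_0 (Comp2_0 f g) h) (Comp2_0 f (Comp2_0 g h))"
| left_unit_0: "wf2 P f \<Longrightarrow> eq2 P (Comp2_0 (Id2 []) f) f"
| right_unit_0: "wf2 P f \<Longrightarrow> eq2 P (Comp2_0 f (Id2 [])) f"
| id_0: "w \<in> lists (gens P) \<Longrightarrow> w' \<in> lists (gens P) \<Longrightarrow>
    eq2 P (Comp2_0 (Id2 w) (Id2 w')) (Id2 (w @ w'))"
| interchange: "wf2 P (Comp2_1 f g) \<Longrightarrow> wf2 P (Comp2_1 h k) \<Longrightarrow>
    eq2 P (Comp2_0 (Comp2_1 f g) (Comp2_1 h k)) (Comp2_1 (Comp2_0 f h) (Comp2_0 g k))"

record ('x, 'r, 'g) polygraph3 = "('x, 'r) polygraph2" +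
  cells3 :: "'g set"
  gsrc :: "'g \<Rightarrow> ('x, 'r) cell2"
  gtgt :: "'g \<Rightarrow> ('x, 'r) cell2"

definition extended_presentation :: "('x, 'r, 'g, 'z) polygraph3_scheme \<Rightarrow> bool" where
  "extended_presentation P \<longleftrightarrow>
    wf_polygraph2 P \<and> (\<forall>A\<in>cells3 P. parallel2 P (gsrc P A) (gtgt P A))"

text \<open>Expressions for the 3-cells of the free (3,1)-category, with their source and target
  2-cells. The 3-cells themselves are the classes of well-formed expressions modulo the axioms of
  (3,1)-categories. These axioms only identify 3-cells with equal source and target, so they play no
  role in the question whether a 3-cell between two given 2-cells exists, and are not
  spelled out. Source and target are 2-cells, that is, they matter only up to \<open>eq2\<close>; this is
  taken into account in the composability condition of \<open>Comp3_2\<close> and in \<open>hom3\<close>.\<close>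

datatype ('x, 'r, 'g) cell3 =
    Gen3 'g
  | Id3 "('x, 'r) cell2"
  | Inv3 "('x, 'r, 'g) cell3"
  | Comp3_0 "('x, 'r, 'g) cell3" "('x, 'r, 'g) cell3"
  | Comp3_1 "('x, 'r, 'g) cell3" "('x, 'r, 'g) cell3"
  | Comp3_2 "('x, 'r, 'g) cell3" "('x, 'r, 'g) cell3"

fun src3 and tgt3 ::
  "('x, 'r, 'g, 'z) polygraph3_scheme \<Rightarrow> ('x, 'r, 'g) cell3 \<Rightarrow> ('x, 'r) cell2" where
  "src3 P (Gen3 A) = gsrc P A"
| "src3 P (Id3 f) = f"
| "src3 P (Inv3 F) = tgt3 P F"
| "src3 P (Comp3_0 F G) = Comp2_0 (src3 P F) (src3 P G)"
| "src3 P (Comp3_1 F G) = Comp2_1 (src3 P F) (src3 P G)"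
| "src3 P (Comp3_2 F G) = src3 P F"
| "tgt3 P (Gen3 A) = gtgt P A"
| "tgt3 P (Id3 f) = f"
| "tgt3 P (Inv3 F) = src3 P F"
| "tgt3 P (Comp3_0 F G) = Comp2_0 (tgt3 P F) (tgt3 P G)"
| "tgt3 P (Comp3_1 F G) = Comp2_1 (tgt3 P F) (tgt3 P G)"
| "tgt3 P (Comp3_2 F G) = tgt3 P G"

fun wf3 :: "('x, 'r, 'g, 'z) polygraph3_scheme \<Rightarrow> ('x, 'r, 'g) cell3 \<Rightarrow> bool" where
  "wf3 P (Gen3 A) \<longleftrightarrow> A \<in> cells3 P"
| "wf3 P (Id3 f) \<longleftrightarrow> wf2 P f"
| "wf3 P (Inv3 F) \<longleftrightarrow> wf3 P F"
| "wf3 P (Comp3_0 F G) \<longleftrightarrow> wf3 P F \<and> wf3 P G"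
| "wf3 P (Comp3_1 F G) \<longleftrightarrow> wf3 P F \<and> wf3 P G \<and> tgt2 P (src3 P F) = src2 P (src3 P G)"
| "wf3 P (Comp3_2 F G) \<longleftrightarrow> wf3 P F \<and> wf3 P G \<and> eq2 P (tgt3 P F) (src3 P G)"

definition hom3 :: "('x, 'r, 'g, 'z) polygraph3_scheme \<Rightarrow> ('x, 'r) cell2 \<Rightarrow> ('x, 'r) cell2 \<Rightarrow>
    ('x, 'r, 'g) cell3 set" where
  "hom3 P f g = {F. wf3 P F \<and> eq2 P (src3 P F) f \<and> eq2 P (tgt3 P F) g}"

definition homotopy_basis :: "('x, 'r, 'g, 'z) polygraph3_scheme \<Rightarrow> bool" where
  "homotopy_basis P \<longleftrightarrow> (\<forall>f g. parallel2 P f g \<longrightarrow> hom3 P f g \<noteq> {})"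

definition coherent_presentation ::
  "('x, 'r, 'g, 'z) polygraph3_scheme \<Rightarrow> ('m, 'n) monoid_scheme \<Rightarrow> bool" where
  "coherent_presentation P M \<longleftrightarrow>
    extended_presentation P \<and> polygraph_monoid P \<cong> M \<and> homotopy_basis P"

text \<open>A signed alphabet is a countable set \<open>S\<close> of elements of a linear order together with a sign
  map \<open>sg\<close> into the integers modulo 2; only the values of \<open>sg\<close> on \<open>S\<close> matter.\<close>

definition super_column :: "('a::linorder \<Rightarrow> bit) \<Rightarrow> 'a list \<Rightarrow> bool" where
  "super_column sg u \<longleftrightarrow> successively (\<lambda>x y. y \<le> x \<and> (y = x \<longrightarrow> sg x = 1)) u"

text \<open>Tableaux are lists of rows, the top row first. An inserted letter \<open>x\<close> displaces the leftmost
  entry \<open>y\<close> with \<open>bumps sg x y\<close>, which is the smallest such entry since rows are weakly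
  increasing.\<close>

definition bumps :: "('a::linorder \<Rightarrow> bit) \<Rightarrow> 'a \<Rightarrow> 'a \<Rightarrow> bool" where
  "bumps sg x y \<longleftrightarrow> (if sg x = 0 then x < y else x \<le> y)"

fun row_insert :: "('a::linorder \<Rightarrow> bit) \<Rightarrow> 'a list \<Rightarrow> 'a \<Rightarrow> 'a list \<times> 'a option" where
  "row_insert sg [] x = ([x], None)"
| "row_insert sg (y # ys) x =
    (if bumps sg x y then (x # ys, Some y)
     else (let (ys', z) = row_insert sg ys x in (y # ys', z)))"

fun right_insert :: "('a::linorder \<Rightarrow> bit) \<Rightarrow> 'a list list \<Rightarrow> 'a \<Rightarrow> 'a list list" where
  "right_insert sg [] x = [[x]]"
| "right_insert sg (r # T) x =
    (case row_insert sg r x of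
      (r', None) \<Rightarrow> r' # T
    | (r', Some y) \<Rightarrow> r' # right_insert sg T y)"

definition insert_word :: "('a::linorder \<Rightarrow> bit) \<Rightarrow> 'a list \<Rightarrow> 'a list list" where
  "insert_word sg w = foldl (right_insert sg) [] w"

definition n_columns :: "'a list list \<Rightarrow> nat" where
  "n_columns T = (case T of [] \<Rightarrow> 0 | r # _ \<Rightarrow> length r)"

text \<open>Reading, from bottom to top, of the \<open>j\<close>-th column (counted from 0 on the left). It is empty
  if \<open>T\<close> has no such column.\<close>

definition column_reading :: "'a list list \<Rightarrow> nat \<Rightarrow> 'a list" where
  "column_reading T j = rev [r ! j. r \<leftarrow> T, j < length r]"

text \<open>In the topmost juxtaposition the entries are compared from the top, that is, from the end of
  the words \<open>u\<close> and \<open>v\<close>.\<close>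

definition juxtaposable :: "('a::linorder \<Rightarrow> bit) \<Rightarrow> 'a list \<Rightarrow> 'a list \<Rightarrow> bool" where
  "juxtaposable sg u v \<longleftrightarrow> length v \<le> length u \<and>
    (\<forall>i<length v. rev u ! i \<le> rev v ! i \<and> (rev u ! i = rev v ! i \<longrightarrow> sg (rev u ! i) = 0))"

definition left_col :: "('a::linorder \<Rightarrow> bit) \<Rightarrow> 'a list \<Rightarrow> 'a list \<Rightarrow> 'a list" where
  "left_col sg u v = (let T = insert_word sg (u @ v) in
    if n_columns T = 2 then column_reading T 0 else u @ v)"

definition right_col :: "('a::linorder \<Rightarrow> bit) \<Rightarrow> 'a list \<Rightarrow> 'a list \<Rightarrow> 'a list" where
  "right_col sg u v = (let T = insert_word sg (u @ v) in
    if n_columns T = 2 then column_reading T 1 else [])"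

definition super_plactic_relations ::
  "'a::linorder set \<Rightarrow> ('a \<Rightarrow> bit) \<Rightarrow> ('a list \<times> 'a list) set" where
  "super_plactic_relations S sg =
    {([z, x, y], [x, z, y]) | x y z. x \<in> S \<and> y \<in> S \<and> z \<in> S \<and> x \<le> y \<and> y \<le> z \<and>
       (x = y \<longrightarrow> sg y = 0) \<and> (y = z \<longrightarrow> sg y = 1)} \<union>
    {([y, z, x], [y, x, z]) | x y z. x \<in> S \<and> y \<in> S \<and> z \<in> S \<and> x \<le> y \<and> y \<le> z \<and>
       (x = y \<longrightarrow> sg y = 1) \<and> (y = z \<longrightarrow> sg y = 0)}"

definition super_plactic :: "'a::linorder set \<Rightarrow> ('a \<Rightarrow> bit) \<Rightarrow> 'a list set monoid" where
  "super_plactic S sg = presented_monoid S (super_plactic_relations S sg)"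

text \<open>The generator \<open>c\<^sub>u\<close> is the word \<open>u\<close> itself, seen as a letter. \<open>colgen u\<close> is the corresponding
  1-cell, which is the empty word if \<open>u\<close> is empty. The rule \<open>\<gamma>\<close> with indices \<open>u\<close>, \<open>v\<close> is named by
  the pair \<open>(u, v)\<close>.\<close>

definition colgen :: "'a list \<Rightarrow> 'a list list" where
  "colgen u = (if u = [] then [] else [u])"

definition columns :: "'a::linorder set \<Rightarrow> ('a \<Rightarrow> bit) \<Rightarrow> 'a list set" where
  "columns S sg = {u \<in> lists S. u \<noteq> [] \<and> super_column sg u}"

definition Col2 :: "'a::linorder set \<Rightarrow> ('a \<Rightarrow> bit) \<Rightarrow> ('a list, 'a list \<times> 'a list) polygraph2" where
  "Col2 S sg =
    \<lparr>gens = columns S sg,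
     rules = {(u, v). u \<in> columns S sg \<and> v \<in> columns S sg \<and> \<not> juxtaposable sg u v},
     rsrc = (\<lambda>(u, v). colgen u @ colgen v),
     rtgt = (\<lambda>(u, v). colgen (left_col sg u v) @ colgen (right_col sg u v))\<rparr>"

definition gamma :: "('a::linorder \<Rightarrow> bit) \<Rightarrow> 'a list \<Rightarrow> 'a list \<Rightarrow> ('a list, 'a list \<times> 'a list) cell2" where
  "gamma sg p q =
    (if p = [] \<or> q = [] \<or> juxtaposable sg p q then Id2 (colgen p @ colgen q) else Gen2 (p, q))"

definition X_src ::
  "('a::linorder \<Rightarrow> bit) \<Rightarrow> 'a list \<Rightarrow> 'a list \<Rightarrow> 'a list \<Rightarrow> ('a list, 'a list \<times> 'a list) cell2" where
  "X_src sg u v t =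
    (let e = left_col sg u v; e' = right_col sg u v;
         b = left_col sg e' t; b' = right_col sg e' t in
     Comp2_1 (Comp2_1
       (Comp2_0 (gamma sg u v) (Id2 (colgen t)))
       (Comp2_0 (Id2 (colgen e)) (gamma sg e' t)))
       (Comp2_0 (gamma sg e b) (Id2 (colgen b'))))"

definition X_tgt ::
  "('a::linorder \<Rightarrow> bit) \<Rightarrow> 'a list \<Rightarrow> 'a list \<Rightarrow> 'a list \<Rightarrow> ('a list, 'a list \<times> 'a list) cell2" where
  "X_tgt sg u v t =
    (let w = left_col sg v t; w' = right_col sg v t;
         a = left_col sg u w; a' = right_col sg u w in
     Comp2_1 (Comp2_1
       (Comp2_0 (Id2 (colgen u)) (gamma sg v t))
       (Comp2_0 (gamma sg u w) (Id2 (colgen w'))))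
       (Comp2_0 (Id2 (colgen a)) (gamma sg a' w')))"

definition Col3 :: "'a::linorder set \<Rightarrow> ('a \<Rightarrow> bit) \<Rightarrow>
    ('a list, 'a list \<times> 'a list, 'a list \<times> 'a list \<times> 'a list) polygraph3" where
  "Col3 S sg = polygraph2.extend (Col2 S sg)
    \<lparr>cells3 = {(u, v, t). u \<in> columns S sg \<and> v \<in> columns S sg \<and> t \<in> columns S sg \<and>
                \<not> juxtaposable sg u v \<and> \<not> juxtaposable sg v t},
     gsrc = (\<lambda>(u, v, t). X_src sg u v t),
     gtgt = (\<lambda>(u, v, t). X_tgt sg u v t)\<rparr>"

text \<open>The stated shape of the 3-cells: both boundary 2-cells end in the columns \<open>a\<close>, \<open>d\<close>, \<open>b'\<close> of the
  tableau of \<open>uvt\<close>, where \<open>a\<close> is also the left column of the tableau of \<open>uw\<close> and \<open>b'\<close> the right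
  column of the tableau of \<open>e't\<close>.\<close>

definition X_shape :: "'a::linorder set \<Rightarrow> ('a \<Rightarrow> bit) \<Rightarrow> 'a list \<Rightarrow> 'a list \<Rightarrow> 'a list \<Rightarrow> bool" where
  "X_shape S sg u v t \<longleftrightarrow>
    (let T = insert_word sg (u @ v @ t);
         a = column_reading T 0; d = column_reading T 1; b' = column_reading T 2;
         x = colgen u @ colgen v @ colgen t; y = colgen a @ colgen d @ colgen b' in
     n_columns T \<le> 3 \<and>
     a = left_col sg u (left_col sg v t) \<and>
     b' = right_col sg (right_col sg u v) t \<and>
     X_src sg u v t \<in> hom2 (Col2 S sg) x y \<and>
     X_tgt sg u v t \<in> hom2 (Col2 S sg) x y)"

end

theory Submission
  imports Defs
begin

text \<open>
  The two columns of \<open>[uv]\<close> arise from a matching: reading both columns from top to bottom, every entry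
  of \<open>u\<close> is matched with the first entry of \<open>v\<close> still available that may stand to its right; the
  matched entries form the right column and everything else the left one. Seen as a queue with arrivals
  \<open>u\<close> and services \<open>v\<close>, the right column consists of the departures. Two tandems of three such
  queues have the same output, which is the Yang--Baxter type relation underlying the 3-cells \<open>X\<close>.

  Hence inserting columns one after another gives a normal form \<open>N w\<close> of words over columns, namely the
  columns of the insertion tableau, together with a canonical 2-cell from \<open>w\<close> to \<open>N w\<close>. The 3-cells
  make these 2-cells natural with respect to every rule in every context, so every 2-cell is homotopic to
  the composite of the canonical cell of its source and the inverse of the one of its target. No
  termination argument is involved.
\<close>

section \<open>Bumping and the matching of two columns\<close>

text \<open>Two obstacles shape the proof. The 3-cells only need tandems whose queues start empty,
  but in that form the equality of the two outputs is not stable under induction: after one event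
  some queues are occupied. So \<open>braid\<close> treats all initial lengths on one side, with
  those on the other side computed from them. Lengths suffice as states because a waiting entry
  accepts every later service, so it is irrelevant which waiting entry is served. Secondly, 3-cells
  exist only for nonempty columns with both adjacent pairs non-juxtaposable, whereas naturality
  meets every triple. The other triples are settled by recognising an identity step from a single
  output column. Naturality itself is local: a rule applied to the left of a word \<open>w\<close>
  commutes with the normalization of \<open>w\<close>, and what remains is to insert its two columns
  into the normal form of \<open>w\<close>. There each 3-cell carries the comparison past one
  column.\<close>

lemma bumps_trans: "bumps sg x y \<Longrightarrow> bumps sg y z \<Longrightarrow> bumps sg x z"
  by (auto simp: bumps_def split: if_splits)

text \<open>A row step and a column step, in either order, combine to a strict inequality, since
  equality throughout would force both signs on one letter. The combination is therefore a row step
  (names in \<open>_trans\<close>) as well as a column step (names in \<open>_less\<close>).\<close>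

lemma bumps_row_trans: "bumps sg x y \<Longrightarrow> \<not> bumps sg z y \<Longrightarrow> \<not> bumps sg z x"
  by (auto simp: bumps_def split: if_splits)

lemma row_bumps_trans: "\<not> bumps sg y x \<Longrightarrow> bumps sg y z \<Longrightarrow> \<not> bumps sg z x"
  by (auto simp: bumps_def split: if_splits)

lemma row_bumps_less: "\<not> bumps sg y x \<Longrightarrow> bumps sg y z \<Longrightarrow> bumps sg x z"
  by (auto simp: bumps_def split: if_splits)

lemma bumps_row_less: "bumps sg x y \<Longrightarrow> \<not> bumps sg z y \<Longrightarrow> bumps sg x z"
  by (auto simp: bumps_def split: if_splits)

lemma row_trans: "\<not> bumps sg y x \<Longrightarrow> \<not> bumps sg z y \<Longrightarrow> \<not> bumps sg z x"
  by (auto simp: bumps_def split: if_splits)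

lemma transp_bumps: "transp (bumps sg)"
  using bumps_trans by (blast intro: transpI)

text \<open>In this section columns are listed from top to bottom. \<open>\<not> bumps sg y x\<close> says that \<open>y\<close> may stand to
  the right of \<open>x\<close> in a row, \<open>bumps sg x y\<close> that \<open>y\<close> may stand below \<open>x\<close> in a column.\<close>

fun greedy :: "('a::linorder \<Rightarrow> bit) \<Rightarrow> 'a list \<Rightarrow> 'a list \<Rightarrow> 'a list \<times> 'a list" where
  "greedy sg [] vs = (vs, [])"
| "greedy sg (u # us) [] = (u # us, [])"
| "greedy sg (u # us) (v # vs) =
    (if bumps sg v u then apfst ((#) v) (greedy sg (u # us) vs)
     else map_prod ((#) u) ((#) v) (greedy sg us vs))"

text \<open>The same matching in the order of the letters: the number counts the entries of the first column
  that are waiting for a partner.\<close>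

fun queue :: "('a::linorder \<Rightarrow> bit) \<Rightarrow> nat \<Rightarrow> 'a list \<Rightarrow> 'a list \<Rightarrow> 'a list \<times> 'a list" where
  "queue sg q us [] = (us, [])"
| "queue sg 0 [] (v # vs) = apfst ((#) v) (queue sg 0 [] vs)"
| "queue sg (Suc q) [] (v # vs) = apsnd ((#) v) (queue sg q [] vs)"
| "queue sg 0 (u # us) (v # vs) =
    (if bumps sg v u then apfst ((#) v) (queue sg 0 (u # us) vs)
     else apfst ((#) u) (queue sg (Suc 0) us (v # vs)))"
| "queue sg (Suc q) (u # us) (v # vs) =
    (if bumps sg v u then apsnd ((#) v) (queue sg q (u # us) vs)
     else apfst ((#) u) (queue sg (Suc (Suc q)) us (v # vs)))"

lemma queue_arrive:
  "\<forall>v\<in>set vs. \<not> bumps sg v u \<Longrightarrow> queue sg q (u # us) vs = apfst ((#) u) (queue sg (Suc q) us vs)"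
  by (cases vs; cases q) auto

lemma queue_serve_idle:
  "\<forall>u\<in>set us. bumps sg v u \<Longrightarrow> queue sg 0 us (v # vs) = apfst ((#) v) (queue sg 0 us vs)"
  by (cases us) auto

lemma queue_serve:
  "\<forall>u\<in>set us. bumps sg v u \<Longrightarrow> queue sg (Suc q) us (v # vs) = apsnd ((#) v) (queue sg q us vs)"
  by (cases us) auto

lemma set_snd_queue: "set (snd (queue sg q us vs)) \<subseteq> set vs"
  by (induction sg q us vs rule: queue.induct) auto

lemma set_fst_queue: "set (fst (queue sg q us vs)) \<subseteq> set us \<union> set vs"
  by (induction sg q us vs rule: queue.induct) auto

lemma served_after_arrival:
  "y \<in> set (snd (queue sg 0 us vs)) \<Longrightarrow> sorted_wrt (bumps sg) vs \<Longrightarrow> \<exists>u\<in>set us. \<not> bumps sg y u"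
proof (induction vs)
  case (Cons v vs)
  show ?case
  proof (cases us)
    case us [simp]: (Cons u us')
    show ?thesis
    proof (cases "bumps sg v u")
      case False
      then have "y \<in> set (v # vs)"
        using Cons.prems(1) set_snd_queue[of sg "Suc 0" us' "v # vs"] by auto
      with False Cons.prems(2) show ?thesis
        using row_bumps_trans by fastforce
    qed (use Cons in auto)
  qed (use Cons in auto)
qed simp

text \<open>\<open>ps\<close> holds the entries already waiting. Every remaining service suits each
  of them, so their number is all that \<open>queue\<close> has to remember. The two functions
  record an entry of the first column at different times: \<open>queue\<close> on arrival,
  \<open>greedy\<close> when it is matched.\<close>

lemma greedy_queue:
  "\<forall>p\<in>set ps. \<forall>v\<in>set vs. \<not> bumps sg v p \<Longrightarrow> sorted_wrt (bumps sg) vs \<Longrightarrow>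
   greedy sg (ps @ us) vs = apfst ((@) ps) (queue sg (length ps) us vs)"
proof (induction "length us + length vs" arbitrary: ps us vs rule: less_induct)
  case less
  show ?case
  proof (cases vs)
    case Nil
    then show ?thesis by (cases "ps @ us") auto
  next
    case [simp]: (Cons v vs')
    show ?thesis
    proof (cases "us \<noteq> [] \<and> \<not> bumps sg v (hd us)")
      \<comment> \<open>An arrival comes next: \<open>u\<close> joins the waiting entries and
        nothing is matched yet.\<close>
      case True
      then obtain u us' where [simp]: "us = u # us'" and u: "\<not> bumps sg v u"
        by (cases us) auto
      have uv: "\<forall>v\<in>set vs. \<not> bumps sg v u"
        using u less.prems(2) row_bumps_trans by fastforce
      have "greedy sg ((ps @ [u]) @ us') vs = apfst ((@) (ps @ [u])) (queue sg (length (ps @ [u])) us' vs)"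
        by (rule less.hyps) (use less.prems uv in auto)
      then show ?thesis
        using queue_arrive[OF uv, of "length ps" us'] by (cases "queue sg (Suc (length ps)) us' vs") simp
    next
      case False
      show ?thesis
      proof (cases ps)
        case [simp]: Nil
        have "greedy sg us vs' = apfst ((@) []) (queue sg 0 us vs')"
          using less.hyps[of us vs' "[]"] less.prems by simp
        with False show ?thesis
          by (cases us) (auto simp: apfst_def map_prod_def split: prod.splits)
      next
        case [simp]: (Cons p ps')
        have "greedy sg (ps' @ us) vs' = apfst ((@) ps') (queue sg (length ps') us vs')"
          by (rule less.hyps) (use less.prems in auto)
        moreover have "\<not> bumps sg v p" using less.prems by simp
        ultimately show ?thesis
          using False by (cases us) (auto simp: apfst_def apsnd_def map_prod_def split: prod.splits)
      qed
    qed
  qed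
qed

corollary greedy_eq_queue: "sorted_wrt (bumps sg) vs \<Longrightarrow> greedy sg us vs = queue sg 0 us vs"
  using greedy_queue[of "[]" vs sg us] by (cases "queue sg 0 us vs") simp

text \<open>The parameters are the initial lengths of the three queues, in the order in which the boundary of
  a 3-cell \<open>X\<close> runs through them.\<close>

definition braid_left ::
  "('a::linorder \<Rightarrow> bit) \<Rightarrow> nat \<Rightarrow> nat \<Rightarrow> nat \<Rightarrow> 'a list \<Rightarrow> 'a list \<Rightarrow> 'a list \<Rightarrow> 'a list \<times> 'a list \<times> 'a list"
  where
  "braid_left sg p1 p2 p3 u v t =
    (let (e, e') = queue sg p1 u v; (b, b') = queue sg p2 e' t; (a, d) = queue sg p3 e b
     in (a, d, b'))"

definition braid_right ::
  "('a::linorder \<Rightarrow> bit) \<Rightarrow> nat \<Rightarrow> nat \<Rightarrow> nat \<Rightarrow> 'a list \<Rightarrow> 'a list \<Rightarrow> 'a list \<Rightarrow> 'a list \<times> 'a list \<times> 'a list"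
  where
  "braid_right sg q1 q2 q3 u v t =
    (let (w, w') = queue sg q1 v t; (a, a') = queue sg q2 u w; (d, b') = queue sg q3 a' w'
     in (a, d, b'))"

lemma sorted_wrt_bumps_late:
  assumes "sorted_wrt (bumps sg) vs" "vs = [] \<or> \<not> bumps sg (hd vs) x" "y \<in> set vs"
  shows "\<not> bumps sg y x"
  using assms row_bumps_trans[of sg "hd vs" x y] by (cases vs) auto

lemma sorted_wrt_bumps_early:
  assumes "sorted_wrt (bumps sg) us" "us = [] \<or> bumps sg x (hd us)" "y \<in> set us"
  shows "bumps sg x y"
  using assms bumps_trans[of sg x "hd us" y] by (cases us) auto

section \<open>The effect of a single event on the two tandems\<close>

context
  fixes sg :: "'a::linorder \<Rightarrow> bit" and u v t :: "'a list"
  assumes sorted: "sorted_wrt (bumps sg) u" "sorted_wrt (bumps sg) v" "sorted_wrt (bumps sg) t"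
begin

text \<open>Here and in the next lemmas \<open>x\<close> is to be the earliest event left in the
  three columns. The equations record which output column receives it and how the queue lengths
  change.\<close>

lemma braid_left_u:
  assumes "\<forall>y\<in>set v \<union> set t. \<not> bumps sg y x"
  shows "braid_left sg p1 p2 p3 (x # u) v t = apfst ((#) x) (braid_left sg (Suc p1) p2 (Suc p3) u v t)"
proof -
  obtain e e' where e: "queue sg (Suc p1) u v = (e, e')" by force
  obtain b b' where b: "queue sg p2 e' t = (b, b')" by force
  have "set e' \<subseteq> set v" using set_snd_queue[of sg "Suc p1" u v] e by simp
  then have "set b \<subseteq> set v \<union> set t" using set_fst_queue[of sg p2 e' t] b by auto
  then have "queue sg p3 (x # e) b = apfst ((#) x) (queue sg (Suc p3) e b)"
    using assms by (intro queue_arrive) auto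
  moreover have "queue sg p1 (x # u) v = (x # e, e')"
    using queue_arrive[of v sg x p1 u] assms e by simp
  ultimately show ?thesis
    by (simp add: braid_left_def e b split: prod.splits)
qed

lemma braid_right_u:
  assumes "\<forall>y\<in>set v \<union> set t. \<not> bumps sg y x"
  shows "braid_right sg q1 q2 q3 (x # u) v t = apfst ((#) x) (braid_right sg q1 (Suc q2) q3 u v t)"
proof -
  obtain w w' where w: "queue sg q1 v t = (w, w')" by force
  have "set w \<subseteq> set v \<union> set t" using set_fst_queue[of sg q1 v t] w by simp
  then have "queue sg q2 (x # u) w = apfst ((#) x) (queue sg (Suc q2) u w)"
    using assms by (intro queue_arrive) auto
  then show ?thesis
    by (simp add: braid_right_def w split: prod.splits)
qed

lemma braid_left_v:
  assumes "\<forall>y\<in>set t. \<not> bumps sg y x" "\<forall>y\<in>set u. bumps sg x y" "\<forall>y\<in>set v. bumps sg x y"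
  shows "braid_left sg (Suc p1) p2 0 u (x # v) t = apfst ((#) x) (braid_left sg p1 (Suc p2) 0 u v t)"
    and "braid_left sg (Suc p1) p2 (Suc p3) u (x # v) t =
      apsnd (apfst ((#) x)) (braid_left sg p1 (Suc p2) p3 u v t)"
    and "braid_left sg 0 p2 p3 u (x # v) t = apfst ((#) x) (braid_left sg 0 p2 (Suc p3) u v t)"
proof -
  obtain e e' where e: "queue sg p1 u v = (e, e')" by force
  obtain b b' where b: "queue sg (Suc p2) e' t = (b, b')" by force
  have "set e \<subseteq> set u \<union> set v" using set_fst_queue[of sg p1 u v] e by simp
  then have ex: "\<forall>y\<in>set e. bumps sg x y" using assms by auto
  have 1: "queue sg (Suc p1) u (x # v) = (e, x # e')"
    using queue_serve[of u sg x p1 v] assms e by simp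
  have 2: "queue sg p2 (x # e') t = (x # b, b')"
    using queue_arrive[of t sg x p2 e'] assms b by simp
  show "braid_left sg (Suc p1) p2 0 u (x # v) t = apfst ((#) x) (braid_left sg p1 (Suc p2) 0 u v t)"
    using queue_serve_idle[OF ex, of b] by (simp add: braid_left_def e b 1 2 split: prod.splits)
  show "braid_left sg (Suc p1) p2 (Suc p3) u (x # v) t =
      apsnd (apfst ((#) x)) (braid_left sg p1 (Suc p2) p3 u v t)"
    using queue_serve[OF ex, of p3 b] by (simp add: braid_left_def e b 1 2 split: prod.splits)
next
  obtain e e' where e: "queue sg 0 u v = (e, e')" by force
  obtain b b' where b: "queue sg p2 e' t = (b, b')" by force
  have 1: "queue sg 0 u (x # v) = (x # e, e')"
    using queue_serve_idle[of u sg x v] assms e by simp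
  \<comment> \<open>\<open>x\<close> is now an arrival at the third queue, whose services
    \<open>b\<close> are letters of \<open>t\<close> or departures from the first queue.\<close>
  have "\<not> bumps sg y x" if y: "y \<in> set b" for y
  proof (cases "y \<in> set t")
    case False
    then have "y \<in> set (snd (queue sg 0 u v))"
      using y set_fst_queue[of sg p2 e' t] b e by auto
    then obtain z where "z \<in> set u" "\<not> bumps sg y z"
      using served_after_arrival sorted by blast
    then show ?thesis using assms(2) bumps_row_trans by blast
  qed (use assms in auto)
  then have "queue sg p3 (x # e) b = apfst ((#) x) (queue sg (Suc p3) e b)"
    by (intro queue_arrive) auto
  then show "braid_left sg 0 p2 p3 u (x # v) t = apfst ((#) x) (braid_left sg 0 p2 (Suc p3) u v t)"
    by (simp add: braid_left_def e b 1 split: prod.splits)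
qed

lemma braid_right_v:
  assumes "\<forall>y\<in>set t. \<not> bumps sg y x" "\<forall>y\<in>set u. bumps sg x y"
  shows "braid_right sg q1 0 q3 u (x # v) t = apfst ((#) x) (braid_right sg (Suc q1) 0 q3 u v t)"
    and "braid_right sg q1 (Suc q2) q3 u (x # v) t =
      apsnd (apfst ((#) x)) (braid_right sg (Suc q1) q2 (Suc q3) u v t)"
proof -
  obtain w w' where w: "queue sg (Suc q1) v t = (w, w')" by force
  have 1: "queue sg q1 (x # v) t = (x # w, w')"
    using queue_arrive[of t sg x q1 v] assms w by simp
  show "braid_right sg q1 0 q3 u (x # v) t = apfst ((#) x) (braid_right sg (Suc q1) 0 q3 u v t)"
    using queue_serve_idle[OF assms(2), of w] by (simp add: braid_right_def w 1 split: prod.splits)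
  obtain a a' where a: "queue sg q2 u w = (a, a')" by force
  have 2: "queue sg (Suc q2) u (x # w) = (a, x # a')"
    using queue_serve[OF assms(2), of q2 w] a by simp
  have "set w' \<subseteq> set t" using set_snd_queue[of sg "Suc q1" v t] w by simp
  then have "queue sg q3 (x # a') w' = apfst ((#) x) (queue sg (Suc q3) a' w')"
    using assms by (intro queue_arrive) auto
  then show "braid_right sg q1 (Suc q2) q3 u (x # v) t =
      apsnd (apfst ((#) x)) (braid_right sg (Suc q1) q2 (Suc q3) u v t)"
    by (simp add: braid_right_def w a 1 2 split: prod.splits)
qed

lemma braid_left_t:
  assumes "\<forall>y\<in>set u \<union> set v. bumps sg x y"
  shows "braid_left sg p1 (Suc p2) p3 u v (x # t) =
      apsnd (apsnd ((#) x)) (braid_left sg p1 p2 p3 u v t)"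
    and "braid_left sg p1 0 (Suc p3) u v (x # t) =
      apsnd (apfst ((#) x)) (braid_left sg p1 0 p3 u v t)"
    and "braid_left sg p1 0 0 u v (x # t) = apfst ((#) x) (braid_left sg p1 0 0 u v t)"
proof -
  obtain e e' where e: "queue sg p1 u v = (e, e')" by force
  have e': "\<forall>y\<in>set e'. bumps sg x y"
    using set_snd_queue[of sg p1 u v] e assms by auto
  have ex: "\<forall>y\<in>set e. bumps sg x y"
    using set_fst_queue[of sg p1 u v] e assms by auto
  show "braid_left sg p1 (Suc p2) p3 u v (x # t) =
      apsnd (apsnd ((#) x)) (braid_left sg p1 p2 p3 u v t)"
    using queue_serve[OF e', of p2 t] by (simp add: braid_left_def e split: prod.splits)
  obtain b b' where b: "queue sg 0 e' t = (b, b')" by force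
  have 1: "queue sg 0 e' (x # t) = (x # b, b')"
    using queue_serve_idle[OF e', of t] b by simp
  show "braid_left sg p1 0 (Suc p3) u v (x # t) =
      apsnd (apfst ((#) x)) (braid_left sg p1 0 p3 u v t)"
    using queue_serve[OF ex, of p3 b] by (simp add: braid_left_def e b 1 split: prod.splits)
  show "braid_left sg p1 0 0 u v (x # t) = apfst ((#) x) (braid_left sg p1 0 0 u v t)"
    using queue_serve_idle[OF ex, of b] by (simp add: braid_left_def e b 1 split: prod.splits)
qed

lemma braid_right_t:
  assumes "\<forall>y\<in>set u \<union> set v \<union> set t. bumps sg x y"
  shows "braid_right sg (Suc q1) q2 (Suc q3) u v (x # t) =
      apsnd (apsnd ((#) x)) (braid_right sg q1 q2 q3 u v t)"
    and "braid_right sg (Suc q1) q2 0 u v (x # t) =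
      apsnd (apfst ((#) x)) (braid_right sg q1 q2 0 u v t)"
    and "braid_right sg 0 (Suc q2) q3 u v (x # t) =
      apsnd (apfst ((#) x)) (braid_right sg 0 q2 (Suc q3) u v t)"
    and "braid_right sg 0 0 q3 u v (x # t) = apfst ((#) x) (braid_right sg 0 0 q3 u v t)"
proof -
  obtain w w' where w: "queue sg q1 v t = (w, w')" by force
  obtain a a' where a: "queue sg q2 u w = (a, a')" by force
  have 1: "queue sg (Suc q1) v (x # t) = (w, x # w')"
    using queue_serve[of v sg x q1 t] assms w by simp
  have a': "\<forall>y\<in>set a'. bumps sg x y"
    using set_snd_queue[of sg q2 u w] a set_fst_queue[of sg q1 v t] w assms by fastforce
  show "braid_right sg (Suc q1) q2 (Suc q3) u v (x # t) =
      apsnd (apsnd ((#) x)) (braid_right sg q1 q2 q3 u v t)"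
    using queue_serve[OF a', of q3 w'] by (simp add: braid_right_def w a 1 split: prod.splits)
  show "braid_right sg (Suc q1) q2 0 u v (x # t) =
      apsnd (apfst ((#) x)) (braid_right sg q1 q2 0 u v t)"
    using queue_serve_idle[OF a', of w'] by (simp add: braid_right_def w a 1 split: prod.splits)
next
  obtain w w' where w: "queue sg 0 v t = (w, w')" by force
  obtain a a' where a: "queue sg q2 u w = (a, a')" by force
  have 1: "queue sg 0 v (x # t) = (x # w, w')"
    using queue_serve_idle[of v sg x t] assms w by simp
  have xu: "\<forall>y\<in>set u. bumps sg x y" using assms by simp
  have 2: "queue sg (Suc q2) u (x # w) = (a, x # a')"
    using queue_serve[OF xu, of q2 w] a by simp
  have "\<not> bumps sg y x" if y: "y \<in> set w'" for y
  proof -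
    obtain z where "z \<in> set v" "\<not> bumps sg y z"
      using served_after_arrival[of y sg v t] y sorted(3) unfolding w snd_conv by blast
    then show ?thesis using assms bumps_row_trans by blast
  qed
  then have "queue sg q3 (x # a') w' = apfst ((#) x) (queue sg (Suc q3) a' w')"
    by (intro queue_arrive) auto
  then show "braid_right sg 0 (Suc q2) q3 u v (x # t) =
      apsnd (apfst ((#) x)) (braid_right sg 0 q2 (Suc q3) u v t)"
    by (simp add: braid_right_def w a 1 2 split: prod.splits)
  show "braid_right sg 0 0 q3 u v (x # t) = apfst ((#) x) (braid_right sg 0 0 q3 u v t)"
    using queue_serve_idle[OF xu, of w] by (simp add: braid_right_def w 1 split: prod.splits)
qed

end

text \<open>All events fit into one linear order, in which equal letters of sign 0 occur in the
  order \<open>u\<close>, \<open>v\<close>, \<open>t\<close> and equal letters of sign 1 in the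
  order \<open>t\<close>, \<open>v\<close>, \<open>u\<close>. The mixed transitivity laws exclude a
  cycle among the three heads.\<close>

lemma next_event:
  assumes "u \<noteq> [] \<or> v \<noteq> [] \<or> t \<noteq> []"
    and sorted: "sorted_wrt (bumps sg) u" "sorted_wrt (bumps sg) v" "sorted_wrt (bumps sg) t"
  obtains (u) x u' where "u = x # u'" "\<forall>y\<in>set v \<union> set t. \<not> bumps sg y x"
  | (v) x v' where "v = x # v'" "\<forall>y\<in>set t. \<not> bumps sg y x" "\<forall>y\<in>set u \<union> set v'. bumps sg x y"
  | (t) x t' where "t = x # t'" "\<forall>y\<in>set u \<union> set v \<union> set t'. bumps sg x y"
proof -
  note late = sorted_wrt_bumps_late and early = sorted_wrt_bumps_early
  consider "u \<noteq> []" "v = [] \<or> \<not> bumps sg (hd v) (hd u)" "t = [] \<or> \<not> bumps sg (hd t) (hd u)"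
    | "v \<noteq> []" "u = [] \<or> bumps sg (hd v) (hd u)" "t = [] \<or> \<not> bumps sg (hd t) (hd v)"
    | "t \<noteq> []" "u = [] \<or> bumps sg (hd t) (hd u)" "v = [] \<or> bumps sg (hd t) (hd v)"
    using assms(1) bumps_trans[of sg "hd t" "hd v" "hd u"] row_trans[of sg "hd v" "hd u" "hd t"]
      bumps_row_less[of sg "hd t" "hd u" "hd v"]
    by (cases "u = []"; cases "v = []"; cases "t = []") blast+
  then show thesis
  proof cases
    case 1
    then show thesis using late[OF sorted(2) 1(2)] late[OF sorted(3) 1(3)] u[of "hd u" "tl u"] by auto
  next
    case 2
    then show thesis using early[OF sorted(1) 2(2)] late[OF sorted(3) 2(3)] sorted(2) v[of "hd v" "tl v"]
      by (cases v) auto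
  next
    case 3
    then show thesis using early[OF sorted(1) 3(2)] early[OF sorted(2) 3(3)] sorted(3) t[of "hd t" "tl t"]
      by (cases t) auto
  qed
qed

text \<open>The queue lengths on the left are a piecewise linear function of those on the right; it is the
  tropical transition map between the two factorizations, and every event preserves it.\<close>

theorem braid:
  assumes "sorted_wrt (bumps sg) u" "sorted_wrt (bumps sg) v" "sorted_wrt (bumps sg) t"
  shows "braid_left sg (q2 + (q3 - q1)) (min q1 q3) (q2 + (q1 - q3)) u v t = braid_right sg q1 q2 q3 u v t"
  using assms
proof (induction "length u + length v + length t" arbitrary: u v t q1 q2 q3 rule: less_induct)
  case less
  show ?case
  proof (cases "u \<noteq> [] \<or> v \<noteq> [] \<or> t \<noteq> []")
    case False
    then show ?thesis by (simp add: braid_left_def braid_right_def)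
  next
    case True
    then show ?thesis
      using less.prems
    proof (cases rule: next_event)
      case (u x u')
      have "braid_left sg (Suc q2 + (q3 - q1)) (min q1 q3) (Suc q2 + (q1 - q3)) u' v t =
          braid_right sg q1 (Suc q2) q3 u' v t"
        by (rule less.hyps) (use u less.prems in auto)
      with u less.prems show ?thesis
        by (simp add: braid_left_u braid_right_u)
    next
      case (v x v')
      have s: "sorted_wrt (bumps sg) u" "sorted_wrt (bumps sg) v'" "sorted_wrt (bumps sg) t"
        using less.prems v by auto
      have p: "\<forall>y\<in>set t. \<not> bumps sg y x" "\<forall>y\<in>set u. bumps sg x y" "\<forall>y\<in>set v'. bumps sg x y"
        using v by auto
      note L = braid_left_v[OF s p] and R = braid_right_v[OF s p(1,2)]
      have "length u + length v' + length t < length u + length v + length t" using v by simp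
      note IH = less.hyps[OF this s]
      show ?thesis
      proof (cases q2)
        case (Suc k)
        then show ?thesis
          using IH[of k "Suc q3" "Suc q1"] v(1) by (simp add: L R)
      next
        case 0
        \<comment> \<open>For \<open>q2 = 0\<close> the first and the third length on the left are
          the truncated differences \<open>q3 - q1\<close> and \<open>q1 - q3\<close>. At most one
          of them is positive, and this decides whether the first queue can serve
          \<open>x\<close>.\<close>
        show ?thesis
        proof (cases "q1 < q3")
          case True
          then obtain k where "q3 = Suc (q1 + k)" using less_iff_Suc_add by auto
          then show ?thesis
            using IH[of 0 q3 "Suc q1"] v(1) 0 by (simp add: L R)
        next
          case False
          then obtain k where "q1 = q3 + k" using le_Suc_ex by fastforce
          then show ?thesis
            using IH[of 0 q3 "Suc q1"] v(1) 0 by (simp add: L R)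
        qed
      qed
    next
      case (t x t')
      have s: "sorted_wrt (bumps sg) u" "sorted_wrt (bumps sg) v" "sorted_wrt (bumps sg) t'"
        using less.prems t by auto
      have p: "\<forall>y\<in>set u \<union> set v. bumps sg x y" using t by auto
      note L = braid_left_t[OF s p] and R = braid_right_t[OF s t(2)]
      have "length u + length v + length t' < length u + length v + length t" using t by simp
      note IH = less.hyps[OF this s]
      \<comment> \<open>One instance for each case of \<open>braid_right_t\<close>, in the same
        order; the predecessors matter only where the lengths are positive.\<close>
      show ?thesis
        using IH[of q2 "q3 - 1" "q1 - 1"] IH[of q2 0 "q1 - 1"] IH[of "q2 - 1" "Suc q3" 0] IH[of 0 q3 0] t(1)
        by (cases q1; cases q2; cases q3) (simp_all add: L R)
    qed
  qed
qed

section \<open>Words over columns\<close>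

lemma super_column_rev: "super_column sg u \<longleftrightarrow> sorted_wrt (bumps sg) (rev u)"
proof -
  have "(\<lambda>x y. y \<le> x \<and> (y = x \<longrightarrow> sg x = 1)) = (\<lambda>x y. bumps sg y x)"
    by (intro ext) (auto simp: bumps_def le_less)
  then show ?thesis
    unfolding super_column_def
    using successively_conv_sorted_wrt[OF transp_bumps[of sg], of "rev u"] by (simp only: successively_rev)
qed

section \<open>Juxtaposition and the output of the matching\<close>

fun jux :: "('a::linorder \<Rightarrow> bit) \<Rightarrow> 'a list \<Rightarrow> 'a list \<Rightarrow> bool" where
  "jux sg us [] \<longleftrightarrow> True"
| "jux sg [] (v # vs) \<longleftrightarrow> False"
| "jux sg (u # us) (v # vs) \<longleftrightarrow> \<not> bumps sg v u \<and> jux sg us vs"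

lemma jux_nth:
  "jux sg us vs \<longleftrightarrow> length vs \<le> length us \<and> (\<forall>i<length vs. \<not> bumps sg (vs ! i) (us ! i))"
  by (induction sg us vs rule: jux.induct) (auto simp: less_Suc_eq_0_disj)

lemma juxtaposable_jux: "juxtaposable sg u v \<longleftrightarrow> jux sg (rev u) (rev v)"
proof -
  have "x \<le> y \<and> (x = y \<longrightarrow> sg x = 0) \<longleftrightarrow> \<not> bumps sg y x" for x y
    by (auto simp: bumps_def)
  then show ?thesis by (simp add: juxtaposable_def jux_nth)
qed

lemma set_fst_greedy: "set (fst (greedy sg us vs)) \<subseteq> set us \<union> set vs"
  by (induction sg us vs rule: greedy.induct) auto

lemma set_snd_greedy: "set (snd (greedy sg us vs)) \<subseteq> set vs"
  by (induction sg us vs rule: greedy.induct) auto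

lemma sorted_fst_greedy:
  "sorted_wrt (bumps sg) us \<Longrightarrow> sorted_wrt (bumps sg) vs \<Longrightarrow>
   sorted_wrt (bumps sg) (fst (greedy sg us vs))"
proof (induction sg us vs rule: greedy.induct)
  case (3 sg u us v vs)
  show ?case
  proof (cases "bumps sg v u")
    case True
    then have "\<forall>y\<in>set (u # us) \<union> set vs. bumps sg v y"
      using 3(3,4) bumps_trans[of sg v u] by auto
    then show ?thesis
      using 3 True set_fst_greedy[of sg "u # us" vs] by auto
  next
    case False
    then have "\<forall>y\<in>set us \<union> set vs. bumps sg u y"
      using 3(3,4) row_bumps_less[of sg v u] by auto
    then show ?thesis
      using 3 False set_fst_greedy[of sg us vs] by auto
  qed
qed auto

lemma sorted_snd_greedy:
  "sorted_wrt (bumps sg) vs \<Longrightarrow> sorted_wrt (bumps sg) (snd (greedy sg us vs))"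
proof (induction sg us vs rule: greedy.induct)
  case (3 sg u us v vs)
  then show ?case using set_snd_greedy[of sg us vs] by auto
qed auto

lemma length_greedy:
  "length (fst (greedy sg us vs)) + length (snd (greedy sg us vs)) = length us + length vs"
  by (induction sg us vs rule: greedy.induct) auto

lemma length_snd_greedy: "length (snd (greedy sg us vs)) \<le> length vs"
  by (induction sg us vs rule: greedy.induct) auto

text \<open>An idle service is lost to the right column. A right column of full length therefore
  means that no service was idle, and then the entries are paired row by row.\<close>

lemma snd_greedy_eq:
  "length (snd (greedy sg us vs)) = length vs \<Longrightarrow> jux sg us vs"
proof (induction sg us vs rule: greedy.induct)
  case (3 sg u us v vs)
  then show ?case using length_snd_greedy[of sg "u # us" vs] by (auto split: if_splits)
qed auto

lemma jux_greedy: "jux sg us vs \<Longrightarrow> greedy sg us vs = (us, vs)"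
  by (induction sg us vs rule: greedy.induct) (auto elim: jux.elims)

lemma snd_greedy_Nil: "snd (greedy sg us vs) = [] \<Longrightarrow> fst (greedy sg us vs) = vs @ us"
  by (induction sg us vs rule: greedy.induct) (auto split: if_splits)

lemma fst_greedy_Nil: "fst (greedy sg us vs) = [] \<longleftrightarrow> us = [] \<and> vs = []"
  by (induction sg us vs rule: greedy.induct) (auto split: if_splits)

text \<open>This is what an idle service does: put on top of the left column, it pushes that column
  down by one, so every entry on the right faces a letter that precedes its former
  neighbour.\<close>

lemma jux_Cons_left:
  "jux sg l r \<Longrightarrow> sorted_wrt (bumps sg) (x # l) \<Longrightarrow> jux sg (x # l) r"
proof (induction l r arbitrary: x rule: jux.induct[of _ sg])
  case (3 sg u us v vs)
  then show ?case using bumps_row_trans[of sg x u v] by auto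
qed auto

lemma jux_fst_snd_greedy:
  "sorted_wrt (bumps sg) us \<Longrightarrow> sorted_wrt (bumps sg) vs \<Longrightarrow>
   jux sg (fst (greedy sg us vs)) (snd (greedy sg us vs))"
proof (induction sg us vs rule: greedy.induct)
  case (3 sg u us v vs)
  show ?case
  proof (cases "bumps sg v u")
    case True
    then show ?thesis
      using 3 sorted_fst_greedy[OF 3(3,4)] by (auto intro: jux_Cons_left)
  qed (use 3 in auto)
qed auto

text \<open>The matching in terms of words, free of tableaux; on super columns it agrees with
  \<open>left_col\<close> by \<open>left_col_eq_lcol\<close>.\<close>

definition lcol :: "('a::linorder \<Rightarrow> bit) \<Rightarrow> 'a list \<Rightarrow> 'a list \<Rightarrow> 'a list" where
  "lcol sg u v = rev (fst (greedy sg (rev u) (rev v)))"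

definition rcol :: "('a::linorder \<Rightarrow> bit) \<Rightarrow> 'a list \<Rightarrow> 'a list \<Rightarrow> 'a list" where
  "rcol sg u v = rev (snd (greedy sg (rev u) (rev v)))"

definition scols :: "'a::linorder set \<Rightarrow> ('a \<Rightarrow> bit) \<Rightarrow> 'a list set" where
  "scols S sg = {u \<in> lists S. super_column sg u}"

lemma columns_scols: "u \<in> columns S sg \<longleftrightarrow> u \<in> scols S sg \<and> u \<noteq> []"
  by (auto simp: columns_def scols_def)

lemma Nil_scols [simp]: "[] \<in> scols S sg"
  by (simp add: scols_def super_column_def)

lemma lcol_scols [simp]: "u \<in> scols S sg \<Longrightarrow> v \<in> scols S sg \<Longrightarrow> lcol sg u v \<in> scols S sg"
  using set_fst_greedy[of sg "rev u" "rev v"]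
  by (auto simp: scols_def lcol_def super_column_rev intro!: sorted_fst_greedy)

lemma rcol_scols [simp]: "u \<in> scols S sg \<Longrightarrow> v \<in> scols S sg \<Longrightarrow> rcol sg u v \<in> scols S sg"
  using set_snd_greedy[of sg "rev u" "rev v"]
  by (auto simp: scols_def rcol_def super_column_rev intro!: sorted_snd_greedy)

lemma lcol_Nil_iff [simp]: "lcol sg u v = [] \<longleftrightarrow> u = [] \<and> v = []"
  by (simp add: lcol_def fst_greedy_Nil)

lemma lcol_Nil1 [simp]: "lcol sg [] v = v" and rcol_Nil1 [simp]: "rcol sg [] v = []"
  by (simp_all add: lcol_def rcol_def)

lemma lcol_Nil2 [simp]: "lcol sg u [] = u" and rcol_Nil2 [simp]: "rcol sg u [] = []"
  by (cases "rev u"; auto simp: lcol_def rcol_def)+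

lemma juxtaposable_lcol: "juxtaposable sg u v \<Longrightarrow> lcol sg u v = u"
  and juxtaposable_rcol: "juxtaposable sg u v \<Longrightarrow> rcol sg u v = v"
  by (simp_all add: juxtaposable_jux lcol_def rcol_def jux_greedy)

lemma rcol_eq_juxtaposable: "rcol sg u v = v \<Longrightarrow> juxtaposable sg u v"
  unfolding rcol_def juxtaposable_jux
  by (rule snd_greedy_eq) (metis length_rev)

text \<open>The total number of letters is preserved, so a left column of unchanged length leaves a
  right column as long as \<open>v\<close>. With \<open>rcol_eq_juxtaposable\<close> this recognises
  an identity step from one output column, which \<open>braid_homotopic\<close> needs for triples
  without a 3-cell.\<close>

lemma lcol_eq_juxtaposable: "lcol sg u v = u \<Longrightarrow> juxtaposable sg u v"
  unfolding lcol_def juxtaposable_jux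
  using length_greedy[of sg "rev u" "rev v"]
  by (intro snd_greedy_eq) (metis add_left_cancel length_rev)

lemma juxtaposable_lcol_rcol:
  "u \<in> scols S sg \<Longrightarrow> v \<in> scols S sg \<Longrightarrow> juxtaposable sg (lcol sg u v) (rcol sg u v)"
  by (simp add: juxtaposable_jux lcol_def rcol_def scols_def super_column_rev jux_fst_snd_greedy)

lemma rcol_Nil_lcol: "rcol sg u v = [] \<Longrightarrow> lcol sg u v = u @ v"
  by (simp add: rcol_def lcol_def snd_greedy_Nil)

text \<open>This is \<open>braid\<close> with three queues that start empty; the lengths on the
  other side are then 0 as well.\<close>

lemma braid_words:
  assumes "u \<in> scols S sg" "v \<in> scols S sg" "t \<in> scols S sg"
  shows "lcol sg (lcol sg u v) (lcol sg (rcol sg u v) t) = lcol sg u (lcol sg v t)"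
    and "rcol sg (lcol sg u v) (lcol sg (rcol sg u v) t) = lcol sg (rcol sg u (lcol sg v t)) (rcol sg v t)"
    and "rcol sg (rcol sg u v) t = rcol sg (rcol sg u (lcol sg v t)) (rcol sg v t)"
proof -
  define us vs ts where "us = rev u" and "vs = rev v" and "ts = rev t"
  then have s [simp]: "sorted_wrt (bumps sg) us" "sorted_wrt (bumps sg) vs" "sorted_wrt (bumps sg) ts"
    using assms by (simp_all add: scols_def super_column_rev)
  obtain e e' where e: "greedy sg us vs = (e, e')" by force
  obtain b b' where b: "greedy sg e' ts = (b, b')" by force
  obtain a d where a: "greedy sg e b = (a, d)" by force
  obtain w w' where w: "greedy sg vs ts = (w, w')" by force
  obtain f f' where f: "greedy sg us w = (f, f')" by force
  obtain g g' where g: "greedy sg f' w' = (g, g')" by force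
  have "sorted_wrt (bumps sg) e'" using e sorted_snd_greedy[of sg vs us] by simp
  then have "sorted_wrt (bumps sg) b" using b sorted_fst_greedy[of sg e' ts] by simp
  moreover have "sorted_wrt (bumps sg) w" "sorted_wrt (bumps sg) w'"
    using w sorted_fst_greedy[of sg vs ts] sorted_snd_greedy[of sg ts vs] by simp_all
  ultimately have "(a, d, b') = (f, g, g')"
    using braid[OF s, of 0 0 0] e b a w f g
    by (simp add: braid_left_def braid_right_def greedy_eq_queue)
  then show "lcol sg (lcol sg u v) (lcol sg (rcol sg u v) t) = lcol sg u (lcol sg v t)"
    and "rcol sg (lcol sg u v) (lcol sg (rcol sg u v) t) = lcol sg (rcol sg u (lcol sg v t)) (rcol sg v t)"
    and "rcol sg (rcol sg u v) t = rcol sg (rcol sg u (lcol sg v t)) (rcol sg v t)"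
    using e b a w f g by (simp_all add: lcol_def rcol_def us_def vs_def ts_def)
qed

section \<open>Insertion of a column into a word over columns from the left\<close>

fun col_insert :: "('a::linorder \<Rightarrow> bit) \<Rightarrow> 'a list \<Rightarrow> 'a list list \<Rightarrow> 'a list list" where
  "col_insert sg u [] = colgen u"
| "col_insert sg u (t # ts) = colgen (lcol sg u t) @ col_insert sg (rcol sg u t) ts"

lemma colgen_Nil [simp]: "colgen [] = []"
  by (simp add: colgen_def)

lemma colgen_nonempty: "u \<noteq> [] \<Longrightarrow> colgen u = [u]"
  by (simp add: colgen_def)

lemma colgen_columns [simp]: "u \<in> scols S sg \<Longrightarrow> colgen u \<in> lists (columns S sg)"
  by (simp add: colgen_def columns_scols)

lemma columns_in_scols: "u \<in> columns S sg \<Longrightarrow> u \<in> scols S sg"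
  by (simp add: columns_scols)

lemma col_insert_columns [simp]:
  "u \<in> scols S sg \<Longrightarrow> ts \<in> lists (columns S sg) \<Longrightarrow> col_insert sg u ts \<in> lists (columns S sg)"
  by (induction ts arbitrary: u) (auto simp: columns_in_scols)

lemma foldr_col_insert_columns [simp]:
  "us \<in> lists (scols S sg) \<Longrightarrow> ts \<in> lists (columns S sg) \<Longrightarrow>
   foldr (col_insert sg) us ts \<in> lists (columns S sg)"
  by (induction us) auto

lemma col_insert_Nil: "ts \<in> lists (columns S sg) \<Longrightarrow> col_insert sg [] ts = ts"
  by (induction ts) (auto simp: colgen_def columns_scols)

lemma col_insert_colgen:
  "u \<in> scols S sg \<Longrightarrow> v \<in> scols S sg \<Longrightarrow>
   col_insert sg u (colgen v) = colgen (lcol sg u v) @ colgen (rcol sg u v)"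
  by (cases "v = []") (auto simp: colgen_def)

text \<open>This makes normal forms invariant under the rules. Past the first column of the word,
  the braid relation says that both sides leave the same column behind and carry on, respectively, a
  pair of columns and its matched version, which is the situation of the induction hypothesis. At
  the empty word the matched pair is juxtaposable, so matching it once more changes nothing.\<close>

lemma col_insert_col_insert:
  "u \<in> scols S sg \<Longrightarrow> v \<in> scols S sg \<Longrightarrow> ts \<in> lists (columns S sg) \<Longrightarrow>
   col_insert sg u (col_insert sg v ts) = col_insert sg (lcol sg u v) (col_insert sg (rcol sg u v) ts)"
proof (induction ts arbitrary: u v)
  case Nil
  then show ?case
    using juxtaposable_lcol_rcol[OF Nil(1,2)]
    by (simp add: col_insert_colgen[of _ S] juxtaposable_lcol juxtaposable_rcol)
next
  case (Cons t ts)
  then have t: "t \<in> scols S sg" "t \<noteq> []" by (simp_all add: columns_scols)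
  define w w' e e' where "w = lcol sg v t" and "w' = rcol sg v t"
    and "e = lcol sg u v" and "e' = rcol sg u v"
  note d = this
  have in_scols: "w \<in> scols S sg" "w' \<in> scols S sg" "e \<in> scols S sg" "e' \<in> scols S sg"
    using Cons.prems t by (simp_all add: d)
  have "col_insert sg u (col_insert sg v (t # ts)) =
      colgen (lcol sg u w) @ col_insert sg (rcol sg u w) (col_insert sg w' ts)"
    using t by (simp add: d colgen_nonempty)
  also have "\<dots> = colgen (lcol sg e (lcol sg e' t)) @
      col_insert sg (rcol sg e (lcol sg e' t)) (col_insert sg (rcol sg e' t) ts)"
    using Cons.IH[of "rcol sg u w" w'] Cons.prems in_scols braid_words[OF Cons.prems(1,2) t(1)]
    by (simp add: d)
  also have "\<dots> = col_insert sg e (col_insert sg e' (t # ts))"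
    using t by (simp add: colgen_nonempty)
  finally show ?case by (simp add: d)
qed

lemma lcol_singleton:
  assumes "x # u \<in> scols S sg"
  shows "lcol sg [x] u = x # u" and "rcol sg [x] u = []"
proof -
  have "\<forall>y\<in>set (rev u). bumps sg y x"
    using assms by (auto simp: scols_def super_column_rev sorted_wrt_append)
  moreover have "greedy sg [x] us = (us @ [x], [])" if "\<forall>y\<in>set us. bumps sg y x" for us
    using that by (induction us) auto
  ultimately show "lcol sg [x] u = x # u" "rcol sg [x] u = []"
    by (simp_all add: lcol_def rcol_def)
qed

text \<open>The letters are inserted from the top of \<open>u\<close> downwards. Each of them may
  stand below the column built so far, so it is absorbed and nothing is handed on to
  \<open>ts\<close>.\<close>

lemma foldr_letters:
  "u \<in> scols S sg \<Longrightarrow> ts \<in> lists (columns S sg) \<Longrightarrow>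
   foldr (col_insert sg) (map (\<lambda>x. [x]) u) ts = col_insert sg u ts"
proof (induction u)
  case Nil
  then show ?case by (simp add: col_insert_Nil)
next
  case (Cons x u)
  have "u \<in> scols S sg" and "[x] \<in> scols S sg"
    using Cons.prems by (auto simp: scols_def super_column_rev sorted_wrt_append)
  then show ?case
    using Cons lcol_singleton[of x u S sg] col_insert_col_insert[of "[x]" S sg u ts]
    by (simp add: col_insert_Nil[of _ S])
qed

section \<open>Columns of the insertion tableau\<close>

fun above :: "('a::linorder \<Rightarrow> bit) \<Rightarrow> 'a list \<Rightarrow> 'a list \<Rightarrow> bool" where
  "above sg r [] \<longleftrightarrow> True"
| "above sg [] (y # r') \<longleftrightarrow> False"
| "above sg (x # r) (y # r') \<longleftrightarrow> bumps sg x y \<and> above sg r r'"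

abbreviation sorted_row :: "('a::linorder \<Rightarrow> bit) \<Rightarrow> 'a list \<Rightarrow> bool" where
  "sorted_row sg \<equiv> sorted_wrt (\<lambda>x y. \<not> bumps sg y x)"

fun tableau :: "('a::linorder \<Rightarrow> bit) \<Rightarrow> 'a list list \<Rightarrow> bool" where
  "tableau sg [] \<longleftrightarrow> True"
| "tableau sg (r # T) \<longleftrightarrow>
    r \<noteq> [] \<and> sorted_row sg r \<and> (T \<noteq> [] \<longrightarrow> above sg r (hd T)) \<and> tableau sg T"

lemma set_row_insert: "set (fst (row_insert sg r x)) \<subseteq> insert x (set r)"
  by (induction r) (auto split: prod.splits)

lemma sorted_row_insert: "sorted_row sg r \<Longrightarrow> sorted_row sg (fst (row_insert sg r x))"
proof (induction r)
  case (Cons y r)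
  show ?case
  proof (cases "bumps sg x y")
    case True
    then show ?thesis using Cons.prems bumps_row_trans[of sg x y] by auto
  next
    case False
    then show ?thesis using Cons set_row_insert[of sg r x] by (auto split: prod.splits)
  qed
qed simp

lemma row_insert_None: "row_insert sg r x = (r', None) \<Longrightarrow> r' = r @ [x]"
  by (induction r arbitrary: r') (auto split: if_splits prod.splits)

lemma row_insert_Some: "row_insert sg r x = (r', Some y) \<Longrightarrow> bumps sg x y"
  by (induction r arbitrary: r') (auto split: if_splits prod.splits)

lemma row_insert_nonempty [simp]: "fst (row_insert sg r x) \<noteq> []"
  by (cases r) (auto split: prod.splits)

lemma above_append: "above sg r r' \<Longrightarrow> above sg (r @ s) r'"
  by (induction sg r r' rule: above.induct) auto

lemma above_row_insert: "above sg r r' \<Longrightarrow> above sg (fst (row_insert sg r x)) r'"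
proof (induction sg r r' rule: above.induct)
  case (3 sg z r y r')
  then show ?case using bumps_trans[of sg x z y] by (auto split: prod.splits)
qed auto

text \<open>The bumped entry \<open>y\<close> lands weakly to the left of the box it leaves: the
  entry below that box, if there is one, is itself bumped by \<open>y\<close>. Hence the entry now
  above \<open>y\<close> is \<open>x\<close> or an entry to the left of \<open>x\<close>, and both
  may stand above \<open>y\<close>.\<close>

lemma above_bumped:
  "above sg r r' \<Longrightarrow> row_insert sg r x = (r2, Some y) \<Longrightarrow> above sg r2 (fst (row_insert sg r' y))"
proof (induction sg r r' arbitrary: r2 rule: above.induct)
  case (1 sg r)
  then show ?case using row_bumps_less[of sg x _ y] row_insert_Some[of sg _ x _ y]
    by (cases r) (auto split: if_splits prod.splits)
next
  case (3 sg z r b r')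
  show ?case
  proof (cases "bumps sg x z")
    case True
    then show ?thesis using 3 by auto
  next
    case False
    then obtain r3 where r3: "row_insert sg r x = (r3, Some y)" "r2 = z # r3"
      using 3(3) by (auto split: prod.splits)
    then have "bumps sg z y"
      using False row_bumps_less[of sg x z y] row_insert_Some[of sg r x r3 y] by auto
    moreover have "above sg r3 r'"
      using above_row_insert[of sg r r' x] 3(2) r3 by simp
    ultimately show ?thesis using 3 r3 by (auto split: prod.splits)
  qed
qed auto

lemma right_insert_nonempty [simp]: "right_insert sg T x \<noteq> []"
  by (cases T) (auto split: prod.splits option.splits)

lemma hd_right_insert: "hd (right_insert sg T x) = (if T = [] then [x] else fst (row_insert sg (hd T) x))"
  by (cases T) (auto split: prod.splits option.splits)

lemma tableau_right_insert: "tableau sg T \<Longrightarrow> tableau sg (right_insert sg T x)"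
proof (induction T arbitrary: x)
  case (Cons r T)
  obtain r2 z where r: "row_insert sg r x = (r2, z)" by force
  have r2: "r2 \<noteq> []" "sorted_row sg r2"
    using row_insert_nonempty[of sg r x] sorted_row_insert[of sg r x] Cons.prems r by auto
  show ?case
  proof (cases z)
    case None
    then show ?thesis using Cons.prems r r2 row_insert_None[of sg r x r2]
      by (auto simp: above_append)
  next
    case (Some y)
    have "above sg r2 (hd (right_insert sg T y))"
    proof (cases "T = []")
      case True
      then show ?thesis using above_bumped[of sg r "[]" x r2 y] r Some by (simp add: hd_right_insert)
    next
      case False
      then show ?thesis using above_bumped[of sg r "hd T" x r2 y] r Some Cons.prems
        by (simp add: hd_right_insert)
    qed
    then show ?thesis using Cons r r2 Some by simp
  qed
qed simp

section \<open>Columns of a tableau and removal of the first one\<close>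

definition tcol :: "'a list list \<Rightarrow> nat \<Rightarrow> 'a list" where
  "tcol T j = [r ! j. r \<leftarrow> T, j < length r]"

lemma column_reading_tcol: "column_reading T j = rev (tcol T j)"
  by (simp add: column_reading_def tcol_def)

lemma tcol_Nil [simp]: "tcol [] j = []"
  by (simp add: tcol_def)

lemma tcol_Cons [simp]: "tcol (r # T) j = (if j < length r then [r ! j] else []) @ tcol T j"
  by (simp add: tcol_def)

text \<open>The tableau without its first column; rows of length one are dropped, since a tableau
  has no empty rows here.\<close>

definition tails :: "'a list list \<Rightarrow> 'a list list" where
  "tails T = filter (\<lambda>r. r \<noteq> []) (map tl T)"

lemma tails_Nil [simp]: "tails [] = []"
  by (simp add: tails_def)

lemma tails_Cons [simp]: "tails (r # T) = (if tl r = [] then tails T else tl r # tails T)"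
  by (simp add: tails_def)

lemma tcol_tails [simp]: "tcol (tails T) j = tcol T (Suc j)"
  proof (induction T)
  case (Cons r T)
  then show ?case by (cases r) auto
qed simp

lemma above_length: "above sg r r' \<Longrightarrow> length r' \<le> length r"
  by (induction sg r r' rule: above.induct) auto

lemma tableau_row_length:
  "tableau sg (r # T) \<Longrightarrow> s \<in> set T \<Longrightarrow> length s \<le> length r"
proof (induction T arbitrary: r)
  case (Cons r' T)
  then show ?case using above_length[of sg r r'] by fastforce
qed simp

lemma tcol_empty: "\<forall>s\<in>set T. length s \<le> j \<Longrightarrow> tcol T j = []"
  by (induction T) auto

lemma tcol_nonempty_iff: "tableau sg T \<Longrightarrow> tcol T j \<noteq> [] \<longleftrightarrow> j < n_columns T"
proof (cases T)
  case (Cons r T')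
  assume "tableau sg T"
  then have "\<forall>s\<in>set T'. length s \<le> length r" using tableau_row_length Cons by blast
  then show ?thesis
    using tcol_empty[of T' j] Cons by (cases "j < length r") (force simp: n_columns_def)+
qed (simp add: n_columns_def)

lemma tails_empty: "tableau sg ([x] # T) \<Longrightarrow> tails T = []"
proof (induction T arbitrary: x)
  case (Cons r T)
  then show ?case using above_length[of sg "[x]" r] by (cases r) (auto split: if_splits)
qed simp

lemma above_tl: "above sg r r' \<Longrightarrow> above sg (tl r) (tl r')"
  by (cases r; cases r') auto

lemma tableau_tails: "tableau sg T \<Longrightarrow> tableau sg (tails T)"
proof (induction T)
  case (Cons r T)
  show ?case
  proof (cases "tl r = []")
    case True
    then show ?thesis using Cons by simp
  next
    case False
    have "above sg (tl r) (hd (tails T))" if "tails T \<noteq> []"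
    proof (cases T)
      case [simp]: (Cons r' T')
      have "tl r' \<noteq> []"
      proof
        assume "tl r' = []"
        then have "r' = [hd r']" using Cons.prems by (cases r') auto
        then have "tails T' = []" using tails_empty[of sg "hd r'" T'] Cons.prems by auto
        with \<open>tl r' = []\<close> that show False by simp
      qed
      then show ?thesis using Cons.prems above_tl by auto
    qed (use that in simp)
    moreover have "sorted_row sg (tl r)" using Cons.prems by (cases r) auto
    ultimately show ?thesis using False Cons by auto
  qed
qed simp

lemma jux_tcol: "tableau sg T \<Longrightarrow> jux sg (tcol T 0) (tcol T 1)"
proof (induction T)
  case (Cons r T)
  show ?case
  proof (cases "tl r = []")
    case True
    then obtain x where "r = [x]" using Cons.prems by (cases r) auto
    moreover from this have "tcol T (Suc 0) = []"
      using tails_empty[of sg x T] Cons.prems tcol_tails[of T 0] by simp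
    ultimately show ?thesis by simp
  next
    case False
    then obtain x y s where "r = x # y # s" using Cons.prems by (cases r; cases "tl r") auto
    then show ?thesis using Cons by auto
  qed
qed simp

lemma sorted_tcol_0: "tableau sg T \<Longrightarrow> sorted_wrt (bumps sg) (tcol T 0)"
proof (induction T)
  case (Cons r T)
  have "bumps sg (hd r) y" if "y \<in> set (tcol T 0)" for y
  proof (rule sorted_wrt_bumps_early[OF _ _ that])
    show "sorted_wrt (bumps sg) (tcol T 0)" using Cons by simp
    show "tcol T 0 = [] \<or> bumps sg (hd r) (hd (tcol T 0))"
      using Cons.prems by (cases T; cases r; cases "hd T") auto
  qed
  then show ?case using Cons by (auto simp: hd_conv_nth)
qed simp

text \<open>The bumping path of \<open>x\<close> in \<open>T\<close> follows the one in \<open>tails T\<close> until it enters the first column,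
  which is then pushed down from there.\<close>

lemma right_insert_first_column:
  assumes "tableau sg T" "\<forall>y\<in>set (tcol T 0). bumps sg x y"
  shows "tcol (right_insert sg T x) 0 = x # tcol T 0"
    and "tcol (right_insert sg T x) (Suc j) = tcol T (Suc j)"
proof -
  have "tcol (right_insert sg T x) 0 = x # tcol T 0 \<and> tcol (right_insert sg T x) (Suc j) = tcol T (Suc j)"
    using assms
  proof (induction T arbitrary: x)
    case (Cons r T)
    obtain h s where r: "r = h # s" using Cons.prems by (cases r) auto
    have "bumps sg x h" using Cons.prems r by simp
    moreover have "\<forall>y\<in>set (tcol T 0). bumps sg h y"
      using sorted_tcol_0[OF Cons.prems(1)] r by simp
    ultimately show ?case using Cons r by simp
  qed simp
  then show "tcol (right_insert sg T x) 0 = x # tcol T 0"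
    and "tcol (right_insert sg T x) (Suc j) = tcol T (Suc j)" by simp_all
qed

lemma jux_exists_left: "jux sg us vs \<Longrightarrow> y \<in> set vs \<Longrightarrow> \<exists>x\<in>set us. \<not> bumps sg y x"
  by (induction sg us vs rule: jux.induct) auto

text \<open>Since \<open>x\<close> precedes the whole first column, it precedes the second one too,
  by juxtaposability. So insertion pushes down the first column in \<open>T\<close> as well as in
  \<open>tails T\<close>, and the matching sees \<open>x\<close> as an idle service in front of a
  juxtaposed pair.\<close>

lemma tcol_right_insert_first:
  assumes "tableau sg T" "\<forall>y\<in>set (tcol T 0). bumps sg x y"
  shows "greedy sg (tcol T 0) (tcol (right_insert sg (tails T) x) 0) =
      (tcol (right_insert sg T x) 0, tcol (right_insert sg T x) 1)"
    and "tcol (right_insert sg T x) (Suc (Suc j)) = tcol (right_insert sg (tails T) x) (Suc j)"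
proof -
  note ri = right_insert_first_column[OF assms]
  have "\<forall>y\<in>set (tcol (tails T) 0). bumps sg x y"
    using jux_exists_left[OF jux_tcol[OF assms(1)]] assms(2) bumps_row_less by fastforce
  note ri' = right_insert_first_column[OF tableau_tails[OF assms(1)] this]
  have "greedy sg us (x # vs) = (x # us, vs)" if "jux sg us vs" "\<forall>y\<in>set us. bumps sg x y" for us vs
    using that jux_greedy[OF that(1)] by (cases us; cases vs) auto
  from this[OF jux_tcol assms(2), OF assms(1)]
  show "greedy sg (tcol T 0) (tcol (right_insert sg (tails T) x) 0) =
      (tcol (right_insert sg T x) 0, tcol (right_insert sg T x) 1)"
    using ri ri' by simp
  show "tcol (right_insert sg T x) (Suc (Suc j)) = tcol (right_insert sg (tails T) x) (Suc j)"
    using ri ri' by simp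
qed

text \<open>Insertion into \<open>T\<close> becomes insertion into \<open>tails T\<close> followed
  by one matching, so that a whole column can be peeled off. Row by row the same letter is bumped
  out of \<open>T\<close> and of \<open>tails T\<close> while the path avoids the first column; once
  it enters that column, \<open>tcol_right_insert_first\<close> applies.\<close>

lemma tcol_right_insert:
  assumes "tableau sg T"
  shows "greedy sg (tcol T 0) (tcol (right_insert sg (tails T) x) 0) =
      (tcol (right_insert sg T x) 0, tcol (right_insert sg T x) 1)"
    and "tcol (right_insert sg T x) (Suc (Suc j)) = tcol (right_insert sg (tails T) x) (Suc j)"
proof -
  have "greedy sg (tcol T 0) (tcol (right_insert sg (tails T) x) 0) =
      (tcol (right_insert sg T x) 0, tcol (right_insert sg T x) 1) \<and>
    tcol (right_insert sg T x) (Suc (Suc j)) = tcol (right_insert sg (tails T) x) (Suc j)"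
    using assms
  proof (induction T arbitrary: x)
    case (Cons r T)
    obtain h s where r: "r = h # s" using Cons.prems by (cases r) auto
    show ?case
    proof (cases "bumps sg x h")
      case True
      have "\<forall>y\<in>set (tcol (r # T) 0). bumps sg x y"
        by (intro ballI sorted_wrt_bumps_early[OF sorted_tcol_0[OF Cons.prems]]) (use True r in auto)
      from tcol_right_insert_first[OF Cons.prems this] show ?thesis by blast
    next
      case False
      obtain s' z where s': "row_insert sg s x = (s', z)" by force
      have hs': "\<not> bumps sg (hd s') h"
        using Cons.prems r False s' set_row_insert[of sg s x] row_insert_nonempty[of sg s x]
        by (cases s') auto
      show ?thesis
      proof (cases "s = []")
        \<comment> \<open>The first row \<open>[h]\<close> leaves no row in \<open>tails\<close>, so
          this case is separate: \<open>x\<close> opens the second column next to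
          \<open>h\<close>.\<close>
        case True
        then show ?thesis
          using Cons.prems r False tails_empty[of sg h T] jux_tcol[of sg T] s' hs'
            tcol_tails[of T] by (cases T) auto
      next
        case s: False
        obtain a s'' where a: "s' = a # s''" using s' row_insert_nonempty[of sg s x] by (cases s') auto
        show ?thesis
        proof (cases z)
          case None
          then show ?thesis
            using Cons.prems r False s s' hs' a jux_greedy[OF jux_tcol[of sg T]] by auto
        next
          case (Some y)
          then show ?thesis
            using Cons.prems r False s s' hs' a Cons.IH[of y] by auto
        qed
      qed
    qed
  qed simp
  then show "greedy sg (tcol T 0) (tcol (right_insert sg (tails T) x) 0) =
      (tcol (right_insert sg T x) 0, tcol (right_insert sg T x) 1)"
    and "tcol (right_insert sg T x) (Suc (Suc j)) = tcol (right_insert sg (tails T) x) (Suc j)"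
    by simp_all
qed

section \<open>Column readings of tableaux as normal forms\<close>

definition reading_columns :: "'a list list \<Rightarrow> 'a list list" where
  "reading_columns T = map (column_reading T) [0..<n_columns T]"

lemma n_columns_tails: "tableau sg T \<Longrightarrow> n_columns (tails T) = n_columns T - 1"
proof (cases "tails T")
  case (Cons r U)
  assume T: "tableau sg T"
  have "j < n_columns (tails T) \<longleftrightarrow> j < n_columns T - 1" for j
    using tcol_nonempty_iff[OF T, of "Suc j"] tcol_nonempty_iff[OF tableau_tails[OF T], of j] by auto
  then have "{..<n_columns (tails T)} = {..<n_columns T - 1}" by (simp add: lessThan_def)
  then show ?thesis by simp
next
  case Nil
  assume T: "tableau sg T"
  then show ?thesis using tcol_nonempty_iff[OF T, of 1] Nil tcol_tails[of T 0]
    by (simp add: n_columns_def)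
qed

lemma reading_columns_eqI:
  assumes "tableau sg T" "tableau sg T'" "\<And>j. tcol T j = tcol T' j"
  shows "reading_columns T = reading_columns T'"
proof -
  have "{..<n_columns T} = {..<n_columns T'}"
    using tcol_nonempty_iff[OF assms(1)] tcol_nonempty_iff[OF assms(2)] assms(3)
    by (simp add: lessThan_def)
  then have "n_columns T = n_columns T'" by simp
  then show ?thesis using assms(3) by (simp add: reading_columns_def column_reading_tcol)
qed

lemma reading_columns_Cons:
  assumes "tableau sg T" "T \<noteq> []"
  shows "reading_columns T = column_reading T 0 # reading_columns (tails T)"
proof -
  have "n_columns T = Suc (n_columns (tails T))"
    using n_columns_tails[OF assms(1)] assms by (cases T; cases "hd T") (auto simp: n_columns_def)
  then show ?thesis
    by (simp add: reading_columns_def column_reading_tcol upt_conv_Cons map_Suc_upt[symmetric] o_def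
        del: upt_Suc)
qed

lemma reading_columns_Nil [simp]: "reading_columns [] = []"
  by (simp add: reading_columns_def n_columns_def)

lemma column_reading_scols: "tableau sg T \<Longrightarrow> column_reading T 0 \<in> scols UNIV sg"
  by (simp add: scols_def super_column_rev column_reading_tcol sorted_tcol_0 lists_UNIV)

lemma reading_columns_columns: "tableau sg T \<Longrightarrow> reading_columns T \<in> lists (columns UNIV sg)"
proof (induction "n_columns T" arbitrary: T)
  case 0
  then show ?case by (simp add: reading_columns_def)
next
  case (Suc n)
  then have "T \<noteq> []" "reading_columns (tails T) \<in> lists (columns UNIV sg)"
    using n_columns_tails[of sg T] tableau_tails[of sg T] by (auto simp: n_columns_def)
  then show ?case
    using Suc.prems column_reading_scols[of sg T] tcol_nonempty_iff[of sg T 0] Suc.hyps(2)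
    by (simp add: reading_columns_Cons[OF Suc.prems] columns_scols column_reading_tcol)
qed

text \<open>Neighbouring columns of a tableau are juxtaposable: the inserted column stays where it
  is and hands on the next one unchanged, and so on to the right end.\<close>

lemma col_insert_reading_columns:
  "tableau sg T \<Longrightarrow> T \<noteq> [] \<Longrightarrow>
   col_insert sg (column_reading T 0) (reading_columns (tails T)) = reading_columns T"
proof (induction "n_columns T" arbitrary: T)
  case 0
  then show ?case by (cases T) (auto simp: n_columns_def)
next
  case (Suc n)
  let ?U = "tails T"
  have ne: "column_reading T 0 \<noteq> []"
    using Suc tcol_nonempty_iff[of sg T 0] by (simp add: column_reading_tcol)
  show ?case
  proof (cases "?U = []")
    case True
    then show ?thesis
      using ne by (simp add: reading_columns_Cons[OF Suc.prems] colgen_def)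
  next
    case False
    have U: "tableau sg ?U" using Suc tableau_tails by blast
    note cU = reading_columns_Cons[OF U False]
    have j: "juxtaposable sg (column_reading T 0) (column_reading ?U 0)"
      using jux_tcol[OF Suc.prems(1)] by (simp add: juxtaposable_jux column_reading_tcol)
    have "col_insert sg (column_reading ?U 0) (reading_columns (tails ?U)) = reading_columns ?U"
      using Suc n_columns_tails[of sg T] U False by auto
    then show ?thesis
      using ne by (simp add: reading_columns_Cons[OF Suc.prems] cU colgen_nonempty
          juxtaposable_lcol[OF j] juxtaposable_rcol[OF j])
  qed
qed

lemma normalize_reading_columns:
  "tableau sg T \<Longrightarrow> foldr (col_insert sg) (reading_columns T) [] = reading_columns T"
proof (induction "n_columns T" arbitrary: T)
  case 0
  then show ?case by (simp add: reading_columns_def)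
next
  case (Suc n)
  then have T: "T \<noteq> []" by (auto simp: n_columns_def)
  have "foldr (col_insert sg) (reading_columns (tails T)) [] = reading_columns (tails T)"
    using Suc n_columns_tails[of sg T] tableau_tails[of sg T] by auto
  then show ?case
    using col_insert_reading_columns[OF Suc.prems T] by (simp add: reading_columns_Cons[OF Suc.prems T])
qed

text \<open>By \<open>tcol_right_insert\<close>, the first two columns after insertion are the
  matched version of the old first column and the first column of the smaller insertion;
  \<open>col_insert_col_insert\<close> undoes this matching and leaves the induction hypothesis for
  \<open>tails T\<close>. The tail \<open>ts\<close> is arbitrary because words are later taken
  apart from their right end, each removed letter moving into \<open>ts\<close>.\<close>

lemma foldr_reading_columns_right_insert:
  assumes "tableau sg T" "ts \<in> lists (columns UNIV sg)"
  shows "foldr (col_insert sg) (reading_columns (right_insert sg T x)) ts =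
    foldr (col_insert sg) (reading_columns T) (col_insert sg [x] ts)"
  using assms
proof (induction "n_columns T" arbitrary: T)
  case 0
  then have T: "T = []" by (cases T) (auto simp: n_columns_def)
  then show ?case
    by (simp add: reading_columns_def column_reading_tcol n_columns_def)
next
  case (Suc n)
  then have T: "T \<noteq> []" by (auto simp: n_columns_def)
  let ?K = "right_insert sg (tails T) x" and ?R = "right_insert sg T x"
  have tT: "tableau sg (tails T)" using Suc.prems tableau_tails by blast
  have tK: "tableau sg ?K" "?K \<noteq> []" using tT tableau_right_insert by auto
  have tR: "tableau sg ?R" "?R \<noteq> []" using Suc.prems tableau_right_insert by auto
  let ?c = "column_reading T 0" and ?k = "column_reading ?K 0"
  have IH: "foldr (col_insert sg) (reading_columns ?K) ts =
      foldr (col_insert sg) (reading_columns (tails T)) (col_insert sg [x] ts)"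
    using Suc n_columns_tails[of sg T] tT by auto
  have ck: "column_reading ?R 0 = lcol sg ?c ?k" "column_reading ?R 1 = rcol sg ?c ?k"
    using tcol_right_insert(1)[OF Suc.prems(1), of x] by (simp_all add: column_reading_tcol lcol_def rcol_def)
  have cs: "reading_columns (tails K) = reading_columns (tails (tails R))"
    if "tableau sg K" "tableau sg R" "\<And>j. tcol R (Suc (Suc j)) = tcol K (Suc j)" for K R
    using that by (intro reading_columns_eqI[of sg]) (auto simp: tableau_tails)
  \<comment> \<open>\<open>colgen\<close> covers the case of a tableau that still has a single
    column after the insertion.\<close>
  have R: "reading_columns ?R = lcol sg ?c ?k # colgen (rcol sg ?c ?k) @ reading_columns (tails ?K)"
  proof (cases "tails ?R = []")
    case True
    then have "rcol sg ?c ?k = []"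
      using ck(2) tcol_tails[of ?R 0] by (simp add: column_reading_tcol)
    moreover have "reading_columns (tails ?K) = []"
      using cs[OF tK(1) tR(1)] tcol_right_insert(2)[OF Suc.prems(1)] True by simp
    ultimately show ?thesis
      using True ck by (simp add: reading_columns_Cons[OF tR])
  next
    case False
    note tU = tableau_tails[OF tR(1)]
    have "column_reading (tails ?R) 0 = rcol sg ?c ?k"
      using ck(2) by (simp add: column_reading_tcol)
    moreover from this have "rcol sg ?c ?k \<noteq> []"
      using tcol_nonempty_iff[OF tU, of 0] tU False
      by (cases "tails ?R") (auto simp: column_reading_tcol n_columns_def)
    ultimately show ?thesis
      using ck cs[OF tK(1) tR(1)] tcol_right_insert(2)[OF Suc.prems(1)]
      by (simp add: reading_columns_Cons[OF tR] reading_columns_Cons[OF tU False] colgen_def)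
  qed
  define Z where "Z = foldr (col_insert sg) (reading_columns (tails ?K)) ts"
  have "reading_columns (tails ?K) \<in> lists (columns UNIV sg)"
    using tableau_tails[OF tK(1)] reading_columns_columns by blast
  then have Z: "Z \<in> lists (columns UNIV sg)"
    unfolding Z_def using Suc.prems by (intro foldr_col_insert_columns) (auto simp: columns_in_scols)
  have c: "?c \<in> scols UNIV sg" "?k \<in> scols UNIV sg"
    using Suc.prems tK column_reading_scols by auto
  have "foldr (col_insert sg) (reading_columns ?R) ts = col_insert sg (lcol sg ?c ?k) (col_insert sg (rcol sg ?c ?k) Z)"
    using col_insert_Nil[OF Z] by (simp add: R Z_def[symmetric] colgen_def)
  also have "\<dots> = col_insert sg ?c (foldr (col_insert sg) (reading_columns ?K) ts)"
    using col_insert_col_insert[OF c Z] by (simp add: reading_columns_Cons[OF tK] Z_def)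
  also have "\<dots> = foldr (col_insert sg) (reading_columns T) (col_insert sg [x] ts)"
    using IH by (simp add: reading_columns_Cons[OF Suc.prems(1) T])
  finally show ?case .
qed

lemma letters_scols [simp]: "map (\<lambda>x. [x]) w \<in> lists (scols UNIV sg)"
  by (auto simp: scols_def super_column_def)

lemma tableau_insert_word: "tableau sg (insert_word sg w)"
  by (induction w rule: rev_induct) (simp_all add: insert_word_def tableau_right_insert)

text \<open>Normalizing the reading of the tableau amounts to inserting the letters as one-letter
  columns, and such a reading is already normal.\<close>

lemma reading_columns_insert_word:
  "reading_columns (insert_word sg w) = foldr (col_insert sg) (map (\<lambda>x. [x]) w) []"
proof -
  have "foldr (col_insert sg) (reading_columns (insert_word sg w)) ts =
      foldr (col_insert sg) (map (\<lambda>x. [x]) w) ts" if "ts \<in> lists (columns UNIV sg)" for ts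
    using that
  proof (induction w arbitrary: ts rule: rev_induct)
    case (snoc x w)
    have "[x] \<in> scols UNIV sg" by (simp add: scols_def super_column_def lists_UNIV)
    then show ?case
      using snoc foldr_reading_columns_right_insert[OF tableau_insert_word snoc.prems, of w x]
      by (simp add: insert_word_def)
  qed (simp add: insert_word_def)
  from this[of "[]"] show ?thesis
    unfolding normalize_reading_columns[OF tableau_insert_word] by simp
qed

lemma left_col_eq_lcol:
  assumes "u \<in> scols S sg" "v \<in> scols S sg"
  shows "left_col sg u v = lcol sg u v" and "right_col sg u v = rcol sg u v"
proof -
  let ?T = "insert_word sg (u @ v)"
  have uv: "u \<in> scols UNIV sg" "v \<in> scols UNIV sg"
    using assms by (auto simp: scols_def)
  have rc: "reading_columns ?T = colgen (lcol sg u v) @ colgen (rcol sg u v)"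
    using uv by (simp add: reading_columns_insert_word foldr_letters[of _ UNIV] col_insert_colgen[of _ UNIV])
  have n: "n_columns ?T = length (reading_columns ?T)"
    by (simp add: reading_columns_def)
  have "left_col sg u v = lcol sg u v \<and> right_col sg u v = rcol sg u v"
  proof (cases "rcol sg u v = []")
    case True
    \<comment> \<open>Without a right column \<open>left_col\<close> and \<open>right_col\<close>
      return their default values, which \<open>rcol_Nil_lcol\<close> shows to be the right
      ones.\<close>
    then have "n_columns ?T \<noteq> 2" using n rc by (simp add: colgen_def)
    then show ?thesis using True rcol_Nil_lcol[OF True] by (simp add: left_col_def right_col_def)
  next
    case False
    then have "lcol sg u v \<noteq> []" by (metis lcol_Nil_iff rcol_Nil1)
    then have rc': "reading_columns ?T = [lcol sg u v, rcol sg u v]" using False rc by (simp add: colgen_def)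
    then have n2: "n_columns ?T = 2" using n by simp
    with rc' show ?thesis
      by (simp add: left_col_def right_col_def reading_columns_def upt_rec)
  qed
  then show "left_col sg u v = lcol sg u v" "right_col sg u v = rcol sg u v" by simp_all
qed

lemma reading_columns_insert_three:
  assumes "u \<in> scols S sg" "v \<in> scols S sg" "t \<in> scols S sg" "u \<noteq> []" "v \<noteq> []" "t \<noteq> []"
  shows "reading_columns (insert_word sg (u @ v @ t)) =
    colgen (lcol sg u (lcol sg v t)) @
    colgen (lcol sg (rcol sg u (lcol sg v t)) (rcol sg v t)) @
    colgen (rcol sg (rcol sg u (lcol sg v t)) (rcol sg v t))"
proof -
  have s: "u \<in> scols UNIV sg" "v \<in> scols UNIV sg" "t \<in> scols UNIV sg"
    using assms by (auto simp: scols_def)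
  then have "reading_columns (insert_word sg (u @ v @ t)) =
      col_insert sg u (col_insert sg v (colgen t))"
    by (simp add: reading_columns_insert_word foldr_letters[of _ UNIV])
  also have "\<dots> = colgen (lcol sg u (lcol sg v t)) @ col_insert sg (rcol sg u (lcol sg v t)) (colgen (rcol sg v t))"
    using assms s by (simp add: col_insert_colgen[of _ UNIV] colgen_nonempty)
  finally show ?thesis
    using s by (simp add: col_insert_colgen[of _ UNIV])
qed

lemma nth_reading_columns:
  "tableau sg T \<Longrightarrow> column_reading T j = (if j < length (reading_columns T) then reading_columns T ! j else [])"
  using tcol_nonempty_iff[of sg T j] by (auto simp: reading_columns_def column_reading_tcol)

section \<open>The monoid\<close>

lemma word_cong_lists:
  assumes "R \<subseteq> lists X \<times> lists X"
  shows "word_cong X R \<subseteq> lists X \<times> lists X"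
proof
  fix p assume "p \<in> word_cong X R"
  moreover have "a \<in> lists X \<and> b \<in> lists X" if "(a, b) \<in> word_cong X R" for a b
    using that assms by (induction rule: word_cong.induct) auto
  ultimately show "p \<in> lists X \<times> lists X" by (cases p) blast
qed

lemma equiv_word_cong:
  assumes "R \<subseteq> lists X \<times> lists X"
  shows "equiv (lists X) (word_cong X R)"
proof (rule equivI)
  show "word_cong X R \<subseteq> lists X \<times> lists X" by (rule word_cong_lists[OF assms])
  show "refl_on (lists X) (word_cong X R)"
    using word_cong_lists[OF assms] by (intro refl_onI word_cong.refl)
  show "sym (word_cong X R)" by (rule symI) (rule word_cong.sym)
  show "trans (word_cong X R)" by (rule transI) (rule word_cong.trans)
qed

lemma word_cong_context:
  "(w, w') \<in> word_cong X R \<Longrightarrow> p \<in> lists X \<Longrightarrow> s \<in> lists X \<Longrightarrow> (p @ w @ s, p @ w' @ s) \<in> word_cong X R"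
  by (intro word_cong.mult word_cong.refl)

lemma word_cong_map:
  assumes "(w, w') \<in> word_cong X R"
    and "\<And>w. w \<in> lists X \<Longrightarrow> f w \<in> lists Y" "\<And>w w'. f (w @ w') = f w @ f w'"
    and "\<And>l r. (l, r) \<in> R \<Longrightarrow> (f l, f r) \<in> word_cong Y Q"
  shows "(f w, f w') \<in> word_cong Y Q"
  using assms(1)
proof (induction rule: word_cong.induct)
  case (refl w)
  then show ?case by (intro word_cong.refl assms(2))
qed (auto simp: assms(3,4) intro: word_cong.sym word_cong.trans word_cong.mult)

lemma presented_monoid_iso:
  fixes f :: "'x list \<Rightarrow> 'y list" and g :: "'y list \<Rightarrow> 'x list"
  assumes R: "R \<subseteq> lists X \<times> lists X" and Q: "Q \<subseteq> lists Y \<times> lists Y"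
    and f: "\<And>w. w \<in> lists X \<Longrightarrow> f w \<in> lists Y" "\<And>w w'. f (w @ w') = f w @ f w'"
      "\<And>l r. (l, r) \<in> R \<Longrightarrow> (f l, f r) \<in> word_cong Y Q"
    and g: "\<And>w. w \<in> lists Y \<Longrightarrow> g w \<in> lists X" "\<And>w w'. g (w @ w') = g w @ g w'"
      "\<And>l r. (l, r) \<in> Q \<Longrightarrow> (g l, g r) \<in> word_cong X R"
    and gf: "\<And>w. w \<in> lists X \<Longrightarrow> (g (f w), w) \<in> word_cong X R"
    and fg: "\<And>w. w \<in> lists Y \<Longrightarrow> (f (g w), w) \<in> word_cong Y Q"
  shows "presented_monoid X R \<cong> presented_monoid Y Q"
proof -
  let ?C = "word_cong X R" and ?D = "word_cong Y Q"
  note C = equiv_word_cong[OF R] and D = equiv_word_cong[OF Q]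
  define h where "h A = (\<Union>a\<in>A. ?D `` {f a})" for A
  have fC: "(f w, f w') \<in> ?D" if "(w, w') \<in> ?C" for w w'
    using word_cong_map[OF that] f by blast
  have gD: "(g w, g w') \<in> ?C" if "(w, w') \<in> ?D" for w w'
    using word_cong_map[OF that] g by blast
  have h: "h (?C `` {w}) = ?D `` {f w}" if "w \<in> lists X" for w
  proof -
    have "?D `` {f a} = ?D `` {f w}" if "(w, a) \<in> ?C" for a
      using fC[OF that] equiv_class_eq[OF D] by blast
    moreover have "(w, w) \<in> ?C" using that by (rule word_cong.refl)
    ultimately show ?thesis unfolding h_def by blast
  qed
  have mult: "(\<Union>a\<in>word_cong Z P `` {w}. \<Union>b\<in>word_cong Z P `` {w'}. word_cong Z P `` {a @ b}) =
      word_cong Z P `` {w @ w'}"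
    if "P \<subseteq> lists Z \<times> lists Z" "w \<in> lists Z" "w' \<in> lists Z"
    for Z :: "'z set" and P w w'
  proof -
    have "word_cong Z P `` {a @ b} = word_cong Z P `` {w @ w'}"
      if "(w, a) \<in> word_cong Z P" "(w', b) \<in> word_cong Z P" for a b
      using word_cong.mult[OF that] equiv_class_eq[OF equiv_word_cong[OF \<open>P \<subseteq> _\<close>]] by blast
    moreover have "(w, w) \<in> word_cong Z P" "(w', w') \<in> word_cong Z P"
      using that by (auto intro: word_cong.refl)
    ultimately show ?thesis by blast
  qed
  have hom: "h \<in> hom (presented_monoid X R) (presented_monoid Y Q)"
  proof (rule homI)
    fix A assume "A \<in> carrier (presented_monoid X R)"
    then obtain w where "w \<in> lists X" "A = ?C `` {w}"
      by (auto simp: presented_monoid_def simp del: in_lists_conv_set elim!: quotientE)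
    then show "h A \<in> carrier (presented_monoid Y Q)"
      using h f(1) by (simp add: presented_monoid_def quotientI del: in_lists_conv_set)
  next
    fix A B assume "A \<in> carrier (presented_monoid X R)" "B \<in> carrier (presented_monoid X R)"
    then obtain w w' where w: "w \<in> lists X" "A = ?C `` {w}" "w' \<in> lists X" "B = ?C `` {w'}"
      by (auto simp: presented_monoid_def simp del: in_lists_conv_set elim!: quotientE)
    have "A \<otimes>\<^bsub>presented_monoid X R\<^esub> B = ?C `` {w @ w'}"
      using mult[OF R w(1,3)] w by (simp add: presented_monoid_def)
    moreover have "h A \<otimes>\<^bsub>presented_monoid Y Q\<^esub> h B = ?D `` {f w @ f w'}"
      using mult[OF Q f(1)[OF w(1)] f(1)[OF w(3)]] w h by (simp add: presented_monoid_def)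
    ultimately show "h (A \<otimes>\<^bsub>presented_monoid X R\<^esub> B) = h A \<otimes>\<^bsub>presented_monoid Y Q\<^esub> h B"
      using h[of "w @ w'"] w f(2) by simp
  qed
  have inj: "A = B" if A: "A \<in> lists X // ?C" and B: "B \<in> lists X // ?C" and "h A = h B" for A B
  proof -
    from A B obtain w w' where w: "w \<in> lists X" "A = ?C `` {w}" "w' \<in> lists X" "B = ?C `` {w'}"
      by (meson quotientE)
    then have "?D `` {f w} = ?D `` {f w'}" using that h by simp
    then have "(f w, f w') \<in> ?D" using eq_equiv_class[OF _ D] f w by blast
    then have "(w, w') \<in> ?C"
      using gD gf[OF w(1)] gf[OF w(3)] by (meson word_cong.sym word_cong.trans)
    then show ?thesis using w equiv_class_eq[OF C] by simp
  qed
  have surj: "B \<in> h ` (lists X // ?C)" if "B \<in> lists Y // ?D" for B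
  proof -
    from that obtain w where w: "w \<in> lists Y" "B = ?D `` {w}" by (rule quotientE)
    then have "B = ?D `` {f (g w)}" using equiv_class_eq[OF D fg] by simp
    then have "B = h (?C `` {g w})" using h g w by simp
    then show ?thesis using quotientI[of "g w" "lists X" ?C] g w by blast
  qed
  have "h \<in> iso (presented_monoid X R) (presented_monoid Y Q)"
  proof (rule isoI[OF hom])
    show "bij_betw h (carrier (presented_monoid X R)) (carrier (presented_monoid Y Q))"
      unfolding bij_betw_def inj_on_def
      using inj surj hom by (auto simp: presented_monoid_def hom_def)
  qed
  then show ?thesis by (auto simp: is_iso_def)
qed

section \<open>The super plactic congruence realizes the matching\<close>

abbreviation plactic_cong :: "'a::linorder set \<Rightarrow> ('a \<Rightarrow> bit) \<Rightarrow> ('a list \<times> 'a list) set" where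
  "plactic_cong S sg \<equiv> word_cong S (super_plactic_relations S sg)"

lemma plactic_zxy:
  assumes "x \<in> S" "y \<in> S" "z \<in> S" "\<not> bumps sg y x" "bumps sg y z"
  shows "([z, x, y], [x, z, y]) \<in> super_plactic_relations S sg"
proof -
  have "x \<le> y" "y \<le> z" "x = y \<longrightarrow> sg y = 0" "y = z \<longrightarrow> sg y = 1"
    using assms by (auto simp: bumps_def split: if_splits)
  then show ?thesis unfolding super_plactic_relations_def using assms by blast
qed

lemma plactic_yzx:
  assumes "x \<in> S" "y \<in> S" "z \<in> S" "bumps sg x y" "\<not> bumps sg z y"
  shows "([y, z, x], [y, x, z]) \<in> super_plactic_relations S sg"
proof -
  have "x \<le> y" "y \<le> z" "x = y \<longrightarrow> sg y = 1" "y = z \<longrightarrow> sg y = 0"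
    using assms by (auto simp: bumps_def split: if_splits)
  then show ?thesis unfolding super_plactic_relations_def using assms by blast
qed

lemma super_plactic_relations_cases:
  assumes "(l, r) \<in> super_plactic_relations S sg"
  obtains (zxy) x y z where "l = [z, x, y]" "r = [x, z, y]" "x \<in> S" "y \<in> S" "z \<in> S"
      "\<not> bumps sg y x" "bumps sg y z"
  | (yzx) x y z where "l = [y, z, x]" "r = [y, x, z]" "x \<in> S" "y \<in> S" "z \<in> S"
      "bumps sg x y" "\<not> bumps sg z y"
proof -
  have 1: "\<not> bumps sg y x" if "x \<le> y" "x = y \<longrightarrow> sg y = 0" for x y
    using that by (auto simp: bumps_def)
  have 2: "bumps sg x y" if "x \<le> y" "x = y \<longrightarrow> sg y = 1" for x y
    using that by (auto simp: bumps_def le_less)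
  from assms show thesis
    unfolding super_plactic_relations_def
    using zxy yzx 1 2 by blast
qed

text \<open>\<open>x\<close> moves to the right past one letter at a time. Exchanging it with
  \<open>d\<close> requires the letter that follows \<open>d\<close> as a witness; the final
  \<open>y\<close> is that witness for the last letter of \<open>ds\<close>.\<close>

lemma plactic_letter_left:
  assumes "x \<in> S" "y \<in> S" "ds \<in> lists S" "\<not> bumps sg y x"
    and "sorted_wrt (\<lambda>a b. bumps sg b a) (ds @ [y])"
  shows "(x # ds @ [y], ds @ [x, y]) \<in> plactic_cong S sg"
  using assms
proof (induction ds)
  case Nil
  then show ?case by (simp add: word_cong.refl)
next
  case (Cons d ds)
  obtain n s where n: "ds @ [y] = n # s" by (cases "ds @ [y]") auto
  have "n \<in> set (ds @ [y])" unfolding n by simp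
  then have "\<not> bumps sg n x" "bumps sg n d" "n \<in> S"
    using Cons.prems by (auto simp: sorted_wrt_append dest: row_bumps_trans)
  then have "([d, x, n], [x, d, n]) \<in> plactic_cong S sg"
    using Cons.prems by (intro word_cong.base plactic_zxy) auto
  moreover have "s \<in> lists S" using n Cons.prems by (metis append_in_lists_conv Cons_in_lists_iff lists.Nil)
  ultimately have "(x # d # n # s, d # x # n # s) \<in> plactic_cong S sg"
    using word_cong_context[OF word_cong.sym, of "[d, x, n]" "[x, d, n]" S _ "[]" s] by simp
  moreover have "([d] @ (x # ds @ [y]) @ [], [d] @ (ds @ [x, y]) @ []) \<in> plactic_cong S sg"
    using Cons by (intro word_cong_context) auto
  ultimately show ?case using n[symmetric] word_cong.trans by fastforce
qed

text \<open>\<open>y\<close> moves to the right past \<open>rs\<close>. Here the witness is the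
  letter on its left, first \<open>x\<close> and afterwards the letter just passed.\<close>

lemma plactic_letter_right:
  assumes "x \<in> S" "y \<in> S" "rs \<in> lists S" "\<not> bumps sg y x"
    and "sorted_wrt (\<lambda>a b. bumps sg b a) (x # rs)"
  shows "(x # y # rs, x # rs @ [y]) \<in> plactic_cong S sg"
  using assms
proof (induction rs arbitrary: x)
  case Nil
  then show ?case by (simp add: word_cong.refl)
next
  case (Cons r rs)
  then have r: "bumps sg r x" "\<not> bumps sg y r" using bumps_row_trans[of sg r x y] by auto
  then have "([x, y, r], [x, r, y]) \<in> plactic_cong S sg"
    using Cons.prems by (intro word_cong.base plactic_yzx) auto
  then have "(x # y # r # rs, x # r # y # rs) \<in> plactic_cong S sg"
    using word_cong_context[of "[x, y, r]" "[x, r, y]" S _ "[]" rs] Cons.prems by simp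
  moreover have "([x] @ (r # y # rs) @ [], [x] @ (r # rs @ [y]) @ []) \<in> plactic_cong S sg"
    using Cons r by (intro word_cong_context) auto
  ultimately show ?case using word_cong.trans by fastforce
qed

lemma greedy_skip:
  "\<forall>v\<in>set lo. \<forall>u\<in>set us. bumps sg v u \<Longrightarrow> greedy sg us (lo @ hi) = apfst ((@) lo) (greedy sg us hi)"
proof (induction lo)
  case Nil
  then show ?case by (cases "greedy sg us hi") simp
next
  case (Cons v lo)
  then show ?case by (cases us; cases "greedy sg us hi") auto
qed

text \<open>The top letter \<open>u\<close> of the first column is inserted into the second one,
  where it displaces the first entry \<open>y\<close> that may stand to its right.
  \<open>plactic_letter_left\<close> brings \<open>u\<close> next to \<open>y\<close>, and
  \<open>plactic_letter_right\<close> sends \<open>y\<close> to the end of the word, where it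
  becomes the top of the right column.\<close>

lemma plactic_greedy:
  assumes "set us \<subseteq> S" "set vs \<subseteq> S" "sorted_wrt (bumps sg) us" "sorted_wrt (bumps sg) vs"
  shows "(rev us @ rev vs, rev (fst (greedy sg us vs)) @ rev (snd (greedy sg us vs))) \<in> plactic_cong S sg"
  using assms
proof (induction us arbitrary: vs)
  case Nil
  then show ?case by (auto intro!: word_cong.refl)
next
  case (Cons u us)
  define lo rest where "lo = takeWhile (\<lambda>v. bumps sg v u) vs" and "rest = dropWhile (\<lambda>v. bumps sg v u) vs"
  have vs: "vs = lo @ rest" by (simp add: lo_def rest_def)
  have lo: "\<forall>v\<in>set lo. bumps sg v u" by (auto simp: lo_def dest: set_takeWhileD)
  then have lo': "\<forall>v\<in>set lo. \<forall>u\<in>set (u # us). bumps sg v u"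
    using Cons.prems bumps_trans[of sg _ u] by auto
  have s: "sorted_wrt (bumps sg) lo" using Cons.prems vs by (auto simp: sorted_wrt_append)
  show ?case
  proof (cases rest)
    case Nil
    \<comment> \<open>No entry accepts \<open>u\<close>, which is then attached at the bottom of the
      second column.\<close>
    have "greedy sg us [u] = (u # us, [])" using Cons.prems by (cases us) auto
    then have "greedy sg us (vs @ [u]) = greedy sg (u # us) vs"
      using greedy_skip[of lo "u # us" sg "[]"] greedy_skip[of lo us sg "[u]"] lo' vs Nil by auto
    moreover have "(rev us @ rev (vs @ [u]), rev (fst (greedy sg us (vs @ [u]))) @ rev (snd (greedy sg us (vs @ [u])))) \<in> plactic_cong S sg"
      by (rule Cons.IH) (use Cons.prems lo s vs Nil in \<open>auto simp: sorted_wrt_append\<close>)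
    ultimately show ?thesis by simp
  next
    case rest: (Cons y hi)
    then have y: "\<not> bumps sg y u" using hd_dropWhile[of "\<lambda>v. bumps sg v u" vs] by (simp add: rest_def)
    have sh: "sorted_wrt (bumps sg) (y # hi)" "\<forall>a\<in>set lo. \<forall>b\<in>set hi. bumps sg a b"
      using Cons.prems vs rest by (auto simp: sorted_wrt_append)
    then have uh: "\<forall>b\<in>set hi. bumps sg u b" using row_bumps_less[of sg y u] y by auto
    have S: "u \<in> S" "y \<in> S" "lo \<in> lists S" "hi \<in> lists S" "us \<in> lists S"
      using Cons.prems vs rest by auto
    let ?v = "lo @ u # hi"
    have sv: "sorted_wrt (bumps sg) ?v" using s sh uh lo by (auto simp: sorted_wrt_append)
    obtain l r where lr: "greedy sg us hi = (l, r)" by force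
    have g1: "greedy sg (u # us) vs = (lo @ u # l, y # r)"
      using greedy_skip[OF lo', of rest] vs rest y lr by simp
    have "greedy sg us (u # hi) = (u # l, r)"
      using Cons.prems lr by (cases us) auto
    then have g2: "greedy sg us ?v = (lo @ u # l, r)"
      using greedy_skip[of lo us sg "u # hi"] lo' by simp
    have IH: "(rev us @ rev ?v, rev (lo @ u # l) @ rev r) \<in> plactic_cong S sg"
      using Cons.IH[of ?v] Cons.prems sv S unfolding g2 by auto
    then have 3: "((rev us @ rev ?v) @ [y], (rev (lo @ u # l) @ rev r) @ [y]) \<in> plactic_cong S sg"
      using S by (intro word_cong.mult[OF IH] word_cong.refl) auto
    have "(u # rev hi @ [y], rev hi @ [u, y]) \<in> plactic_cong S sg"
      using S y sh by (intro plactic_letter_left) (auto simp: sorted_wrt_append sorted_wrt_rev)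
    then have 1: "(rev us @ (u # rev hi @ [y]) @ rev lo, rev us @ (rev hi @ [u, y]) @ rev lo) \<in> plactic_cong S sg"
      using S by (intro word_cong_context) auto
    have "(u # y # rev lo, u # rev lo @ [y]) \<in> plactic_cong S sg"
      using S y lo s by (intro plactic_letter_right) (auto simp: sorted_wrt_rev)
    then have 2: "((rev us @ rev hi) @ (u # y # rev lo) @ [], (rev us @ rev hi) @ (u # rev lo @ [y]) @ []) \<in> plactic_cong S sg"
      using S by (intro word_cong_context) auto
    have "(rev us @ (u # rev hi @ [y]) @ rev lo, (rev (lo @ u # l) @ rev r) @ [y]) \<in> plactic_cong S sg"
      using word_cong.trans[OF 1] word_cong.trans[OF _ 3] 2 by simp
    then show ?thesis unfolding g1 by (simp add: vs rest)
  qed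
qed

lemma plactic_lcol_rcol:
  assumes "u \<in> scols S sg" "v \<in> scols S sg"
  shows "(u @ v, lcol sg u v @ rcol sg u v) \<in> plactic_cong S sg"
  using plactic_greedy[of "rev u" S "rev v" sg] assms
  by (auto simp: scols_def super_column_rev lcol_def rcol_def)

section \<open>Comparison of the column presentation with the plactic one\<close>

lemma Col2_simps [simp]:
  "gens (Col2 S sg) = columns S sg"
  "(u, v) \<in> rules (Col2 S sg) \<longleftrightarrow> u \<in> columns S sg \<and> v \<in> columns S sg \<and> \<not> juxtaposable sg u v"
  "rsrc (Col2 S sg) (u, v) = colgen u @ colgen v"
  "rtgt (Col2 S sg) (u, v) = colgen (left_col sg u v) @ colgen (right_col sg u v)"
  by (simp_all add: Col2_def)

definition col_relations ::
  "'a::linorder set \<Rightarrow> ('a \<Rightarrow> bit) \<Rightarrow> ('a list list \<times> 'a list list) set" where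
  "col_relations S sg = {(rsrc (Col2 S sg) r, rtgt (Col2 S sg) r) | r. r \<in> rules (Col2 S sg)}"

lemma col_relations_lists: "col_relations S sg \<subseteq> lists (columns S sg) \<times> lists (columns S sg)"
proof
  fix p assume "p \<in> col_relations S sg"
  then obtain u v where "p = (colgen u @ colgen v, colgen (left_col sg u v) @ colgen (right_col sg u v))"
    "u \<in> scols S sg" "v \<in> scols S sg"
    by (auto simp: col_relations_def columns_scols)
  then show "p \<in> lists (columns S sg) \<times> lists (columns S sg)"
    by (simp add: left_col_eq_lcol[of _ S] del: in_lists_conv_set)
qed

lemma col_cong:
  assumes "u \<in> scols S sg" "v \<in> scols S sg"
  shows "(colgen u @ colgen v, colgen (lcol sg u v) @ colgen (rcol sg u v))
    \<in> word_cong (columns S sg) (col_relations S sg)"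
proof (cases "u = [] \<or> v = [] \<or> juxtaposable sg u v")
  case True
  then have "colgen (lcol sg u v) @ colgen (rcol sg u v) = colgen u @ colgen v"
    by (auto simp: juxtaposable_lcol juxtaposable_rcol)
  then show ?thesis using assms by (simp add: word_cong.refl del: in_lists_conv_set)
next
  case False
  then have "(u, v) \<in> rules (Col2 S sg)" using assms by (simp add: columns_scols)
  then have "(rsrc (Col2 S sg) (u, v), rtgt (Col2 S sg) (u, v)) \<in> col_relations S sg"
    unfolding col_relations_def by blast
  then show ?thesis using assms by (auto simp: left_col_eq_lcol[of _ S] intro: word_cong.base)
qed

lemma col_cong_letters:
  assumes "u \<in> scols S sg"
  shows "(map (\<lambda>x. [x]) u, colgen u) \<in> word_cong (columns S sg) (col_relations S sg)"
  using assms
proof (induction u)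
  case Nil
  then show ?case by (simp add: word_cong.refl)
next
  case (Cons x u)
  have u: "u \<in> scols S sg" and x: "[x] \<in> scols S sg"
    using Cons.prems by (auto simp: scols_def super_column_rev sorted_wrt_append)
  have "([[x]] @ map (\<lambda>x. [x]) u, [[x]] @ colgen u) \<in> word_cong (columns S sg) (col_relations S sg)"
    using Cons u x by (intro word_cong.mult word_cong.refl) (auto simp: columns_scols)
  moreover have "([[x]] @ colgen u, colgen (x # u)) \<in> word_cong (columns S sg) (col_relations S sg)"
    using col_cong[OF x u] lcol_singleton[OF Cons.prems] by (simp add: colgen_nonempty)
  ultimately show ?case using word_cong.trans by fastforce
qed

text \<open>Both sides of a relation lead to the same pair of columns: \<open>[z, x]\<close> and
  \<open>[y]\<close> for the first kind, \<open>[y, x]\<close> and \<open>[z]\<close> for the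
  second.\<close>

lemma col_cong_plactic:
  assumes "(l, r) \<in> super_plactic_relations S sg"
  shows "(map (\<lambda>x. [x]) l, map (\<lambda>x. [x]) r) \<in> word_cong (columns S sg) (col_relations S sg)"
    (is "_ \<in> ?C")
proof -
  have sing: "[x] \<in> scols S sg" if "x \<in> S" for x using that by (simp add: scols_def super_column_def)
  have two: "[a, b] \<in> scols S sg" if "a \<in> S" "b \<in> S" "bumps sg b a" for a b
    using that by (simp add: scols_def super_column_rev)
  have pair: "([[a], [b]], [[a, b]]) \<in> ?C" if "a \<in> S" "b \<in> S" "bumps sg b a" for a b
    using col_cong_letters[OF two[OF that]] by (simp add: colgen_nonempty)
  have sing': "[[x]] \<in> lists (columns S sg)" if "x \<in> S" for x
    using sing[OF that] by (simp add: columns_scols)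
  have ctxt: "(p @ [[a], [b]] @ s, p @ [[a, b]] @ s) \<in> ?C"
    if "a \<in> S" "b \<in> S" "bumps sg b a" "p \<in> lists (columns S sg)" "s \<in> lists (columns S sg)" for a b p s
    using pair that by (intro word_cong_context)
  show ?thesis
    using assms
  proof (cases rule: super_plactic_relations_cases)
    case (zxy x y z)
    then have xz: "bumps sg x z" using row_bumps_less by blast
    have "([[z], [x], [y]], [[z, x], [y]]) \<in> ?C"
      using ctxt[of z x "[]" "[[y]]"] zxy xz sing' by simp
    moreover have "([[x], [z], [y]], [[x], [z, y]]) \<in> ?C"
      using ctxt[of z y "[[x]]" "[]"] zxy sing' by simp
    moreover have "([[x], [z, y]], [[z, x], [y]]) \<in> ?C"
      using col_cong[OF sing[of x] two[of z y]] zxy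
      by (simp add: lcol_def rcol_def colgen_nonempty)
    ultimately have "([[z], [x], [y]], [[x], [z], [y]]) \<in> ?C"
      by (meson word_cong.trans word_cong.sym)
    then show ?thesis using zxy by simp
  next
    case (yzx x y z)
    then have xz: "bumps sg x z" using bumps_row_less by blast
    have "([[y], [z], [x]], [[y], [z, x]]) \<in> ?C"
      using ctxt[of z x "[[y]]" "[]"] yzx xz sing' by simp
    moreover have "([[y], [x], [z]], [[y, x], [z]]) \<in> ?C"
      using ctxt[of y x "[]" "[[z]]"] yzx sing' by simp
    moreover have "([[y], [z, x]], [[y, x], [z]]) \<in> ?C"
      using col_cong[OF sing[of y] two[of z x]] yzx xz
      by (simp add: lcol_def rcol_def colgen_nonempty)
    ultimately have "([[y], [z], [x]], [[y], [x], [z]]) \<in> ?C"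
      by (meson word_cong.trans word_cong.sym)
    then show ?thesis using yzx by simp
  qed
qed

lemma concat_colgen [simp]: "concat (colgen u) = u"
  by (simp add: colgen_def)

text \<open>Splitting a word into letters and concatenating again is literally the identity. The
  other composite is the identity only up to congruence, a column being congruent to the product of
  its letters.\<close>

lemma polygraph_monoid_Col2_iso: "polygraph_monoid (Col2 S sg) \<cong> super_plactic S sg"
proof -
  have "presented_monoid (columns S sg) (col_relations S sg) \<cong> presented_monoid S (super_plactic_relations S sg)"
  proof (rule presented_monoid_iso[where f = concat and g = "map (\<lambda>x. [x])"])
    show "col_relations S sg \<subseteq> lists (columns S sg) \<times> lists (columns S sg)"
      by (rule col_relations_lists)
    show "super_plactic_relations S sg \<subseteq> lists S \<times> lists S"
      by (auto simp: super_plactic_relations_def)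
    show "concat w \<in> lists S" if "w \<in> lists (columns S sg)" for w
      using that by (induction w) (auto simp: columns_def)
    show "(concat l, concat r) \<in> plactic_cong S sg" if "(l, r) \<in> col_relations S sg" for l r
    proof -
      from that obtain u v where "l = colgen u @ colgen v" "u \<in> scols S sg" "v \<in> scols S sg"
        "r = colgen (left_col sg u v) @ colgen (right_col sg u v)"
        by (auto simp: col_relations_def columns_scols)
      then show ?thesis using plactic_lcol_rcol by (simp add: left_col_eq_lcol[of _ S])
    qed
    show "map (\<lambda>x. [x]) w \<in> lists (columns S sg)" if "w \<in> lists S" for w
      using that by (auto simp: columns_def super_column_def)
    show "(map (\<lambda>x. [x]) (concat w), w) \<in> word_cong (columns S sg) (col_relations S sg)"
      if "w \<in> lists (columns S sg)" for w
      using that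
    proof (induction w)
      case (Cons u w)
      have "(map (\<lambda>x. [x]) u @ map (\<lambda>x. [x]) (concat w), colgen u @ w)
          \<in> word_cong (columns S sg) (col_relations S sg)"
        using Cons by (intro word_cong.mult col_cong_letters) (auto simp: columns_in_scols)
      moreover have "u \<noteq> []" using Cons(1) by (simp add: columns_scols)
      ultimately show ?case by (simp add: colgen_nonempty)
    qed (simp add: word_cong.refl)
  qed (use col_cong_plactic in \<open>auto intro: word_cong.refl\<close>)
  then show ?thesis
    by (simp add: polygraph_monoid_def super_plactic_def col_relations_def)
qed

section \<open>Homotopy of 2-cells\<close>

text \<open>Composition along the 0-cell is associative only up to \<open>eq2\<close>, so contexts
  get one fixed bracketing; \<open>whisker_whisker\<close> merges nested contexts.\<close>

definition whisker :: "'x list \<Rightarrow> ('x, 'r) cell2 \<Rightarrow> 'x list \<Rightarrow> ('x, 'r) cell2" where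
  "whisker l f r = Comp2_0 (Id2 l) (Comp2_0 f (Id2 r))"

locale coherence =
  fixes P :: "('x, 'r, 'g, 'z) polygraph3_scheme"
  assumes ext: "extended_presentation P"
begin

lemma wf2_boundary: "wf2 P f \<Longrightarrow> src2 P f \<in> lists (gens P) \<and> tgt2 P f \<in> lists (gens P)"
  using ext by (induction f) (auto simp: extended_presentation_def wf_polygraph2_def simp del: in_lists_conv_set)

lemma eq2_parallel: "eq2 P f g \<Longrightarrow> parallel2 P f g"
  by (induction rule: eq2.induct) (auto simp: parallel2_def wf2_boundary simp del: in_lists_conv_set)

lemma wf3_parallel: "wf3 P F \<Longrightarrow> parallel2 P (src3 P F) (tgt3 P F)"
proof (induction F)
  case (Gen3 A)
  then show ?case using ext by (simp add: extended_presentation_def)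
next
  case (Comp3_2 F G)
  then have "parallel2 P (tgt3 P F) (src3 P G)" using eq2_parallel by simp
  then show ?case using Comp3_2 by (simp add: parallel2_def)
qed (auto simp: parallel2_def)

text \<open>As this contains \<open>eq2\<close> on 2-cells, the axioms of 2-categories and the
  generating 3-cells can be used in one and the same chain.\<close>

definition homotopic :: "('x, 'r) cell2 \<Rightarrow> ('x, 'r) cell2 \<Rightarrow> bool" (infix "\<approx>" 50) where
  "f \<approx> g \<longleftrightarrow> hom3 P f g \<noteq> {}"

abbreviation vcomp :: "('x, 'r) cell2 \<Rightarrow> ('x, 'r) cell2 \<Rightarrow> ('x, 'r) cell2" (infixr "\<star>" 70) where
  "f \<star> g \<equiv> Comp2_1 f g"

abbreviation word :: "'x list \<Rightarrow> bool" where
  "word w \<equiv> w \<in> lists (gens P)"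

lemma homotopicI: "wf3 P F \<Longrightarrow> eq2 P (src3 P F) f \<Longrightarrow> eq2 P (tgt3 P F) g \<Longrightarrow> f \<approx> g"
  by (auto simp: homotopic_def hom3_def)

lemma homotopicE:
  assumes "f \<approx> g"
  obtains F where "wf3 P F" "eq2 P (src3 P F) f" "eq2 P (tgt3 P F) g"
  using assms by (auto simp: homotopic_def hom3_def)

lemma homotopic_parallel: "f \<approx> g \<Longrightarrow> parallel2 P f g"
  by (elim homotopicE) (use wf3_parallel eq2_parallel in \<open>force simp: parallel2_def\<close>)

lemma homotopic_src: "f \<approx> g \<Longrightarrow> src2 P f = src2 P g"
  and homotopic_tgt: "f \<approx> g \<Longrightarrow> tgt2 P f = tgt2 P g"
  using homotopic_parallel by (auto simp: parallel2_def)

lemma eq2_homotopic: "eq2 P f g \<Longrightarrow> f \<approx> g"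
  using eq2_parallel[of f g]
  by (intro homotopicI[of "Id3 f"]) (auto simp: parallel2_def eq2.refl)

lemma homotopic_refl: "wf2 P f \<Longrightarrow> f \<approx> f"
  by (intro eq2_homotopic eq2.refl)

lemma homotopic_sym: "f \<approx> g \<Longrightarrow> g \<approx> f"
  by (erule homotopicE, rule_tac F = "Inv3 F" in homotopicI) auto

lemma homotopic_trans [trans]: "f \<approx> g \<Longrightarrow> g \<approx> h \<Longrightarrow> f \<approx> h"
proof (elim homotopicE)
  fix F G
  assume "wf3 P F" "eq2 P (src3 P F) f" "eq2 P (tgt3 P F) g"
    "wf3 P G" "eq2 P (src3 P G) g" "eq2 P (tgt3 P G) h"
  then show "f \<approx> h"
    by (intro homotopicI[of "Comp3_2 F G"]) (auto intro: eq2.sym eq2.trans)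
qed

lemma homotopic_0: "f \<approx> f' \<Longrightarrow> g \<approx> g' \<Longrightarrow> Comp2_0 f g \<approx> Comp2_0 f' g'"
proof (elim homotopicE)
  fix F G
  assume "wf3 P F" "eq2 P (src3 P F) f" "eq2 P (tgt3 P F) f'"
    "wf3 P G" "eq2 P (src3 P G) g" "eq2 P (tgt3 P G) g'"
  then show ?thesis by (intro homotopicI[of "Comp3_0 F G"]) (auto intro: eq2.cong_0)
qed

lemma homotopic_1: "f \<approx> f' \<Longrightarrow> g \<approx> g' \<Longrightarrow> tgt2 P f = src2 P g \<Longrightarrow> f \<star> g \<approx> f' \<star> g'"
proof (elim homotopicE)
  fix F G
  assume *: "tgt2 P f = src2 P g" "wf3 P F" "eq2 P (src3 P F) f" "eq2 P (tgt3 P F) f'"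
    "wf3 P G" "eq2 P (src3 P G) g" "eq2 P (tgt3 P G) g'"
  then have "tgt2 P (src3 P F) = src2 P (src3 P G)" "tgt2 P (tgt3 P F) = src2 P (tgt3 P G)"
    using eq2_parallel wf3_parallel by (metis parallel2_def)+
  with * show ?thesis by (intro homotopicI[of "Comp3_1 F G"]) (auto intro: eq2.cong_1)
qed

lemma homotopic_left: "f \<approx> f' \<Longrightarrow> wf2 P g \<Longrightarrow> tgt2 P f = src2 P g \<Longrightarrow> f \<star> g \<approx> f' \<star> g"
  and homotopic_right: "wf2 P f \<Longrightarrow> g \<approx> g' \<Longrightarrow> tgt2 P f = src2 P g \<Longrightarrow> f \<star> g \<approx> f \<star> g'"
  by (auto intro: homotopic_1 homotopic_refl)

lemma homotopic_assoc:
  "wf2 P f \<Longrightarrow> wf2 P g \<Longrightarrow> wf2 P h \<Longrightarrow> tgt2 P f = src2 P g \<Longrightarrow> tgt2 P g = src2 P h \<Longrightarrow>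
   (f \<star> g) \<star> h \<approx> f \<star> g \<star> h"
  by (intro eq2_homotopic eq2.assoc_1) simp

lemma identity_left: "f \<approx> Id2 x \<Longrightarrow> wf2 P g \<Longrightarrow> tgt2 P f = src2 P g \<Longrightarrow> f \<star> g \<approx> g"
  using homotopic_left[of f "Id2 x" g] eq2_homotopic[OF eq2.left_unit_1[of P g]]
    homotopic_tgt[of f "Id2 x"] homotopic_trans by simp

lemma identity_right: "f \<approx> Id2 x \<Longrightarrow> wf2 P g \<Longrightarrow> tgt2 P g = src2 P f \<Longrightarrow> g \<star> f \<approx> g"
  using homotopic_right[of g f "Id2 x"] eq2_homotopic[OF eq2.right_unit_1[of P g]]
    homotopic_src[of f "Id2 x"] homotopic_trans by simp

lemma whisker_simps [simp]:
  "wf2 P (whisker l f r) \<longleftrightarrow> word l \<and> wf2 P f \<and> word r"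
  "src2 P (whisker l f r) = l @ src2 P f @ r"
  "tgt2 P (whisker l f r) = l @ tgt2 P f @ r"
  by (auto simp: whisker_def)

lemma homotopic_whisker: "f \<approx> g \<Longrightarrow> word l \<Longrightarrow> word r \<Longrightarrow> whisker l f r \<approx> whisker l g r"
  unfolding whisker_def by (intro homotopic_0 homotopic_refl) simp_all

lemma Id_Id: "word l \<Longrightarrow> word r \<Longrightarrow> Comp2_0 (Id2 l) (Id2 r) \<approx> Id2 (l @ r)"
  by (intro eq2_homotopic eq2.id_0)

lemma Id_vcomp: "word l \<Longrightarrow> Id2 l \<approx> Id2 l \<star> Id2 l"
  using eq2_homotopic[OF eq2.left_unit_1[of P "Id2 l"]] homotopic_sym by simp

lemma homotopic_interchange:
  "wf2 P (f \<star> g) \<Longrightarrow> wf2 P (h \<star> k) \<Longrightarrow> Comp2_0 (f \<star> g) (h \<star> k) \<approx> Comp2_0 f h \<star> Comp2_0 g k"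
  by (intro eq2_homotopic eq2.interchange)

lemma whisker_Id: "word l \<Longrightarrow> word w \<Longrightarrow> word r \<Longrightarrow> whisker l (Id2 w) r \<approx> Id2 (l @ w @ r)"
proof -
  assume w: "word l" "word w" "word r"
  have "Comp2_0 (Id2 l) (Comp2_0 (Id2 w) (Id2 r)) \<approx> Comp2_0 (Id2 l) (Id2 (w @ r))"
    using w by (intro homotopic_0 Id_Id homotopic_refl) simp_all
  also have "\<dots> \<approx> Id2 (l @ w @ r)"
    using w by (intro Id_Id) simp_all
  finally show ?thesis by (simp add: whisker_def)
qed

lemma whisker_Nil: "wf2 P f \<Longrightarrow> whisker [] f [] \<approx> f"
proof -
  assume f: "wf2 P f"
  have "whisker [] f [] \<approx> Comp2_0 f (Id2 [])"
    unfolding whisker_def using f by (intro eq2_homotopic eq2.left_unit_0) simp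
  also have "\<dots> \<approx> f" using f by (intro eq2_homotopic eq2.right_unit_0)
  finally show ?thesis .
qed

lemma whisker_left: "wf2 P f \<Longrightarrow> word l \<Longrightarrow> whisker l f [] \<approx> Comp2_0 (Id2 l) f"
  unfolding whisker_def
  by (intro homotopic_0 homotopic_refl eq2_homotopic[OF eq2.right_unit_0]) simp_all

lemma whisker_right: "wf2 P f \<Longrightarrow> word r \<Longrightarrow> whisker [] f r \<approx> Comp2_0 f (Id2 r)"
  unfolding whisker_def by (intro eq2_homotopic eq2.left_unit_0) simp

lemma whisker_vcomp:
  assumes "wf2 P f" "wf2 P g" "tgt2 P f = src2 P g" "word l" "word r"
  shows "whisker l (f \<star> g) r \<approx> whisker l f r \<star> whisker l g r"
proof -
  have "Comp2_0 (f \<star> g) (Id2 r) \<approx> Comp2_0 (f \<star> g) (Id2 r \<star> Id2 r)"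
    using assms by (intro homotopic_0 Id_vcomp homotopic_refl) simp_all
  also have "\<dots> \<approx> Comp2_0 f (Id2 r) \<star> Comp2_0 g (Id2 r)"
    using assms by (intro homotopic_interchange) simp_all
  finally have "whisker l (f \<star> g) r \<approx>
      Comp2_0 (Id2 l \<star> Id2 l) (Comp2_0 f (Id2 r) \<star> Comp2_0 g (Id2 r))"
    unfolding whisker_def using assms by (intro homotopic_0 Id_vcomp)
  also have "\<dots> \<approx> whisker l f r \<star> whisker l g r"
    unfolding whisker_def using assms by (intro homotopic_interchange) simp_all
  finally show ?thesis .
qed

lemma whisker_whisker:
  assumes "wf2 P f" "word l" "word l'" "word r" "word r'"
  shows "whisker l (whisker l' f r') r \<approx> whisker (l @ l') f (r' @ r)"
proof -
  have "Comp2_0 (Comp2_0 (Id2 l') (Comp2_0 f (Id2 r'))) (Id2 r) \<approx>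
      Comp2_0 (Id2 l') (Comp2_0 (Comp2_0 f (Id2 r')) (Id2 r))"
    using assms by (intro eq2_homotopic eq2.assoc_0) simp_all
  also have "\<dots> \<approx> Comp2_0 (Id2 l') (Comp2_0 f (Comp2_0 (Id2 r') (Id2 r)))"
    using assms by (intro homotopic_0 homotopic_refl eq2_homotopic[OF eq2.assoc_0]) simp_all
  also have "\<dots> \<approx> Comp2_0 (Id2 l') (Comp2_0 f (Id2 (r' @ r)))"
    using assms by (intro homotopic_0 homotopic_refl Id_Id) simp_all
  finally have "whisker l (whisker l' f r') r \<approx>
      Comp2_0 (Id2 l) (Comp2_0 (Id2 l') (Comp2_0 f (Id2 (r' @ r))))"
    unfolding whisker_def using assms by (intro homotopic_0[OF homotopic_refl]) simp_all
  also have "\<dots> \<approx> Comp2_0 (Comp2_0 (Id2 l) (Id2 l')) (Comp2_0 f (Id2 (r' @ r)))"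
    using assms by (intro homotopic_sym[OF eq2_homotopic[OF eq2.assoc_0]]) simp_all
  also have "\<dots> \<approx> whisker (l @ l') f (r' @ r)"
    unfolding whisker_def using assms by (intro homotopic_0[OF Id_Id] homotopic_refl) simp_all
  finally show ?thesis .
qed

text \<open>Padding each factor with an identity and interchanging lets either factor act first.
  Comparing the two orders gives \<open>exchange\<close>.\<close>

lemma Comp2_0_vcomp:
  assumes "wf2 P f" "wf2 P g"
  shows "Comp2_0 f g \<approx> whisker [] f (src2 P g) \<star> whisker (tgt2 P f) g []"
    and "Comp2_0 f g \<approx> whisker (src2 P f) g [] \<star> whisker [] f (tgt2 P g)"
proof -
  note w = wf2_boundary[OF assms(1)] wf2_boundary[OF assms(2)]
  have left: "h \<approx> Id2 (src2 P h) \<star> h" and right: "h \<approx> h \<star> Id2 (tgt2 P h)" if "wf2 P h" for h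
    using homotopic_sym[OF eq2_homotopic] eq2.left_unit_1[OF that] eq2.right_unit_1[OF that] by blast+
  have "Comp2_0 f g \<approx> Comp2_0 (f \<star> Id2 (tgt2 P f)) (Id2 (src2 P g) \<star> g)"
    using assms by (intro homotopic_0 left right)
  also have "\<dots> \<approx> Comp2_0 f (Id2 (src2 P g)) \<star> Comp2_0 (Id2 (tgt2 P f)) g"
    using assms w by (intro homotopic_interchange) simp_all
  also have "\<dots> \<approx> whisker [] f (src2 P g) \<star> whisker (tgt2 P f) g []"
    using assms w by (intro homotopic_1 homotopic_sym[OF whisker_right] homotopic_sym[OF whisker_left]) simp_all
  finally show "Comp2_0 f g \<approx> whisker [] f (src2 P g) \<star> whisker (tgt2 P f) g []" .
  have "Comp2_0 f g \<approx> Comp2_0 (Id2 (src2 P f) \<star> f) (g \<star> Id2 (tgt2 P g))"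
    using assms by (intro homotopic_0 left right)
  also have "\<dots> \<approx> Comp2_0 (Id2 (src2 P f)) g \<star> Comp2_0 f (Id2 (tgt2 P g))"
    using assms w by (intro homotopic_interchange) simp_all
  also have "\<dots> \<approx> whisker (src2 P f) g [] \<star> whisker [] f (tgt2 P g)"
    using assms w by (intro homotopic_1 homotopic_sym[OF whisker_right] homotopic_sym[OF whisker_left]) simp_all
  finally show "Comp2_0 f g \<approx> whisker (src2 P f) g [] \<star> whisker [] f (tgt2 P g)" .
qed

lemma exchange:
  assumes "wf2 P f" "wf2 P g"
  shows "whisker (src2 P f) g [] \<star> whisker [] f (tgt2 P g) \<approx>
    whisker [] f (src2 P g) \<star> whisker (tgt2 P f) g []"
  using homotopic_trans[OF homotopic_sym[OF Comp2_0_vcomp(2)] Comp2_0_vcomp(1)] assms by blast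

lemma whisker_pair:
  assumes "wf2 P f" "wf2 P g" "word l" "word l'" "word r" "l' @ tgt2 P f @ r = src2 P g"
  shows "whisker l (whisker l' f r \<star> g) [] \<approx> whisker (l @ l') f r \<star> whisker l g []"
proof -
  have "whisker l (whisker l' f r \<star> g) [] \<approx> whisker l (whisker l' f r) [] \<star> whisker l g []"
    using assms by (intro whisker_vcomp) simp_all
  also have "\<dots> \<approx> whisker (l @ l') f r \<star> whisker l g []"
    using assms whisker_whisker[of f l l' "[]" r] by (intro homotopic_left) simp_all
  finally show ?thesis .
qed

lemma homotopic_assoc3:
  assumes "wf2 P f" "wf2 P g" "wf2 P h" "wf2 P k"
    and "tgt2 P f = src2 P g" "tgt2 P g = src2 P h" "tgt2 P h = src2 P k"
  shows "(f \<star> g \<star> h) \<star> k \<approx> f \<star> g \<star> h \<star> k"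
proof -
  have "(f \<star> g \<star> h) \<star> k \<approx> f \<star> (g \<star> h) \<star> k"
    using assms by (intro homotopic_assoc) simp_all
  also have "\<dots> \<approx> f \<star> g \<star> h \<star> k"
    using assms by (intro homotopic_right homotopic_assoc) simp_all
  finally show ?thesis .
qed

text \<open>Prepares \<open>insert_cell_braid\<close>. One column has been inserted by
  \<open>g\<close> and then, further to the right, by \<open>j\<close>; another follows by
  \<open>f\<close> and \<open>k\<close>. As \<open>f\<close> and \<open>j\<close> act on disjoint
  factors, \<open>j\<close> can be postponed, which makes \<open>g\<close> and \<open>f\<close>
  adjacent as in the boundary of a 3-cell.\<close>

lemma insertion_exchange:
  assumes wf: "wf2 P f" "wf2 P g" "wf2 P j" "wf2 P k" and words: "word x" "word y" "word l" "word r" "word ts"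
    and f: "src2 P f = x @ y" "tgt2 P f = l @ r"
    and comp: "tgt2 P g @ ts = y @ src2 P j" "src2 P k = r @ tgt2 P j"
  shows "whisker x (whisker [] g ts \<star> whisker y j []) [] \<star> whisker [] f (tgt2 P j) \<star> whisker l k [] \<approx>
    whisker x g ts \<star> whisker [] f (src2 P j) \<star> whisker (l @ r) j [] \<star> whisker l k []"
proof -
  note b = wf2_boundary[OF wf(3)]
  note simps = wf words f comp b
  let ?F = "whisker [] f (tgt2 P j)" and ?F' = "whisker [] f (src2 P j)" and ?K = "whisker l k []"
  have "whisker x (whisker [] g ts \<star> whisker y j []) [] \<approx> whisker (x @ []) g ts \<star> whisker x (whisker y j []) []"
    using simps by (intro whisker_pair) simp_all
  also have "\<dots> \<approx> whisker x g ts \<star> whisker (x @ y) j []"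
    using simps whisker_whisker[of j x y "[]" "[]"] homotopic_right[of "whisker x g ts"] by simp
  finally have "whisker x (whisker [] g ts \<star> whisker y j []) [] \<star> ?F \<star> ?K \<approx>
      (whisker x g ts \<star> whisker (x @ y) j []) \<star> ?F \<star> ?K"
    using simps by (intro homotopic_left) simp_all
  also have "\<dots> \<approx> whisker x g ts \<star> whisker (x @ y) j [] \<star> ?F \<star> ?K"
    using simps by (intro homotopic_assoc) simp_all
  also have "\<dots> \<approx> whisker x g ts \<star> (whisker (x @ y) j [] \<star> ?F) \<star> ?K"
    using simps by (intro homotopic_right homotopic_sym[OF homotopic_assoc]) simp_all
  also have "\<dots> \<approx> whisker x g ts \<star> (?F' \<star> whisker (l @ r) j []) \<star> ?K"
    using simps exchange[of f j] by (intro homotopic_right homotopic_left) simp_all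
  also have "\<dots> \<approx> whisker x g ts \<star> ?F' \<star> whisker (l @ r) j [] \<star> ?K"
    using simps by (intro homotopic_right homotopic_assoc) simp_all
  finally show ?thesis .
qed

text \<open>A choice of 2-cells to normal forms that is natural up to homotopy with respect to the rules
  makes every 2-cell homotopic to a composite of two chosen ones.\<close>

lemma homotopy_basis_natural:
  assumes sig: "\<And>w. word w \<Longrightarrow> wf2 P (sig w) \<and> src2 P (sig w) = w"
    and nat: "\<And>r l l'. r \<in> rules P \<Longrightarrow> word l \<Longrightarrow> word l' \<Longrightarrow>
      whisker l (Gen2 r) l' \<star> sig (l @ rtgt P r @ l') \<approx> sig (l @ rsrc P r @ l')"
  shows "homotopy_basis P"
proof -
  \<comment> \<open>The context has to be arbitrary: in a composite along the 0-cell each factor is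
    part of the context of the other.\<close>
  have natural: "whisker l f l' \<star> sig (l @ tgt2 P f @ l') \<approx> sig (l @ src2 P f @ l')"
    if "wf2 P f" "word l" "word l'" for f l l'
    using that
  proof (induction f arbitrary: l l')
    case (Gen2 r)
    then show ?case using nat by simp
  next
    case (Id2 w)
    then have w: "word w" by simp
    then show ?case
      using sig[of "l @ w @ l'"] identity_left[OF whisker_Id[OF _ w]] Id2.prems by simp
  next
    case (Inv2 f)
    then have f: "wf2 P f" by simp
    note w = wf2_boundary[OF f]
    let ?s = "sig (l @ src2 P f @ l')" and ?t = "sig (l @ tgt2 P f @ l')"
    have st: "wf2 P ?s" "src2 P ?s = l @ src2 P f @ l'" "wf2 P ?t" "src2 P ?t = l @ tgt2 P f @ l'"
      using sig w Inv2.prems by simp_all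
    have "whisker l (Inv2 f) l' \<star> ?s \<approx> whisker l (Inv2 f) l' \<star> whisker l f l' \<star> ?t"
      using Inv2 f st by (intro homotopic_right homotopic_sym[OF Inv2.IH]) simp_all
    also have "\<dots> \<approx> (whisker l (Inv2 f) l' \<star> whisker l f l') \<star> ?t"
      using Inv2 f st by (intro homotopic_sym[OF homotopic_assoc]) simp_all
    also have "\<dots> \<approx> whisker l (Inv2 f \<star> f) l' \<star> ?t"
      using Inv2 f st by (intro homotopic_left homotopic_sym[OF whisker_vcomp]) simp_all
    also have "\<dots> \<approx> whisker l (Id2 (tgt2 P f)) l' \<star> ?t"
      using Inv2 f st
      by (intro homotopic_left homotopic_whisker eq2_homotopic[OF eq2.left_inv_1]) simp_all
    also have "\<dots> \<approx> ?t"
      using Inv2 f st w by (intro identity_left[OF whisker_Id]) simp_all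
    finally show ?case by simp
  next
    case (Comp2_0 f g)
    then have fg: "wf2 P f" "wf2 P g" by simp_all
    note w = wf2_boundary[OF fg(1)] wf2_boundary[OF fg(2)]
    let ?s = "\<lambda>x y. sig (l @ x @ y @ l')"
    have s: "wf2 P (?s x y)" "src2 P (?s x y) = l @ x @ y @ l'" if "word x" "word y" for x y
      using sig that Comp2_0.prems by simp_all
    let ?f = "whisker l f (src2 P g @ l')" and ?g = "whisker (l @ tgt2 P f) g l'"
    have "whisker l (Comp2_0 f g) l' \<approx>
        whisker l (whisker [] f (src2 P g) \<star> whisker (tgt2 P f) g []) l'"
      using Comp2_0.prems fg by (intro homotopic_whisker Comp2_0_vcomp) simp_all
    also have "\<dots> \<approx> whisker l (whisker [] f (src2 P g)) l' \<star> whisker l (whisker (tgt2 P f) g []) l'"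
      using Comp2_0.prems fg w by (intro whisker_vcomp) simp_all
    also have "\<dots> \<approx> ?f \<star> ?g"
      using Comp2_0.prems fg w
        whisker_whisker[of f l "[]" l' "src2 P g"] whisker_whisker[of g l "tgt2 P f" l' "[]"]
      by (intro homotopic_1) simp_all
    finally have "whisker l (Comp2_0 f g) l' \<star> ?s (tgt2 P f) (tgt2 P g) \<approx>
        (?f \<star> ?g) \<star> ?s (tgt2 P f) (tgt2 P g)"
      using Comp2_0.prems fg w s by (intro homotopic_left) simp_all
    also have "\<dots> \<approx> ?f \<star> ?g \<star> ?s (tgt2 P f) (tgt2 P g)"
      using Comp2_0.prems fg w s by (intro homotopic_assoc) simp_all
    also have "\<dots> \<approx> ?f \<star> ?s (tgt2 P f) (src2 P g)"
      using Comp2_0.IH(2)[of "l @ tgt2 P f" l'] Comp2_0.prems fg w s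
      by (intro homotopic_right) simp_all
    also have "\<dots> \<approx> ?s (src2 P f) (src2 P g)"
      using Comp2_0.IH(1)[of l "src2 P g @ l'"] Comp2_0.prems fg w by simp
    finally show ?case by simp
  next
    case (Comp2_1 f g)
    then have fg: "wf2 P f" "wf2 P g" "tgt2 P f = src2 P g" by simp_all
    note w = wf2_boundary[OF fg(1)] wf2_boundary[OF fg(2)]
    let ?t = "sig (l @ tgt2 P g @ l')"
    have t: "wf2 P ?t" "src2 P ?t = l @ tgt2 P g @ l'" using sig w Comp2_1.prems by simp_all
    have "whisker l (f \<star> g) l' \<star> ?t \<approx> (whisker l f l' \<star> whisker l g l') \<star> ?t"
      using Comp2_1.prems fg t by (intro homotopic_left whisker_vcomp) simp_all
    also have "\<dots> \<approx> whisker l f l' \<star> whisker l g l' \<star> ?t"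
      using Comp2_1.prems fg t by (intro homotopic_assoc) simp_all
    also have "\<dots> \<approx> whisker l f l' \<star> sig (l @ src2 P g @ l')"
      using Comp2_1.prems Comp2_1.IH(2) fg t by (intro homotopic_right) simp_all
    also have "\<dots> \<approx> sig (l @ src2 P f @ l')"
      using Comp2_1.prems Comp2_1.IH(1) fg by simp
    finally show ?case by simp
  qed
  \<comment> \<open>The right-hand side depends only on the source and the target of
    \<open>f\<close>.\<close>
  have "f \<approx> sig (src2 P f) \<star> Inv2 (sig (tgt2 P f))" if f: "wf2 P f" for f
  proof -
    note w = wf2_boundary[OF f]
    let ?t = "sig (tgt2 P f)"
    have t: "wf2 P ?t" "src2 P ?t = tgt2 P f" using sig w by simp_all
    have "whisker [] f [] \<star> ?t \<approx> sig (src2 P f)" using natural[OF f, of "[]" "[]"] by simp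
    then have 1: "f \<star> ?t \<approx> sig (src2 P f)"
      using homotopic_left[OF homotopic_sym[OF whisker_Nil[OF f]], of ?t] t homotopic_trans by simp
    have "?t \<star> Inv2 ?t \<approx> Id2 (src2 P ?t)"
      using t by (intro eq2_homotopic eq2.right_inv_1)
    then have "f \<approx> f \<star> ?t \<star> Inv2 ?t"
      using f t by (intro homotopic_sym[OF identity_right]) simp_all
    also have "\<dots> \<approx> (f \<star> ?t) \<star> Inv2 ?t"
      using f t by (intro homotopic_sym[OF homotopic_assoc]) simp_all
    also have "\<dots> \<approx> sig (src2 P f) \<star> Inv2 ?t"
      using f t by (intro homotopic_left 1) simp_all
    finally show ?thesis .
  qed
  then have "f \<approx> g" if "parallel2 P f g" for f g
    using that homotopic_trans homotopic_sym unfolding parallel2_def by metis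
  then show ?thesis by (simp add: homotopy_basis_def homotopic_def)
qed

end

section \<open>Coherence\<close>

lemma gamma_simps [simp]:
  assumes "u \<in> scols S sg" "v \<in> scols S sg"
  shows "src2 (Col2 S sg) (gamma sg u v) = colgen u @ colgen v"
    and "tgt2 (Col2 S sg) (gamma sg u v) = colgen (lcol sg u v) @ colgen (rcol sg u v)"
    and "wf2 (Col2 S sg) (gamma sg u v)"
  using assms
  by (auto simp: gamma_def left_col_eq_lcol[of _ S] juxtaposable_lcol juxtaposable_rcol columns_scols
      simp del: in_lists_conv_set)

lemma gamma_Id:
  "u = [] \<or> v = [] \<or> juxtaposable sg u v \<Longrightarrow> gamma sg u v = Id2 (colgen u @ colgen v)"
  by (auto simp: gamma_def)

text \<open>The target is written as \<open>X_tgt\<close> produces it; that \<open>X_src\<close>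
  ends there too is the braid relation.\<close>

lemma X_src_hom2:
  assumes "u \<in> scols S sg" "v \<in> scols S sg" "t \<in> scols S sg"
  shows "X_src sg u v t \<in> hom2 (Col2 S sg) (colgen u @ colgen v @ colgen t)
    (colgen (lcol sg u (lcol sg v t)) @
     colgen (lcol sg (rcol sg u (lcol sg v t)) (rcol sg v t)) @
     colgen (rcol sg (rcol sg u (lcol sg v t)) (rcol sg v t)))"
  using assms braid_words[OF assms]
  by (simp add: X_src_def Let_def left_col_eq_lcol[of _ S] hom2_def del: in_lists_conv_set)

lemma X_tgt_hom2:
  assumes "u \<in> scols S sg" "v \<in> scols S sg" "t \<in> scols S sg"
  shows "X_tgt sg u v t \<in> hom2 (Col2 S sg) (colgen u @ colgen v @ colgen t)
    (colgen (lcol sg u (lcol sg v t)) @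
     colgen (lcol sg (rcol sg u (lcol sg v t)) (rcol sg v t)) @
     colgen (rcol sg (rcol sg u (lcol sg v t)) (rcol sg v t)))"
  using assms
  by (simp add: X_tgt_def Let_def left_col_eq_lcol[of _ S] hom2_def del: in_lists_conv_set)

lemma Col3_shape:
  assumes "u \<in> columns S sg" "v \<in> columns S sg" "t \<in> columns S sg"
  shows "X_shape S sg u v t"
proof -
  have s: "u \<in> scols S sg" "v \<in> scols S sg" "t \<in> scols S sg" and ne: "u \<noteq> []" "v \<noteq> []" "t \<noteq> []"
    using assms by (simp_all add: columns_scols)
  let ?T = "insert_word sg (u @ v @ t)"
  define a d b where "a = lcol sg u (lcol sg v t)"
    and "d = lcol sg (rcol sg u (lcol sg v t)) (rcol sg v t)"
    and "b = rcol sg (rcol sg u (lcol sg v t)) (rcol sg v t)"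
  note cols = reading_columns_insert_three[OF s ne, folded a_def d_def b_def]
  \<comment> \<open>\<open>colgen\<close> drops empty columns, so positions 0, 1 and 2 can be read
    off only if no empty column precedes a nonempty one.\<close>
  have a: "a \<noteq> []" using ne by (simp add: a_def)
  have db: "d = [] \<Longrightarrow> b = []" by (auto simp: d_def b_def)
  note col = nth_reading_columns[OF tableau_insert_word[of sg "u @ v @ t"]]
  have T: "column_reading ?T 0 = a" "column_reading ?T 1 = d" "column_reading ?T 2 = b"
    using a db by (auto simp: col cols colgen_def)
  have "n_columns ?T = length (reading_columns ?T)" by (simp add: reading_columns_def)
  then have "n_columns ?T \<le> 3" using cols by (simp add: colgen_def)
  moreover have "left_col sg u (left_col sg v t) = a" "right_col sg (right_col sg u v) t = b"
    using s braid_words(3)[OF s] by (simp_all add: a_def b_def left_col_eq_lcol[of _ S])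
  ultimately show ?thesis
    using X_src_hom2[OF s] X_tgt_hom2[OF s]
    unfolding X_shape_def Let_def T by (simp add: a_def b_def d_def)
qed

section \<open>The extended presentation\<close>

lemma Col3_simps [simp]:
  "gens (Col3 S sg) = columns S sg"
  "(u, v) \<in> rules (Col3 S sg) \<longleftrightarrow> (u, v) \<in> rules (Col2 S sg)"
  "rsrc (Col3 S sg) = rsrc (Col2 S sg)"
  "rtgt (Col3 S sg) = rtgt (Col2 S sg)"
  "(u, v, t) \<in> cells3 (Col3 S sg) \<longleftrightarrow> u \<in> columns S sg \<and> v \<in> columns S sg \<and> t \<in> columns S sg \<and>
     \<not> juxtaposable sg u v \<and> \<not> juxtaposable sg v t"
  "gsrc (Col3 S sg) (u, v, t) = X_src sg u v t"
  "gtgt (Col3 S sg) (u, v, t) = X_tgt sg u v t"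
  by (simp_all add: Col3_def Col2_def polygraph2.defs)

lemma rules_Col3: "rules (Col3 S sg) = rules (Col2 S sg)"
  by auto

lemma src2_tgt2_Col3:
  "src2 (Col3 S sg) f = src2 (Col2 S sg) f \<and> tgt2 (Col3 S sg) f = tgt2 (Col2 S sg) f"
  by (induction f) auto

lemma wf2_Col3: "wf2 (Col3 S sg) f = wf2 (Col2 S sg) f"
  by (induction f) (auto simp: rules_Col3 src2_tgt2_Col3)

lemma polygraph_monoid_Col3: "polygraph_monoid (Col3 S sg) = polygraph_monoid (Col2 S sg)"
  by (simp add: polygraph_monoid_def rules_Col3)

lemma extended_presentation_Col3: "extended_presentation (Col3 S sg)"
  unfolding extended_presentation_def
proof
  show "wf_polygraph2 (Col3 S sg)"
    unfolding wf_polygraph2_def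
  proof
    fix r assume "r \<in> rules (Col3 S sg)"
    then have "(rsrc (Col2 S sg) r, rtgt (Col2 S sg) r) \<in> col_relations S sg"
      unfolding col_relations_def rules_Col3 by blast
    then show "rsrc (Col3 S sg) r \<in> lists (gens (Col3 S sg)) \<and> rtgt (Col3 S sg) r \<in> lists (gens (Col3 S sg))"
      using col_relations_lists[of S sg] by (simp del: in_lists_conv_set) blast
  qed
  show "\<forall>A\<in>cells3 (Col3 S sg). parallel2 (Col3 S sg) (gsrc (Col3 S sg) A) (gtgt (Col3 S sg) A)"
  proof
    fix A assume A: "A \<in> cells3 (Col3 S sg)"
    obtain u v t where [simp]: "A = (u, v, t)" by (cases A)
    have "u \<in> scols S sg" "v \<in> scols S sg" "t \<in> scols S sg"
      using A by (auto simp: columns_scols)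
    then show "parallel2 (Col3 S sg) (gsrc (Col3 S sg) A) (gtgt (Col3 S sg) A)"
      using X_src_hom2[of u S sg v t] X_tgt_hom2[of u S sg v t]
      by (simp add: parallel2_def hom2_def wf2_Col3 src2_tgt2_Col3)
  qed
qed

section \<open>The canonical 2-cells from words to normal forms\<close>

fun insert_cell ::
  "('a::linorder \<Rightarrow> bit) \<Rightarrow> 'a list \<Rightarrow> 'a list list \<Rightarrow> ('a list, 'a list \<times> 'a list) cell2" where
  "insert_cell sg u [] = Id2 (colgen u)"
| "insert_cell sg u (t # ts) = Comp2_1 (whisker [] (gamma sg u t) ts)
    (whisker (colgen (lcol sg u t)) (insert_cell sg (rcol sg u t) ts) [])"

abbreviation normalize :: "('a::linorder \<Rightarrow> bit) \<Rightarrow> 'a list list \<Rightarrow> 'a list list" where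
  "normalize sg w \<equiv> foldr (col_insert sg) w []"

fun normal_cell ::
  "('a::linorder \<Rightarrow> bit) \<Rightarrow> 'a list list \<Rightarrow> ('a list, 'a list \<times> 'a list) cell2" where
  "normal_cell sg [] = Id2 []"
| "normal_cell sg (u # w) = Comp2_1 (whisker [u] (normal_cell sg w) []) (insert_cell sg u (normalize sg w))"

context
  fixes S :: "'a::linorder set" and sg :: "'a \<Rightarrow> bit"
begin

interpretation coherence "Col3 S sg"
  by unfold_locales (rule extended_presentation_Col3)

private abbreviation (input) homotopic_Col3 (infix "\<approx>" 50) where "f \<approx> g \<equiv> homotopic f g"
private abbreviation (input) "P \<equiv> Col3 S sg"
private abbreviation (input) "\<gamma> \<equiv> gamma sg"
private abbreviation (input) "L \<equiv> lcol sg"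
private abbreviation (input) "R \<equiv> rcol sg"

lemma gamma_P [simp]:
  assumes "u \<in> scols S sg" "v \<in> scols S sg"
  shows "src2 P (\<gamma> u v) = colgen u @ colgen v"
    and "tgt2 P (\<gamma> u v) = colgen (L u v) @ colgen (R u v)"
    and "wf2 P (\<gamma> u v)"
  using assms by (simp_all add: src2_tgt2_Col3 wf2_Col3)

text \<open>The cells \<open>X\<close> extended to all triples of columns: when a step of one boundary is an identity,
  the braid relation for columns makes the corresponding step of the other one an identity.\<close>

lemma braid_homotopic:
  assumes s: "u \<in> scols S sg" "v \<in> scols S sg" "t \<in> scols S sg"
  shows "X_src sg u v t \<approx> X_tgt sg u v t"
proof -
  define e e' b b' w w' a a' where "e = L u v" and "e' = R u v" and "b = L e' t" and "b' = R e' t"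
    and "w = L v t" and "w' = R v t" and "a = L u w" and "a' = R u w"
  note defs = this
  have in_scols: "e \<in> scols S sg" "e' \<in> scols S sg" "b \<in> scols S sg" "b' \<in> scols S sg"
    "w \<in> scols S sg" "w' \<in> scols S sg" "a \<in> scols S sg" "a' \<in> scols S sg"
    using s by (simp_all add: defs)
  note br = braid_words[OF s, folded defs]
  define s1 s2 s3 where "s1 = Comp2_0 (\<gamma> u v) (Id2 (colgen t))"
    and "s2 = Comp2_0 (Id2 (colgen e)) (\<gamma> e' t)" and "s3 = Comp2_0 (\<gamma> e b) (Id2 (colgen b'))"
  define t1 t2 t3 where "t1 = Comp2_0 (Id2 (colgen u)) (\<gamma> v t)"
    and "t2 = Comp2_0 (\<gamma> u w) (Id2 (colgen w'))" and "t3 = Comp2_0 (Id2 (colgen a)) (\<gamma> a' w')"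
  have X: "X_src sg u v t = (s1 \<star> s2) \<star> s3" "X_tgt sg u v t = (t1 \<star> t2) \<star> t3"
    using s in_scols
    by (simp_all add: X_src_def X_tgt_def Let_def left_col_eq_lcol[of _ S] s1_def s2_def s3_def
        t1_def t2_def t3_def defs)
  have wf: "wf2 P s1" "wf2 P s2" "wf2 P s3" "wf2 P t1" "wf2 P t2" "wf2 P t3"
    using s in_scols by (simp_all add: s1_def s2_def s3_def t1_def t2_def t3_def del: in_lists_conv_set)
  have st: "tgt2 P s1 = src2 P s2" "tgt2 P s2 = src2 P s3" "tgt2 P t1 = src2 P t2" "tgt2 P t2 = src2 P t3"
    using s in_scols by (simp_all add: s1_def s2_def s3_def t1_def t2_def t3_def defs)
  have id: "Comp2_0 (\<gamma> x y) (Id2 (colgen z)) \<approx> Id2 (colgen x @ colgen y @ colgen z)"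
      "Comp2_0 (Id2 (colgen z)) (\<gamma> x y) \<approx> Id2 (colgen z @ colgen x @ colgen y)"
    if "x \<in> scols S sg" "y \<in> scols S sg" "z \<in> scols S sg" "x = [] \<or> y = [] \<or> juxtaposable sg x y"
    for x y z
    using Id_Id[of "colgen x @ colgen y" "colgen z"] Id_Id[of "colgen z" "colgen x @ colgen y"] that
    by (simp_all add: gamma_Id del: in_lists_conv_set)
  have drop_left: "(f \<star> g) \<star> h \<approx> g \<star> h" if "f \<approx> Id2 x" "wf2 P g" "wf2 P h" "tgt2 P f = src2 P g" "tgt2 P g = src2 P h" for f g h x
    using that by (intro homotopic_left identity_left) simp_all
  have drop_mid: "(f \<star> g) \<star> h \<approx> f \<star> h" if "g \<approx> Id2 x" "wf2 P f" "wf2 P h" "tgt2 P f = src2 P g" "tgt2 P g = src2 P h" for f g h x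
    using that by (intro homotopic_left identity_right) simp_all
  have drop_right: "(f \<star> g) \<star> h \<approx> f \<star> g" if "h \<approx> Id2 x" "wf2 P f" "wf2 P g" "tgt2 P f = src2 P g" "tgt2 P g = src2 P h" for f g h x
    using that by (intro identity_right) simp_all
  consider "u \<noteq> []" "v \<noteq> []" "t \<noteq> []" "\<not> juxtaposable sg u v" "\<not> juxtaposable sg v t"
    | "u \<noteq> []" "v \<noteq> []" "t \<noteq> []" "juxtaposable sg u v"
    | "u \<noteq> []" "v \<noteq> []" "t \<noteq> []" "juxtaposable sg v t"
    | "u = []" | "v = []" | "t = []" by blast
  then show ?thesis
  proof cases
    case 1
    then have "(u, v, t) \<in> cells3 P" using s by (simp add: columns_scols)
    then show ?thesis
      using X_src_hom2[OF s] X_tgt_hom2[OF s]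
      by (intro homotopicI[of "Gen3 (u, v, t)"]) (simp_all add: hom2_def wf2_Col3 eq2.refl)
  next
    case 2
    then have eq: "e = u" "e' = v" by (simp_all add: defs juxtaposable_lcol juxtaposable_rcol)
    \<comment> \<open>As \<open>e' = v\<close>, the common last column \<open>b'\<close> is
      \<open>w'\<close>; so the last step of the second boundary returns its right input and must be
      an identity.\<close>
    then have "R a' w' = w'" using br by (simp add: defs)
    then have "t3 \<approx> Id2 (colgen a @ colgen a' @ colgen w')"
      unfolding t3_def using in_scols rcol_eq_juxtaposable by (intro id) auto
    then have "(t1 \<star> t2) \<star> t3 \<approx> t1 \<star> t2" using wf st by (intro drop_right)
    moreover have "s1 \<approx> Id2 (colgen u @ colgen v @ colgen t)"
      unfolding s1_def using s 2 by (intro id) auto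
    then have "(s1 \<star> s2) \<star> s3 \<approx> s2 \<star> s3" using wf st by (intro drop_left)
    moreover have "s2 = t1" "s3 = t2" using eq by (simp_all add: s2_def s3_def t1_def t2_def defs)
    ultimately show ?thesis using X homotopic_trans homotopic_sym by metis
  next
    case 3
    then have eq: "w = v" "w' = t" by (simp_all add: defs juxtaposable_lcol juxtaposable_rcol)
    \<comment> \<open>Dually, the common first column is now \<open>e\<close>; so the last step of
      the first boundary returns its left input.\<close>
    then have "L e b = e" using br by (simp add: defs)
    then have "s3 \<approx> Id2 (colgen e @ colgen b @ colgen b')"
      unfolding s3_def using in_scols lcol_eq_juxtaposable by (intro id) auto
    then have "(s1 \<star> s2) \<star> s3 \<approx> s1 \<star> s2" using wf st by (intro drop_right)
    moreover have "t1 \<approx> Id2 (colgen u @ colgen v @ colgen t)"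
      unfolding t1_def using s 3 by (intro id) auto
    then have "(t1 \<star> t2) \<star> t3 \<approx> t2 \<star> t3" using wf st by (intro drop_left)
    moreover have "t2 = s1" "t3 = s2" using eq by (simp_all add: s1_def s2_def t2_def t3_def defs)
    ultimately show ?thesis using X homotopic_trans homotopic_sym by metis
  next
    case 4
    \<comment> \<open>If one column is empty, each boundary keeps a single step, the matching of the
      other two columns.\<close>
    have "s1 \<approx> Id2 (colgen u @ colgen v @ colgen t)" unfolding s1_def using s 4 by (intro id) auto
    then have "(s1 \<star> s2) \<star> s3 \<approx> s2 \<star> s3" using wf st by (intro drop_left)
    also have "s2 \<approx> Id2 (colgen e @ colgen e' @ colgen t)"
      unfolding s2_def using s in_scols 4 by (intro id) (auto simp: defs)
    then have "s2 \<star> s3 \<approx> s3" using wf st by (intro identity_left)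
    also have "s3 \<approx> \<gamma> v t" unfolding s3_def using s 4
      by (simp add: defs eq2_homotopic[OF eq2.right_unit_0])
    finally have 1: "X_src sg u v t \<approx> \<gamma> v t" using X by simp
    have "t3 \<approx> Id2 (colgen a @ colgen a' @ colgen w')"
      unfolding t3_def using in_scols 4 by (intro id) (auto simp: defs)
    then have "(t1 \<star> t2) \<star> t3 \<approx> t1 \<star> t2" using wf st by (intro drop_right)
    also have "t2 \<approx> Id2 (colgen u @ colgen w @ colgen w')"
      unfolding t2_def using s in_scols 4 by (intro id) auto
    then have "t1 \<star> t2 \<approx> t1" using wf st by (intro identity_right)
    also have "t1 \<approx> \<gamma> v t" unfolding t1_def using s 4
      by (simp add: eq2_homotopic[OF eq2.left_unit_0])
    finally have "X_tgt sg u v t \<approx> \<gamma> v t" using X by simp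
    with 1 show ?thesis using homotopic_trans homotopic_sym by blast
  next
    case 5
    have "s1 \<approx> Id2 (colgen u @ colgen v @ colgen t)" unfolding s1_def using s 5 by (intro id) auto
    then have "(s1 \<star> s2) \<star> s3 \<approx> s2 \<star> s3" using wf st by (intro drop_left)
    also have "s2 \<approx> Id2 (colgen e @ colgen e' @ colgen t)"
      unfolding s2_def using s in_scols 5 by (intro id) (auto simp: defs)
    then have "s2 \<star> s3 \<approx> s3" using wf st by (intro identity_left)
    also have "s3 \<approx> \<gamma> u t" unfolding s3_def using s 5
      by (simp add: defs eq2_homotopic[OF eq2.right_unit_0])
    finally have 1: "X_src sg u v t \<approx> \<gamma> u t" using X by simp
    have "t3 \<approx> Id2 (colgen a @ colgen a' @ colgen w')"
      unfolding t3_def using in_scols 5 by (intro id) (auto simp: defs)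
    then have "(t1 \<star> t2) \<star> t3 \<approx> t1 \<star> t2" using wf st by (intro drop_right)
    also have "t1 \<approx> Id2 (colgen u @ colgen v @ colgen t)"
      unfolding t1_def using s in_scols 5 by (intro id) auto
    then have "t1 \<star> t2 \<approx> t2" using wf st by (intro identity_left)
    also have "t2 \<approx> \<gamma> u t" unfolding t2_def using s 5
      by (simp add: defs eq2_homotopic[OF eq2.right_unit_0])
    finally have "X_tgt sg u v t \<approx> \<gamma> u t" using X by simp
    with 1 show ?thesis using homotopic_trans homotopic_sym by blast
  next
    case 6
    \<comment> \<open>Here \<open>b = e'\<close>, and \<open>e\<close>, \<open>e'\<close> are
      juxtaposable, being the output of a matching.\<close>
    have "s3 \<approx> Id2 (colgen e @ colgen b @ colgen b')"
      unfolding s3_def using s in_scols 6 by (intro id) (auto simp: defs juxtaposable_lcol_rcol)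
    then have "(s1 \<star> s2) \<star> s3 \<approx> s1 \<star> s2" using wf st by (intro drop_right)
    also have "s2 \<approx> Id2 (colgen e @ colgen e' @ colgen t)"
      unfolding s2_def using s in_scols 6 by (intro id) (auto simp: defs)
    then have "s1 \<star> s2 \<approx> s1" using wf st by (intro identity_right)
    also have "s1 \<approx> \<gamma> u v" unfolding s1_def using s 6
      by (simp add: defs eq2_homotopic[OF eq2.right_unit_0])
    finally have 1: "X_src sg u v t \<approx> \<gamma> u v" using X by simp
    have "t3 \<approx> Id2 (colgen a @ colgen a' @ colgen w')"
      unfolding t3_def using in_scols 6 by (intro id) (auto simp: defs)
    then have "(t1 \<star> t2) \<star> t3 \<approx> t1 \<star> t2" using wf st by (intro drop_right)
    also have "t1 \<approx> Id2 (colgen u @ colgen v @ colgen t)"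
      unfolding t1_def using s in_scols 6 by (intro id) auto
    then have "t1 \<star> t2 \<approx> t2" using wf st by (intro identity_left)
    also have "t2 \<approx> \<gamma> u v" unfolding t2_def using s 6
      by (simp add: defs eq2_homotopic[OF eq2.right_unit_0])
    finally have "X_tgt sg u v t \<approx> \<gamma> u v" using X by simp
    with 1 show ?thesis using homotopic_trans homotopic_sym by blast
  qed
qed

lemma insert_cell_simps [simp]:
  assumes "u \<in> scols S sg" "ts \<in> lists (columns S sg)"
  shows "src2 P (insert_cell sg u ts) = colgen u @ ts"
    and "tgt2 P (insert_cell sg u ts) = col_insert sg u ts"
    and "wf2 P (insert_cell sg u ts)"
proof -
  have "src2 P (insert_cell sg u ts) = colgen u @ ts \<and>
      tgt2 P (insert_cell sg u ts) = col_insert sg u ts \<and> wf2 P (insert_cell sg u ts)"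
    using assms
  proof (induction ts arbitrary: u)
    case (Cons t ts)
    then have "t \<in> scols S sg" "t \<noteq> []" by (simp_all add: columns_scols)
    then show ?case
      using Cons by (simp add: colgen_nonempty del: in_lists_conv_set) (simp add: colgen_def columns_scols)
  qed (simp del: in_lists_conv_set)
  then show "src2 P (insert_cell sg u ts) = colgen u @ ts"
    and "tgt2 P (insert_cell sg u ts) = col_insert sg u ts"
    and "wf2 P (insert_cell sg u ts)" by simp_all
qed

lemma lists_scols: "w \<in> lists (columns S sg) \<Longrightarrow> w \<in> lists (scols S sg)"
  by (auto simp: columns_scols)

lemma normalize_lists [simp]: "w \<in> lists (columns S sg) \<Longrightarrow> normalize sg w \<in> lists (columns S sg)"
  by (intro foldr_col_insert_columns lists_scols) simp_all

lemma normal_cell_simps [simp]: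
  assumes "w \<in> lists (columns S sg)"
  shows "src2 P (normal_cell sg w) = w" and "tgt2 P (normal_cell sg w) = normalize sg w"
    and "wf2 P (normal_cell sg w)"
proof -
  have "src2 P (normal_cell sg w) = w \<and> tgt2 P (normal_cell sg w) = normalize sg w \<and>
      wf2 P (normal_cell sg w)"
    using assms
  proof (induction w)
    case (Cons u w)
    then have "u \<in> scols S sg" "colgen u = [u]" by (auto simp: columns_scols colgen_def)
    then show ?case using Cons by (simp del: in_lists_conv_set)
  qed simp
  then show "src2 P (normal_cell sg w) = w" and "tgt2 P (normal_cell sg w) = normalize sg w"
    and "wf2 P (normal_cell sg w)" by simp_all
qed

lemma insert_cell_Nil: "ts \<in> lists (columns S sg) \<Longrightarrow> insert_cell sg [] ts \<approx> Id2 ts"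
proof (induction ts)
  case Nil
  then show ?case by (simp add: homotopic_refl)
next
  case (Cons t ts)
  then have t: "t \<in> scols S sg" "colgen t = [t]" "word [t]" "word ts"
    by (auto simp: columns_scols colgen_def)
  have "insert_cell sg [] (t # ts) \<approx> whisker [t] (insert_cell sg [] ts) []"
    using t whisker_Id[of "[]" "[t]" ts] identity_left[of "whisker [] (\<gamma> [] t) ts" "[] @ [t] @ ts"]
    by (simp add: gamma_Id del: in_lists_conv_set)
  also have "\<dots> \<approx> whisker [t] (Id2 ts) []"
    using Cons t by (intro homotopic_whisker) (simp_all del: in_lists_conv_set)
  also have "\<dots> \<approx> Id2 (t # ts)"
    using t whisker_Id[of "[t]" ts "[]"] by simp
  finally show ?case .
qed

lemma insert_cell_colgen:
  assumes "u \<in> scols S sg" "v \<in> scols S sg"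
  shows "insert_cell sg u (colgen v) \<approx> \<gamma> u v"
proof (cases "v = []")
  case True
  then show ?thesis using assms by (simp add: gamma_Id homotopic_refl del: in_lists_conv_set)
next
  case False
  let ?l = "colgen (L u v)" and ?r = "colgen (R u v)"
  have w: "word ?l" "word ?r" using assms by (simp_all del: in_lists_conv_set)
  have "insert_cell sg u (colgen v) = whisker [] (\<gamma> u v) [] \<star> whisker ?l (Id2 ?r) []"
    using False by (simp add: colgen_def)
  also have "\<dots> \<approx> whisker [] (\<gamma> u v) []"
    using whisker_Id[OF w, of "[]"] assms w
    by (intro identity_right[of _ "?l @ ?r"]) (simp_all del: in_lists_conv_set)
  also have "\<dots> \<approx> \<gamma> u v"
    using assms by (intro whisker_Nil) simp
  finally show ?thesis .
qed

lemma whisker_gamma: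
  assumes "x \<in> scols S sg" "y \<in> scols S sg" "z \<in> scols S sg" and ts: "word ts"
  shows "whisker [] (Comp2_0 (\<gamma> x y) (Id2 (colgen z))) ts \<approx> whisker [] (\<gamma> x y) (colgen z @ ts)"
    and "whisker [] (Comp2_0 (Id2 (colgen z)) (\<gamma> x y)) ts \<approx> whisker (colgen z) (\<gamma> x y) ts"
proof -
  note [simp del] = in_lists_conv_set
  have "whisker [] (Comp2_0 (\<gamma> x y) (Id2 (colgen z))) ts \<approx>
      whisker [] (whisker [] (\<gamma> x y) (colgen z)) ts"
    using assms by (intro homotopic_whisker homotopic_sym[OF whisker_right]) simp_all
  also have "\<dots> \<approx> whisker ([] @ []) (\<gamma> x y) (colgen z @ ts)"
    using assms by (intro whisker_whisker) simp_all
  finally show "whisker [] (Comp2_0 (\<gamma> x y) (Id2 (colgen z))) ts \<approx>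
      whisker [] (\<gamma> x y) (colgen z @ ts)" by simp
  have "whisker [] (Comp2_0 (Id2 (colgen z)) (\<gamma> x y)) ts \<approx>
      whisker [] (whisker (colgen z) (\<gamma> x y) []) ts"
    using assms by (intro homotopic_whisker homotopic_sym[OF whisker_left]) simp_all
  also have "\<dots> \<approx> whisker ([] @ colgen z) (\<gamma> x y) ([] @ ts)"
    using assms by (intro whisker_whisker) simp_all
  finally show "whisker [] (Comp2_0 (Id2 (colgen z)) (\<gamma> x y)) ts \<approx>
      whisker (colgen z) (\<gamma> x y) ts" by simp
qed

lemma whisker_three:
  assumes "wf2 P f" "wf2 P g" "wf2 P h" "tgt2 P f = src2 P g" "tgt2 P g = src2 P h" "word ts"
    and "whisker [] f ts \<approx> f'" "whisker [] g ts \<approx> g'" "whisker [] h ts \<approx> h'"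
  shows "whisker [] ((f \<star> g) \<star> h) ts \<approx> f' \<star> g' \<star> h'"
proof -
  note [simp del] = in_lists_conv_set
  have "whisker [] ((f \<star> g) \<star> h) ts \<approx> whisker [] (f \<star> g \<star> h) ts"
    using assms by (intro homotopic_whisker homotopic_assoc) simp_all
  also have "\<dots> \<approx> whisker [] f ts \<star> whisker [] (g \<star> h) ts"
    using assms by (intro whisker_vcomp) simp_all
  also have "\<dots> \<approx> whisker [] f ts \<star> whisker [] g ts \<star> whisker [] h ts"
    using assms by (intro homotopic_right whisker_vcomp) simp_all
  also have "\<dots> \<approx> f' \<star> g' \<star> h'"
    using assms by (intro homotopic_1) simp_all
  finally show ?thesis .
qed

lemma whisker_braid:
  assumes s: "u \<in> scols S sg" "v \<in> scols S sg" "t \<in> scols S sg" and ts: "word ts"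
  defines "e \<equiv> L u v" and "e' \<equiv> R u v" and "w \<equiv> L v t" and "w' \<equiv> R v t"
  shows "whisker [] (\<gamma> u v) (colgen t @ ts) \<star> whisker (colgen e) (\<gamma> e' t) ts \<star>
      whisker [] (\<gamma> e (L e' t)) (colgen (R e' t) @ ts) \<approx>
    whisker (colgen u) (\<gamma> v t) ts \<star> whisker [] (\<gamma> u w) (colgen w' @ ts) \<star>
      whisker (colgen (L u w)) (\<gamma> (R u w) w') ts"
    (is "?src \<approx> ?tgt")
proof -
  note [simp del] = in_lists_conv_set
  have c: "e \<in> scols S sg" "e' \<in> scols S sg" "w \<in> scols S sg" "w' \<in> scols S sg"
    using s by (simp_all add: e_def e'_def w_def w'_def)
  have "whisker [] (X_src sg u v t) ts \<approx> ?src"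
    unfolding X_src_def Let_def
    using s c ts
    by (simp add: left_col_eq_lcol[of _ S] flip: e_def e'_def)
      (intro whisker_three whisker_gamma; simp add: e_def e'_def)
  moreover have "whisker [] (X_tgt sg u v t) ts \<approx> ?tgt"
    unfolding X_tgt_def Let_def
    using s c ts
    by (simp add: left_col_eq_lcol[of _ S] flip: w_def w'_def)
      (intro whisker_three whisker_gamma; simp add: w_def w'_def)
  moreover have "whisker [] (X_src sg u v t) ts \<approx> whisker [] (X_tgt sg u v t) ts"
    using s ts by (intro homotopic_whisker braid_homotopic) simp_all
  ultimately show ?thesis using homotopic_trans homotopic_sym by blast
qed

text \<open>The lift of \<open>col_insert_col_insert\<close> to 2-cells.
  \<open>insertion_exchange\<close> collects the steps that involve \<open>t\<close>, the induction
  hypothesis supplies the third step of the boundary, \<open>whisker_braid\<close> passes to the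
  other boundary, and a second exchange redistributes its steps over the two insertions.\<close>

lemma insert_cell_braid:
  assumes "u \<in> scols S sg" "v \<in> scols S sg" "word ts"
  shows "whisker (colgen u) (insert_cell sg v ts) [] \<star> insert_cell sg u (col_insert sg v ts) \<approx>
    whisker [] (\<gamma> u v) ts \<star> whisker (colgen (L u v)) (insert_cell sg (R u v) ts) [] \<star>
      insert_cell sg (L u v) (col_insert sg (R u v) ts)"
  using assms
proof (induction ts arbitrary: u v)
  case Nil
  note [simp del] = in_lists_conv_set
  let ?e = "L u v" and ?e' = "R u v"
  have c: "?e \<in> scols S sg" "?e' \<in> scols S sg" using Nil by simp_all
  have wI: "whisker (colgen x) (Id2 (colgen y)) [] \<approx> Id2 (colgen x @ colgen y @ [])"
    if "x \<in> scols S sg" "y \<in> scols S sg" for x y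
    using that by (intro whisker_Id) simp_all
  have "whisker (colgen u) (insert_cell sg v []) [] \<star> insert_cell sg u (col_insert sg v []) \<approx>
      insert_cell sg u (colgen v)"
    using Nil by (simp add: identity_left[OF wI])
  also have "\<dots> \<approx> \<gamma> u v" using Nil by (intro insert_cell_colgen)
  also have "\<dots> \<approx> whisker [] (\<gamma> u v) []"
    using Nil by (intro homotopic_sym[OF whisker_Nil]) simp
  also have "\<dots> \<approx> whisker [] (\<gamma> u v) [] \<star>
      whisker (colgen ?e) (insert_cell sg ?e' []) [] \<star> insert_cell sg ?e (col_insert sg ?e' [])"
  proof -
    have "insert_cell sg ?e (colgen ?e') \<approx> \<gamma> ?e ?e'" using c by (intro insert_cell_colgen)
    then have "insert_cell sg ?e (colgen ?e') \<approx> Id2 (colgen ?e @ colgen ?e')"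
      using juxtaposable_lcol_rcol[OF Nil(1,2)] by (simp add: gamma_Id)
    moreover have "whisker (colgen ?e) (Id2 (colgen ?e')) [] \<star> insert_cell sg ?e (colgen ?e') \<approx>
        insert_cell sg ?e (colgen ?e')"
      using c by (intro identity_left[OF wI]) simp_all
    ultimately have "whisker (colgen ?e) (Id2 (colgen ?e')) [] \<star> insert_cell sg ?e (colgen ?e') \<approx>
        Id2 (colgen ?e @ colgen ?e')"
      using homotopic_trans by blast
    then show ?thesis
      using Nil c by (intro homotopic_sym[OF identity_right]) simp_all
  qed
  finally show ?case .
next
  case (Cons t ts)
  note [simp del] = in_lists_conv_set
  define e e' b b' w w' a a' d Y Z where "e = L u v" and "e' = R u v" and "b = L e' t" and "b' = R e' t"
    and "w = L v t" and "w' = R v t" and "a = L u w" and "a' = R u w" and "d = L a' w'"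
    and "Y = col_insert sg w' ts" and "Z = col_insert sg b' ts"
  note defs = this
  have t: "t \<in> scols S sg" "t \<noteq> []" "word ts" "colgen t = [t]" "word (t # ts)"
    using Cons.prems by (simp_all add: columns_scols colgen_nonempty)
  note s = Cons.prems(1,2) t(1)
  have c [simp]: "u \<in> scols S sg" "v \<in> scols S sg" "t \<in> scols S sg" "ts \<in> lists (columns S sg)"
    "e \<in> scols S sg" "e' \<in> scols S sg" "b \<in> scols S sg" "b' \<in> scols S sg"
    "w \<in> scols S sg" "w' \<in> scols S sg" "a \<in> scols S sg" "a' \<in> scols S sg" "d \<in> scols S sg"
    "Y \<in> lists (columns S sg)" "Z \<in> lists (columns S sg)"
    using s t by (simp_all add: defs)
  have br: "L e b = a" "R e b = d" "R a' w' = b'"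
    using braid_words[OF s] by (simp_all add: defs)
  have wb: "colgen w = [w]" "colgen b = [b]" using t by (simp_all add: defs colgen_nonempty)
  \<comment> \<open>\<open>M\<close> is what both sides still have to do after the three steps of a
    boundary: insert \<open>b'\<close> into \<open>ts\<close> and then \<open>d\<close> into the
    result.\<close>
  define J K M where "J = insert_cell sg w' ts" and "K = insert_cell sg a' Y"
    and "M = whisker (colgen a @ colgen d) (insert_cell sg b' ts) [] \<star> whisker (colgen a) (insert_cell sg d Z) []"
  have J [simp]: "wf2 P J" "src2 P J = colgen w' @ ts" "tgt2 P J = Y" by (simp_all add: J_def Y_def)
  have K [simp]: "wf2 P K" "src2 P K = colgen a' @ Y" "tgt2 P K = col_insert sg a' Y" by (simp_all add: K_def)
  have M [simp]: "wf2 P M" "src2 P M = colgen a @ colgen d @ colgen b' @ ts"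
    by (simp_all add: M_def Z_def)
  have [simp]: "L u w = a" "R u w = a'" "L v t = w" "R v t = w'" "L e' t = b" "R e' t = b'"
    "L a' w' = d" "L u v = e" "R u v = e'" "L e b = a" "R e b = d" "R a' w' = b'"
    using br by (simp_all add: defs)
  have ic: "insert_cell sg v (t # ts) = whisker [] (\<gamma> v t) ts \<star> whisker (colgen w) J []"
    "insert_cell sg e' (t # ts) = whisker [] (\<gamma> e' t) ts \<star> whisker (colgen b) (insert_cell sg b' ts) []"
    "col_insert sg v (t # ts) = w # Y" "col_insert sg e' (t # ts) = b # Z"
    by (simp_all add: J_def Y_def Z_def wb)
  have ic': "insert_cell sg u (w # Y) = whisker [] (\<gamma> u w) Y \<star> whisker (colgen a) K []"
    "insert_cell sg e (b # Z) = whisker [] (\<gamma> e b) Z \<star> whisker (colgen a) (insert_cell sg d Z) []"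
    by (simp_all add: K_def)

  have "whisker (colgen u) (insert_cell sg v (t # ts)) [] \<star> insert_cell sg u (w # Y) \<approx>
      whisker (colgen u) (\<gamma> v t) ts \<star> whisker [] (\<gamma> u w) (colgen w' @ ts) \<star>
      whisker (colgen a @ colgen a') J [] \<star> whisker (colgen a) K []"
    using insertion_exchange[of "\<gamma> u w" "\<gamma> v t" J K "colgen u" "colgen w" "colgen a" "colgen a'" ts]
    unfolding ic ic' by simp
  also have "\<dots> \<approx> whisker (colgen u) (\<gamma> v t) ts \<star> whisker [] (\<gamma> u w) (colgen w' @ ts) \<star>
      whisker (colgen a) (\<gamma> a' w') ts \<star> M"
  proof -
    have "whisker (colgen a @ colgen a') J [] \<star> whisker (colgen a) K [] \<approx>
        whisker (colgen a) (whisker (colgen a') J [] \<star> K) []"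
      by (intro homotopic_sym[OF whisker_pair]) simp_all
    \<comment> \<open>\<open>J\<close> and \<open>K\<close> insert \<open>w'\<close> into
      \<open>ts\<close> and then \<open>a'\<close> into the result, which is the left-hand side of
      the induction hypothesis for the pair \<open>a'\<close>, \<open>w'\<close>.\<close>
    also have "\<dots> \<approx> whisker (colgen a) (whisker [] (\<gamma> a' w') ts \<star>
        whisker (colgen d) (insert_cell sg b' ts) [] \<star> insert_cell sg d Z) []"
      using Cons.IH[of a' w'] by (intro homotopic_whisker) (simp_all add: J_def K_def Y_def Z_def)
    also have "\<dots> \<approx> whisker (colgen a @ []) (\<gamma> a' w') ts \<star>
        whisker (colgen a) (whisker (colgen d) (insert_cell sg b' ts) [] \<star> insert_cell sg d Z) []"
      by (intro whisker_pair) (simp_all add: Z_def)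
    also have "\<dots> \<approx> whisker (colgen a @ []) (\<gamma> a' w') ts \<star> M"
      unfolding M_def by (intro homotopic_right whisker_pair) (simp_all add: Z_def)
    finally have "whisker (colgen a @ colgen a') J [] \<star> whisker (colgen a) K [] \<approx>
        whisker (colgen a) (\<gamma> a' w') ts \<star> M" by simp
    then show ?thesis by (intro homotopic_right) simp_all
  qed
  also have "\<dots> \<approx> (whisker (colgen u) (\<gamma> v t) ts \<star> whisker [] (\<gamma> u w) (colgen w' @ ts) \<star>
      whisker (colgen a) (\<gamma> a' w') ts) \<star> M"
    by (intro homotopic_sym[OF homotopic_assoc3]) simp_all
  also have "\<dots> \<approx> (whisker [] (\<gamma> u v) (colgen t @ ts) \<star> whisker (colgen e) (\<gamma> e' t) ts \<star>
      whisker [] (\<gamma> e b) (colgen b' @ ts)) \<star> M"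
    using homotopic_sym[OF whisker_braid[OF s, of ts]] by (intro homotopic_left) simp_all
  also have "\<dots> \<approx> whisker [] (\<gamma> u v) (colgen t @ ts) \<star> whisker (colgen e) (\<gamma> e' t) ts \<star>
      whisker [] (\<gamma> e b) (colgen b' @ ts) \<star> M"
    by (intro homotopic_assoc3) simp_all
  also have "\<dots> \<approx> whisker [] (\<gamma> u v) (t # ts) \<star>
      whisker (colgen e) (insert_cell sg e' (t # ts)) [] \<star> insert_cell sg e (b # Z)"
  proof -
    have "whisker (colgen e) (insert_cell sg e' (t # ts)) [] \<star> insert_cell sg e (b # Z) \<approx>
        whisker (colgen e) (\<gamma> e' t) ts \<star> whisker [] (\<gamma> e b) (colgen b' @ ts) \<star> M"
      using insertion_exchange[of "\<gamma> e b" "\<gamma> e' t" "insert_cell sg b' ts" "insert_cell sg d Z"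
          "colgen e" "colgen b" "colgen a" "colgen d" ts]
      unfolding ic ic' M_def by (simp add: Z_def)
    moreover have "t \<in> columns S sg" using Cons.prems by simp
    ultimately show ?thesis
      using homotopic_right[OF _ homotopic_sym, of "whisker [] (\<gamma> u v) (t # ts)"] t(4) by simp
  qed
  finally show ?case unfolding ic(3) using ic(4) by simp
qed

lemma normal_cell_colgen:
  assumes "u \<in> scols S sg" "w \<in> lists (columns S sg)"
  shows "normal_cell sg (colgen u @ w) \<approx>
    whisker (colgen u) (normal_cell sg w) [] \<star> insert_cell sg u (normalize sg w)"
proof (cases "u = []")
  case True
  note [simp del] = in_lists_conv_set foldr_append
  have "normal_cell sg w \<approx> whisker [] (normal_cell sg w) []"
    using assms by (intro homotopic_sym[OF whisker_Nil]) simp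
  also have "\<dots> \<approx> whisker [] (normal_cell sg w) [] \<star> insert_cell sg [] (normalize sg w)"
    using assms by (intro homotopic_sym[OF identity_right[OF insert_cell_Nil]]) simp_all
  finally show ?thesis using True by simp
next
  case False
  note [simp del] = in_lists_conv_set foldr_append
  have "u \<in> columns S sg" using False assms by (simp add: columns_scols)
  then show ?thesis using False assms by (simp add: colgen_nonempty homotopic_refl)
qed

lemma normalize_colgen:
  "w \<in> lists (columns S sg) \<Longrightarrow> normalize sg (colgen u @ w) = col_insert sg u (normalize sg w)"
  using col_insert_Nil[OF normalize_lists, of w] by (simp add: colgen_def del: in_lists_conv_set)

lemma normal_cell_colgen2:
  assumes "u \<in> scols S sg" "v \<in> scols S sg" "w \<in> lists (columns S sg)"
  shows "normal_cell sg (colgen u @ colgen v @ w) \<approx>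
    whisker (colgen u @ colgen v) (normal_cell sg w) [] \<star>
    whisker (colgen u) (insert_cell sg v (normalize sg w)) [] \<star>
    insert_cell sg u (col_insert sg v (normalize sg w))"
proof -
  note [simp del] = in_lists_conv_set foldr_append
  let ?N = "normalize sg w" and ?n = "normal_cell sg w"
  have vw: "colgen v @ w \<in> lists (columns S sg)" using assms by simp
  have "normal_cell sg (colgen u @ colgen v @ w) \<approx>
      whisker (colgen u) (normal_cell sg (colgen v @ w)) [] \<star> insert_cell sg u (col_insert sg v ?N)"
    using normal_cell_colgen[OF assms(1) vw] by (simp add: normalize_colgen[OF assms(3)])
  also have "\<dots> \<approx> whisker (colgen u) (whisker (colgen v) ?n [] \<star> insert_cell sg v ?N) [] \<star>
      insert_cell sg u (col_insert sg v ?N)"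
    using assms vw normalize_colgen[OF assms(3), of v]
    by (intro homotopic_left homotopic_whisker normal_cell_colgen) simp_all
  also have "\<dots> \<approx> (whisker (colgen u @ colgen v) ?n [] \<star> whisker (colgen u) (insert_cell sg v ?N) []) \<star>
      insert_cell sg u (col_insert sg v ?N)"
    using assms by (intro homotopic_left whisker_pair) simp_all
  also have "\<dots> \<approx> whisker (colgen u @ colgen v) ?n [] \<star> whisker (colgen u) (insert_cell sg v ?N) [] \<star>
      insert_cell sg u (col_insert sg v ?N)"
    using assms by (intro homotopic_assoc) simp_all
  finally show ?thesis .
qed

text \<open>For empty \<open>l\<close> the rule and the normalization of \<open>w\<close> act on
  disjoint factors; after exchanging them, \<open>insert_cell_braid\<close> applies to the normal
  form of \<open>w\<close>. Columns on the left only whisker this homotopy and append an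
  insertion.\<close>

lemma normal_cell_gamma:
  assumes "u \<in> scols S sg" "v \<in> scols S sg" "w \<in> lists (columns S sg)" "l \<in> lists (columns S sg)"
  shows "whisker l (\<gamma> u v) w \<star> normal_cell sg (l @ colgen (L u v) @ colgen (R u v) @ w) \<approx>
    normal_cell sg (l @ colgen u @ colgen v @ w)"
  using assms(4)
proof (induction l)
  case Nil
  note [simp del] = in_lists_conv_set foldr_append
  let ?N = "normalize sg w" and ?n = "normal_cell sg w" and ?e = "L u v" and ?e' = "R u v"
  have c: "?e \<in> scols S sg" "?e' \<in> scols S sg" using assms by simp_all
  let ?i = "whisker (colgen ?e) (insert_cell sg ?e' ?N) [] \<star> insert_cell sg ?e (col_insert sg ?e' ?N)"
  have "whisker [] (\<gamma> u v) w \<star> normal_cell sg (colgen ?e @ colgen ?e' @ w) \<approx>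
      whisker [] (\<gamma> u v) w \<star> whisker (colgen ?e @ colgen ?e') ?n [] \<star> ?i"
    using assms c by (intro homotopic_right normal_cell_colgen2) simp_all
  also have "\<dots> \<approx> (whisker [] (\<gamma> u v) w \<star> whisker (colgen ?e @ colgen ?e') ?n []) \<star> ?i"
    using assms c by (intro homotopic_sym[OF homotopic_assoc]) simp_all
  also have "\<dots> \<approx> (whisker (colgen u @ colgen v) ?n [] \<star> whisker [] (\<gamma> u v) ?N) \<star> ?i"
    using assms c homotopic_sym[OF exchange[of "\<gamma> u v" ?n]] by (intro homotopic_left) simp_all
  also have "\<dots> \<approx> whisker (colgen u @ colgen v) ?n [] \<star> whisker [] (\<gamma> u v) ?N \<star> ?i"
    using assms c by (intro homotopic_assoc) simp_all
  also have "\<dots> \<approx> whisker (colgen u @ colgen v) ?n [] \<star>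
      whisker (colgen u) (insert_cell sg v ?N) [] \<star> insert_cell sg u (col_insert sg v ?N)"
    using assms c by (intro homotopic_right homotopic_sym[OF insert_cell_braid]) simp_all
  also have "\<dots> \<approx> normal_cell sg (colgen u @ colgen v @ w)"
    using assms by (intro homotopic_sym[OF normal_cell_colgen2])
  finally show ?case by simp
next
  case (Cons c l)
  note [simp del] = in_lists_conv_set foldr_append
  let ?x = "l @ colgen u @ colgen v @ w" and ?y = "l @ colgen (L u v) @ colgen (R u v) @ w"
  let ?g = "whisker l (\<gamma> u v) w"
  have c: "c \<in> columns S sg" "c \<in> scols S sg" "l \<in> lists (columns S sg)" "colgen c = [c]"
    using Cons by (simp_all add: columns_scols colgen_nonempty)
  have xy: "?x \<in> lists (columns S sg)" "?y \<in> lists (columns S sg)" using assms c by simp_all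
  have IH: "?g \<star> normal_cell sg ?y \<approx> normal_cell sg ?x" using Cons by simp
  \<comment> \<open>Homotopic 2-cells have the same target, so the induction hypothesis also tells
    that both words have the same normal form, and \<open>c\<close> is inserted into the same word
    on both sides.\<close>
  from homotopic_tgt[OF this] have N: "normalize sg ?y = normalize sg ?x"
    using xy by simp
  let ?i = "insert_cell sg c (normalize sg ?x)"
  have "whisker (c # l) (\<gamma> u v) w \<star> normal_cell sg (c # ?y) =
      whisker (c # l) (\<gamma> u v) w \<star> whisker [c] (normal_cell sg ?y) [] \<star> ?i"
    by (simp only: normal_cell.simps N)
  also have "\<dots> \<approx> (whisker (c # l) (\<gamma> u v) w \<star> whisker [c] (normal_cell sg ?y) []) \<star> ?i"
    using assms c xy N by (intro homotopic_sym[OF homotopic_assoc]) simp_all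
  also have "\<dots> \<approx> whisker [c] (?g \<star> normal_cell sg ?y) [] \<star> ?i"
    using assms c xy N homotopic_sym[OF whisker_pair[of "\<gamma> u v" "normal_cell sg ?y" "[c]" l w]]
    by (intro homotopic_left) simp_all
  also have "\<dots> \<approx> whisker [c] (normal_cell sg ?x) [] \<star> ?i"
    using assms c xy N by (intro homotopic_left homotopic_whisker IH) simp_all
  finally show ?case by simp
qed

lemma homotopy_basis_Col3: "homotopy_basis P"
proof (rule homotopy_basis_natural[of "normal_cell sg"])
  fix r l w assume *: "r \<in> rules P" "word l" "word w"
  note [simp del] = in_lists_conv_set foldr_append
  obtain u v where r: "r = (u, v)" by (cases r)
  then have uv: "u \<in> scols S sg" "v \<in> scols S sg" and "\<gamma> u v = Gen2 r"
    using * by (auto simp: columns_scols gamma_def)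
  then show "whisker l (Gen2 r) w \<star> normal_cell sg (l @ rtgt P r @ w) \<approx> normal_cell sg (l @ rsrc P r @ w)"
    using normal_cell_gamma[OF uv, of w l] * r by (simp add: left_col_eq_lcol[OF uv])
qed simp

end

theorem theorem3p1:
  fixes S :: "'a::linorder set" and sg :: "'a \<Rightarrow> bit"
  assumes "countable S"
  shows "(\<forall>(u, v, t)\<in>cells3 (Col3 S sg). X_shape S sg u v t) \<and>
    coherent_presentation (Col3 S sg) (super_plactic S sg)"
proof
  show "\<forall>(u, v, t)\<in>cells3 (Col3 S sg). X_shape S sg u v t"
    using Col3_shape[of _ S sg] by auto
  show "coherent_presentation (Col3 S sg) (super_plactic S sg)"
    unfolding coherent_presentation_def
    using extended_presentation_Col3 polygraph_monoid_Col2_iso[of S sg] homotopy_basis_Col3[of S sg]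
    by (simp add: polygraph_monoid_Col3)
qed

end
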